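(* Let $(Y,Y^\diamond)$ be a norming dual pair such that $(Y,\sigma(Y,Y^\diamond))$ is sequentially complete and such that every sequentially continuous linear map $(Y,\sigma(Y,Y^\diamond))\to\mathbb R$ is continuous. Let $\{S_0(t)\}_{t\ge0}$ be a twin semigroup on $(Y,Y^\diamond)$ with generator $C_0$, and let $q_1,\dots,q_n\in Y$, $Q_1^\diamond,\dots,Q_n^\diamond\in Y^\diamond$ be such that each function $t\mapsto K_{ij}(t):=Q_i^\diamond(S_0(t)-I)q_j$ belongs to $NBV_{loc}([0,\infty);\mathbb R)$ and is continuous at $t=0$. Let $R$ be the resolvent of $K$. Let $V_0(t):Y\to\mathbb R^n$, $(V_0(t)y)_i=Q_i^\diamond(S_0(t)-I)y$, for $t\ge 0$, and let $W_0(t):Y^\diamond\to\mathbb R^n$ be defined by $(y^\diamond W_0(t))_j=y^\diamond S_0(t)q_j$ for $t>0$ and $W_0(0)=0$. Assume that $t\mapsto y^\diamond W_0(t)$ belongs to $NBV_{loc}([0,\infty);\mathbb R^n)$ for all $y^\diamond\in Y^\diamond$. Define $W(0)=0$ and, for $t>0$, $$y^\diamond W(t)=y^\diamond W_0(t)+\int_{[0,t]}y^\diamond W_0(t-\tau)\,R(d\tau)$$ ($y^\diamond W_0$ a row vector), where at $\tau=t$ the integrand is $y^\diamond W_0(0+)$, i.e. $y^\diamond W(t)=(\mu_{y^\diamond W_0}+\mu_{y^\diamond W_0}\ast\mu_R)([0,t])$. Then $t\mapsto y^\diamond W(t)$ belongs to $NBV_{loc}([0,\infty);\mathbb R^n)$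 for all $y^\diamond\in Y^\diamond$, and $$S(0)=I,\qquad y^\diamond S(t)y=y^\diamond S_0(t)y+\sum_{j=1}^n\int_{[0,t]}y^\diamond W_j(d\tau)\;(V_0(t-\tau)y)_j\qquad (t>0,\ y\in Y,\ y^\diamond\in Y^\diamond)$$ defines a twin semigroup $\{S(t)\}_{t\ge0}$ on $(Y,Y^\diamond)$ with generator $C$ given by $$\mathcal D(C)=\mathcal D(C_0),\qquad Cy=C_0y+\sum_{j=1}^n\langle Q_j^\diamond,C_0y\rangle\,q_j .$$
   Context: Spaces are real; for non-real $\lambda$ complexifications are used. Banach spaces $Y,Y^\diamond$ form a norming dual pair if there is a bilinear map $\langle\cdot,\cdot\rangle:Y^\diamond\times Y\to\mathbb R$ with $|\langle y^\diamond,y\rangle|\le M\|y^\diamond\|\|y\|$ for some $M\ge1$, $\|y\|=\sup\{|\langle y^\diamond,y\rangle|:\|y^\diamond\|\le1\}$ and $\|y^\diamond\|=\sup\{|\langle y^\diamond,y\rangle|:\|y\|\le1\}$. $\sigma(Y,Y^\diamond)$ is the weak topology on $Y$ induced by $Y^\diamond$. A twin operator $L$ is a bounded bilinear map $Y^\diamond\times Y\to\mathbb R$, $(y^\diamond,y)\mapsto y^\diamond Ly$, such that for each $y$ there is $Ly\in Y$ with $\langle y^\diamond,Ly\rangle=y^\diamond Ly$ for all $y^\diamond$, and for each $y^\diamond$ there is $y^\diamond L\in Y^\diamond$ with $\langle y^\diamond L,y\rangle=y^\diamond Ly$ for all $y$. Composition: $y^\diamond L_1L_2y:=\langle y^\diamond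 L_1,L_2y\rangle$. A twin semigroup is a family $\{S(t)\}_{t\ge0}$ of twin operators with: (i) $S(0)=I$, $S(t+s)=S(t)S(s)$; (ii) $|y^\diamond S(t)y|\le Me^{\omega t}\|y\|\|y^\diamond\|$ for some $M\ge1,\omega\in\mathbb R$; (iii) $t\mapsto y^\diamond S(t)y$ is (Borel) measurable for all $y,y^\diamond$; (iv) for $\operatorname{Re}\lambda>\omega$ there is a twin operator $\overline S(\lambda)$ with $y^\diamond\overline S(\lambda)y=\int_0^\infty e^{-\lambda t}y^\diamond S(t)y\,dt$. Its generator is the (possibly multi-valued) linear operator $C$ on $Y$ with $(\lambda I-C)^{-1}=\overline S(\lambda)$, i.e. $y\in\mathcal D(C)$ and $z\in Cy$ iff $y=\overline S(\lambda)(\lambda y-z)$ (independent of $\lambda$). $NBV_{loc}([0,\infty))$ consists of the functions $F$ on $[0,\infty)$ of locally bounded variation, with $F(0)=0$ and $F$ right-continuous on $(0,\infty)$; $\mu_F$ (also written $F(d\tau)$) is the Radon measure on $[0,\infty)$ with $\mu_F([0,t])=F(t)$ for $t>0$ (so $\mu_F(\{0\})=F(0+)$). The resolvent $R$ of $K$ is the unique matrix-valued function in $NBV_{loc}$ with $\mu_R=\mu_K+\mu_K\ast\mu_R=\mu_K+\mu_R\ast\mu_K$ ($\ast$ is convolution of measures). If $C_0$ is multi-valued, $Cy$ means $\{z+\sum_j\langle Q_j^\diamond,z\rangle q_j: z\in C_0y\}$. *)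

theory Defs
  imports "HOL-Analysis.Analysis"
begin

section \<open>Norming dual pairs and the weak topology\<close>

text \<open>The pairing and all twin operators are bilinear forms whose first argument ranges over
  the partner space (type \<open>'b\<close>) and whose second argument ranges over the space itself
  (type \<open>'a\<close>).\<close>

definition norming_dual_pair :: "('b::banach \<Rightarrow> 'a::banach \<Rightarrow> real) \<Rightarrow> bool" where
  "norming_dual_pair p \<longleftrightarrow>
     bounded_bilinear p \<and>
     (\<forall>y. norm y = (SUP y'\<in>cball 0 1. \<bar>p y' y\<bar>)) \<and>
     (\<forall>y'. norm y' = (SUP y\<in>cball 0 1. \<bar>p y' y\<bar>))"

definition pairing_topology :: "('b \<Rightarrow> 'a \<Rightarrow> real) \<Rightarrow> 'a topology" where
  "pairing_topology p = topology_generated_by {{y. p y' y \<in> U} | y' U. open U}"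

definition sequentially_complete :: "'a::real_vector topology \<Rightarrow> bool" where
  "sequentially_complete T \<longleftrightarrow>
     (\<forall>x :: nat \<Rightarrow> 'a.
        (\<forall>U. openin T U \<and> 0 \<in> U \<longrightarrow> (\<exists>N. \<forall>m\<ge>N. \<forall>n\<ge>N. x m - x n \<in> U)) \<longrightarrow>
        (\<exists>l. limitin T x l sequentially))"

definition seq_continuous_functional :: "'a topology \<Rightarrow> ('a \<Rightarrow> real) \<Rightarrow> bool" where
  "seq_continuous_functional T \<phi> \<longleftrightarrow>
     (\<forall>x l. limitin T x l sequentially \<longrightarrow> (\<lambda>n::nat. \<phi> (x n)) \<longlonglongrightarrow> \<phi> l)"


section \<open>Twin operators and twin semigroups\<close>

definition twin_operator ::
    "('b::real_normed_vector \<Rightarrow> 'a::real_normed_vector \<Rightarrow> real) \<Rightarrow> ('b \<Rightarrow> 'a \<Rightarrow> real) \<Rightarrow> bool" where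
  "twin_operator p L \<longleftrightarrow>
     bounded_bilinear L \<and>
     (\<forall>y. \<exists>z. \<forall>y'. p y' z = L y' y) \<and>
     (\<forall>y'. \<exists>z'. \<forall>y. p z' y = L y' y)"

text \<open>For a norming dual pair the representing elements are unique.\<close>

definition twin_right :: "('b \<Rightarrow> 'a \<Rightarrow> real) \<Rightarrow> ('b \<Rightarrow> 'a \<Rightarrow> real) \<Rightarrow> 'a \<Rightarrow> 'a" where
  "twin_right p L y = (THE z. \<forall>y'. p y' z = L y' y)"

definition twin_left :: "('b \<Rightarrow> 'a \<Rightarrow> real) \<Rightarrow> ('b \<Rightarrow> 'a \<Rightarrow> real) \<Rightarrow> 'b \<Rightarrow> 'b" where
  "twin_left p L y' = (THE z'. \<forall>y. p z' y = L y' y)"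

definition twin_comp ::
    "('b \<Rightarrow> 'a \<Rightarrow> real) \<Rightarrow> ('b \<Rightarrow> 'a \<Rightarrow> real) \<Rightarrow> ('b \<Rightarrow> 'a \<Rightarrow> real) \<Rightarrow> 'b \<Rightarrow> 'a \<Rightarrow> real" where
  "twin_comp p L\<^sub>1 L\<^sub>2 y' y = p (twin_left p L\<^sub>1 y') (twin_right p L\<^sub>2 y)"

text \<open>The complexification of a real vector space is represented by the pairs \<open>(x, y)\<close>,
  read as \<open>x + i y\<close>.  The product norm is not homogeneous over the complex numbers, but
  it is equivalent to the usual complexification norms, so boundedness is not affected.
  Real bilinear forms are extended complex-bilinearly.\<close>

definition complex_scale :: "complex \<Rightarrow> 'a::real_vector \<times> 'a \<Rightarrow> 'a \<times> 'a" where
  "complex_scale c u =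
     (Re c *\<^sub>R fst u - Im c *\<^sub>R snd u, Re c *\<^sub>R snd u + Im c *\<^sub>R fst u)"

definition complexify :: "('b \<Rightarrow> 'a \<Rightarrow> real) \<Rightarrow> 'b \<times> 'b \<Rightarrow> 'a \<times> 'a \<Rightarrow> complex" where
  "complexify L u' u =
     Complex (L (fst u') (fst u) - L (snd u') (snd u)) (L (fst u') (snd u) + L (snd u') (fst u))"

definition complex_twin_operator ::
    "('b::real_normed_vector \<Rightarrow> 'a::real_normed_vector \<Rightarrow> real) \<Rightarrow>
     ('b \<times> 'b \<Rightarrow> 'a \<times> 'a \<Rightarrow> complex) \<Rightarrow> bool" where
  "complex_twin_operator p L \<longleftrightarrow>
     bounded_bilinear L \<and>
     (\<forall>c u' u. L (complex_scale c u') u = c * L u' u \<and> L u' (complex_scale c u) = c * L u' u) \<and>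
     (\<forall>u. \<exists>z. \<forall>u'. complexify p u' z = L u' u) \<and>
     (\<forall>u'. \<exists>z'. \<forall>u. complexify p z' u = L u' u)"

definition twin_laplace :: "(real \<Rightarrow> 'b \<Rightarrow> 'a \<Rightarrow> real) \<Rightarrow> real \<Rightarrow> 'b \<Rightarrow> 'a \<Rightarrow> real" where
  "twin_laplace S \<zeta> y' y = set_lebesgue_integral lborel {0..} (\<lambda>t. exp (- (\<zeta> * t)) * S t y' y)"

definition complex_twin_laplace ::
    "(real \<Rightarrow> 'b \<Rightarrow> 'a \<Rightarrow> real) \<Rightarrow> complex \<Rightarrow> 'b \<times> 'b \<Rightarrow> 'a \<times> 'a \<Rightarrow> complex" where
  "complex_twin_laplace S \<zeta> u' u =
     set_lebesgue_integral lborel {0..}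
       (\<lambda>t. exp (- (\<zeta> * complex_of_real t)) * complexify (S t) u' u)"

text \<open>Only the values \<open>S t\<close> with \<open>t \<ge> 0\<close> are relevant.\<close>

definition twin_semigroup_bound ::
    "('b::real_normed_vector \<Rightarrow> 'a::real_normed_vector \<Rightarrow> real) \<Rightarrow>
     (real \<Rightarrow> 'b \<Rightarrow> 'a \<Rightarrow> real) \<Rightarrow> real \<Rightarrow> real \<Rightarrow> bool" where
  "twin_semigroup_bound p S M \<omega> \<longleftrightarrow>
     (\<forall>t\<ge>0. twin_operator p (S t)) \<and>
     S 0 = p \<and>
     (\<forall>t\<ge>0. \<forall>s\<ge>0. S (t + s) = twin_comp p (S t) (S s)) \<and>
     M \<ge> 1 \<and>
     (\<forall>t\<ge>0. \<forall>y' y. \<bar>S t y' y\<bar> \<le> M * exp (\<omega> * t) * norm y * norm y') \<and>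
     (\<forall>y' y. (\<lambda>t. S t y' y) \<in> borel_measurable (restrict_space borel {0..})) \<and>
     (\<forall>\<zeta>::real. \<zeta> > \<omega> \<longrightarrow> twin_operator p (twin_laplace S \<zeta>)) \<and>
     (\<forall>\<zeta>::complex. Re \<zeta> > \<omega> \<longrightarrow> complex_twin_operator p (complex_twin_laplace S \<zeta>))"

definition twin_semigroup ::
    "('b::real_normed_vector \<Rightarrow> 'a::real_normed_vector \<Rightarrow> real) \<Rightarrow>
     (real \<Rightarrow> 'b \<Rightarrow> 'a \<Rightarrow> real) \<Rightarrow> bool" where
  "twin_semigroup p S \<longleftrightarrow> (\<exists>M \<omega>. twin_semigroup_bound p S M \<omega>)"

text \<open>A multi-valued operator is given by its graph: \<open>(y, z) \<in> C\<close> means that \<open>y\<close> is in the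
  domain of \<open>C\<close> and \<open>z \<in> C y\<close>.  The defining equation does not depend on the choice
  of \<open>\<zeta>\<close> (resolvent identity), nor on the choice of the growth bound.\<close>

definition twin_generator ::
    "('b::real_normed_vector \<Rightarrow> 'a::real_normed_vector \<Rightarrow> real) \<Rightarrow>
     (real \<Rightarrow> 'b \<Rightarrow> 'a \<Rightarrow> real) \<Rightarrow> ('a \<times> 'a) set" where
  "twin_generator p S =
     {(y, z). \<exists>M \<omega>. twin_semigroup_bound p S M \<omega> \<and>
        (\<forall>\<zeta>>\<omega>. y = twin_right p (twin_laplace S \<zeta>) (\<zeta> *\<^sub>R y - z))}"


section \<open>Normalised functions of bounded variation and their measures\<close>

definition variation_sums :: "(real \<Rightarrow> 'v::real_normed_vector) \<Rightarrow> real \<Rightarrow> real \<Rightarrow> real set" where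
  "variation_sums F a b =
     {(\<Sum>i<m. norm (F (x (Suc i)) - F (x i))) | (m::nat) x. mono x \<and> range x \<subseteq> {a..b}}"

definition NBV_loc :: "(real \<Rightarrow> 'v::real_normed_vector) \<Rightarrow> bool" where
  "NBV_loc F \<longleftrightarrow>
     (\<forall>T\<ge>0. bdd_above (variation_sums F 0 T)) \<and>
     F 0 = 0 \<and>
     (\<forall>t>0. continuous (at_right t) F)"

definition total_variation :: "(real \<Rightarrow> real) \<Rightarrow> real \<Rightarrow> real" where
  "total_variation F t = Sup (variation_sums F 0 t)"

text \<open>The distribution function, on all of the real line, of a measure on \<open>[0, \<infinity>)\<close> with
  \<open>\<mu> [0, t] = F t\<close> for \<open>t > 0\<close>.  It is right-continuous also at \<open>0\<close>, and its jump at \<open>0\<close>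
  is \<open>F(0+) = \<mu> {0}\<close>.\<close>

definition distribution_ext :: "(real \<Rightarrow> real) \<Rightarrow> real \<Rightarrow> real" where
  "distribution_ext F t = (if t < 0 then 0 else if t = 0 then Lim (at_right 0) F else F t)"

text \<open>The signed Radon measure of \<open>F\<close> (in \<open>NBV_loc\<close>) is represented by its Jordan
  decomposition: the positive and negative parts are the Stieltjes measures of the positive and
  negative variation functions of \<open>F\<close>.\<close>

definition NBV_pos :: "(real \<Rightarrow> real) \<Rightarrow> real measure" where
  "NBV_pos F = interval_measure (distribution_ext (\<lambda>t. (total_variation F t + F t) / 2))"

definition NBV_neg :: "(real \<Rightarrow> real) \<Rightarrow> real measure" where
  "NBV_neg F = interval_measure (distribution_ext (\<lambda>t. (total_variation F t - F t) / 2))"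

text \<open>\<open>\<mu>\<^sub>F E\<close>, meaningful for bounded Borel sets \<open>E\<close>, and the integral of \<open>g\<close> over \<open>A\<close> with
  respect to \<open>\<mu>\<^sub>F\<close>.\<close>

definition NBV_measure :: "(real \<Rightarrow> real) \<Rightarrow> real set \<Rightarrow> real" where
  "NBV_measure F E = measure (NBV_pos F) E - measure (NBV_neg F) E"

definition NBV_integral :: "(real \<Rightarrow> real) \<Rightarrow> real set \<Rightarrow> (real \<Rightarrow> real) \<Rightarrow> real" where
  "NBV_integral F A g =
     set_lebesgue_integral (NBV_pos F) A g - set_lebesgue_integral (NBV_neg F) A g"

text \<open>The convolution \<open>(\<mu>\<^sub>F * \<mu>\<^sub>G) E = \<integral> \<mu>\<^sub>F (E - t) \<mu>\<^sub>G(dt)\<close> of measures on \<open>[0, \<infinity>)\<close>.\<close>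

definition NBV_conv :: "(real \<Rightarrow> real) \<Rightarrow> (real \<Rightarrow> real) \<Rightarrow> real set \<Rightarrow> real" where
  "NBV_conv F G E = NBV_integral G {0..} (\<lambda>t. NBV_measure F {s. 0 \<le> s \<and> s + t \<in> E})"

definition is_resolvent ::
    "(real \<Rightarrow> real^'n^'n) \<Rightarrow> (real \<Rightarrow> real^'n^'n) \<Rightarrow> bool" where
  "is_resolvent K R \<longleftrightarrow>
     NBV_loc R \<and>
     (\<forall>i j. \<forall>E\<in>sets borel. bounded E \<and> E \<subseteq> {0..} \<longrightarrow>
        NBV_measure (\<lambda>t. R t $ i $ j) E =
          NBV_measure (\<lambda>t. K t $ i $ j) E +
          (\<Sum>k\<in>UNIV. NBV_conv (\<lambda>t. K t $ i $ k) (\<lambda>t. R t $ k $ j) E) \<and>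
        NBV_measure (\<lambda>t. R t $ i $ j) E =
          NBV_measure (\<lambda>t. K t $ i $ j) E +
          (\<Sum>k\<in>UNIV. NBV_conv (\<lambda>t. R t $ i $ k) (\<lambda>t. K t $ k $ j) E))"


section \<open>The perturbed semigroup\<close>

definition pert_kernel ::
    "('b \<Rightarrow> 'a \<Rightarrow> real) \<Rightarrow> (real \<Rightarrow> 'b \<Rightarrow> 'a \<Rightarrow> real) \<Rightarrow> ('n::finite \<Rightarrow> 'a) \<Rightarrow> ('n \<Rightarrow> 'b) \<Rightarrow>
     real \<Rightarrow> real^'n^'n" where
  "pert_kernel p S\<^sub>0 q Q t = (\<chi> i j. S\<^sub>0 t (Q i) (q j) - p (Q i) (q j))"

definition pert_V\<^sub>0 ::
    "('b \<Rightarrow> 'a \<Rightarrow> real) \<Rightarrow> (real \<Rightarrow> 'b \<Rightarrow> 'a \<Rightarrow> real) \<Rightarrow> ('n::finite \<Rightarrow> 'b) \<Rightarrow>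
     real \<Rightarrow> 'a \<Rightarrow> real^'n" where
  "pert_V\<^sub>0 p S\<^sub>0 Q t y = (\<chi> i. S\<^sub>0 t (Q i) y - p (Q i) y)"

definition pert_W\<^sub>0 ::
    "(real \<Rightarrow> 'b \<Rightarrow> 'a \<Rightarrow> real) \<Rightarrow> ('n::finite \<Rightarrow> 'a) \<Rightarrow> 'b \<Rightarrow> real \<Rightarrow> real^'n" where
  "pert_W\<^sub>0 S\<^sub>0 q y' t = (if t = 0 then 0 else (\<chi> j. S\<^sub>0 t y' (q j)))"

text \<open>At \<open>\<tau> = t\<close> the integrand is the right limit of \<open>y'W\<^sub>0\<close> at \<open>0\<close>, not the normalised value
  \<open>y'W\<^sub>0(0) = 0\<close>.\<close>

definition pert_W ::
    "(real \<Rightarrow> 'b \<Rightarrow> 'a \<Rightarrow> real) \<Rightarrow> ('n::finite \<Rightarrow> 'a) \<Rightarrow> (real \<Rightarrow> real^'n^'n) \<Rightarrow>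
     'b \<Rightarrow> real \<Rightarrow> real^'n" where
  "pert_W S\<^sub>0 q R y' t =
     (if t = 0 then 0
      else (\<chi> j. pert_W\<^sub>0 S\<^sub>0 q y' t $ j +
              (\<Sum>i\<in>UNIV. NBV_integral (\<lambda>s. R s $ i $ j) {0..t}
                 (\<lambda>\<tau>. if \<tau> = t then Lim (at_right 0) (\<lambda>s. pert_W\<^sub>0 S\<^sub>0 q y' s $ i)
                       else pert_W\<^sub>0 S\<^sub>0 q y' (t - \<tau>) $ i))))"

definition pert_semigroup ::
    "('b \<Rightarrow> 'a \<Rightarrow> real) \<Rightarrow> (real \<Rightarrow> 'b \<Rightarrow> 'a \<Rightarrow> real) \<Rightarrow> ('n::finite \<Rightarrow> 'a) \<Rightarrow> ('n \<Rightarrow> 'b) \<Rightarrow>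
     (real \<Rightarrow> real^'n^'n) \<Rightarrow> real \<Rightarrow> 'b \<Rightarrow> 'a \<Rightarrow> real" where
  "pert_semigroup p S\<^sub>0 q Q R t y' y =
     (if t = 0 then p y' y
      else S\<^sub>0 t y' y +
           (\<Sum>j\<in>UNIV. NBV_integral (\<lambda>s. pert_W S\<^sub>0 q R y' s $ j) {0..t}
              (\<lambda>\<tau>. pert_V\<^sub>0 p S\<^sub>0 Q (t - \<tau>) y $ j)))"

end

theory Submission
  imports Defs
begin

text \<open>The perturbed family is \<open>S(t) = S\<^sub>0(t) + (W * V\<^sub>0)(t)\<close>, the convolution of the measure \<open>y'W\<close> with
  the function \<open>V\<^sub>0 y\<close>. A signed measure on the half-line occurs through a function \<open>F\<close> of locally
  bounded variation, its integral is \<open>nbv_int F\<close>, and \<open>conv F g\<close> is its convolution with a causal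
  function \<open>g\<close> (Borel, locally bounded, zero on the negative axis). Two facts carry all computations.
  Convolutions commute (\<open>conv_commute\<close>, Fubini), and an identity between integrals of bounded Borel
  functions holds as soon as it holds for indicators of \<open>(-\<infinity>, s]\<close> (\<open>bdd_borel_induct\<close>), so that
  measures may be compared through their distribution functions. Write \<open>k, r, w\<^sub>0, w\<close> for the
  distribution functions of \<open>K, R, W\<^sub>0, W\<close>. The hypotheses say \<open>r = k + R * k\<close>, also with
  the factors in the other order, and \<open>w = w\<^sub>0 + R * w\<^sub>0\<close>; together they give the renewal equation
  \<open>w = w\<^sub>0 + W * k\<close> (\<open>w_fixed_point\<close>).

  Representability. For fixed \<open>y'\<close> the functional \<open>y \<mapsto> y'S(t)y\<close> is sequentially continuous for the
  weak topology by dominated convergence, because weakly convergent sequences are norm bounded;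
  hence it is continuous and therefore given by an element of the partner space. For fixed \<open>y\<close> the
  functional \<open>y' \<mapsto> \<integral> g d(y'W)\<close> is represented by an element of \<open>Y\<close>: this holds for indicators
  and passes to bounded pointwise limits by sequential completeness (\<open>right_rep_nbv_int\<close>).

  Semigroup law. Since \<open>y'W(\<sigma>)\<close> is represented by an element \<open>W(\<sigma>)\<close> of \<open>Y\<close>, one may apply
  \<open>S(t)\<close> to it. The resolvent equation shows \<open>V\<^sub>0(\<cdot>)W(\<sigma>) = \<rho> - K * \<rho>\<close>, where \<open>\<rho>\<close> is the
  measure of \<open>R\<close> restricted to \<open>(\<sigma>, \<infinity>)\<close> and shifted to start at zero (\<open>v_of_W\<close>), and the renewal
  equation turns \<open>W * V\<^sub>0W(\<sigma>)\<close> into \<open>W\<^sub>0 * \<rho>\<close>. Adding \<open>S\<^sub>0(t)W(\<sigma>)\<close> yields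
  \<open>S(t)W(\<sigma>) = W(t + \<sigma>)\<close> (\<open>S_of_W\<close>). This is the semigroup law on the elements \<open>W(\<sigma>)\<close>; a monotone
  class argument extends it to integrals against \<open>W\<close>, of which \<open>S(s)y - S\<^sub>0(s)y\<close> is one (\<open>S_add\<close>).
  The exponential bound follows from the bound on \<open>[0, 1]\<close>, which rests on uniform boundedness of
  the total variation of \<open>y'W\<^sub>0\<close>.

  Generator. The Laplace transforms, written with a hat here, satisfy
  \<open>S\<^sup>^ = S\<^sub>0\<^sup>^ + \<Sum>\<^sub>j S\<^sup>^q\<^sub>j (\<zeta> Q\<^sub>j S\<^sub>0\<^sup>^ - Q\<^sub>j)\<close> (\<open>laplace_S\<close>), because \<open>S(t)q = W(t)\<close> for
  \<open>t > 0\<close>. The formula for the generator is then linear algebra with the matrix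
  \<open>\<kappa>(\<zeta>) = \<zeta> Q S\<^sub>0\<^sup>^ q - Q q\<close>; it tends to zero as \<open>\<zeta> \<rightarrow> \<infinity>\<close>, so \<open>1 - \<kappa>(\<zeta>)\<close> is invertible for one
  large \<open>\<zeta>\<close>, and the resolvent identity transfers the conclusion from that \<open>\<zeta>\<close> to all others.\<close>

section \<open>Uniform boundedness and the weak topology of a pairing\<close>

text \<open>By Baire some set \<open>{x. \<forall>i\<in>I. \<bar>f i x\<bar> \<le> n}\<close> contains a ball, and differences of its points fill a
  ball around zero.\<close>

lemma uniform_boundedness:
  fixes f :: "'i \<Rightarrow> 'a::banach \<Rightarrow> real"
  assumes lin: "\<And>i. i \<in> I \<Longrightarrow> bounded_linear (f i)"
    and pointwise: "\<And>x. \<exists>B. \<forall>i\<in>I. \<bar>f i x\<bar> \<le> B"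
  obtains C where "C \<ge> 0" "\<And>i x. i \<in> I \<Longrightarrow> \<bar>f i x\<bar> \<le> C * norm x"
proof -
  define A where "A n = (\<Inter>i\<in>I. {x. \<bar>f i x\<bar> \<le> real n})" for n
  have "closed (A n)" for n
    unfolding A_def using lin
    by (intro closed_INT ballI closed_Collect_le continuous_intros)
       (auto intro: linear_continuous_on)
  have "\<exists>n. x \<in> A n" for x
  proof -
    obtain B where B: "\<forall>i\<in>I. \<bar>f i x\<bar> \<le> B"
      using pointwise by blast
    obtain n :: nat where "B \<le> real n"
      using real_arch_simple by blast
    with B have "x \<in> A n"
      unfolding A_def by fastforce
    then show ?thesis ..
  qed
  then have cover: "(\<Union>n. A n) = UNIV"
    by blast
  have "\<exists>n. interior (A n) \<noteq> {}"
  proof (rule ccontr)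
    assume "\<nexists>n. interior (A n) \<noteq> {}"
    then have "interior (A n) = {}" for n
      by blast
    then have "euclidean interior_of \<Union>(range A) = {}"
      using Baire_category_alt[of "euclidean :: 'a topology" "range A"] \<open>\<And>n. closed (A n)\<close>
        completely_metrizable_space_euclidean
      by auto
    then show False
      using cover by simp
  qed
  then obtain n x r where "r > 0" and ball: "ball x r \<subseteq> A n"
    by (metis all_not_in_conv mem_interior)
  have small: "\<bar>f i h\<bar> \<le> 2 * real n" if "i \<in> I" "norm h < r" for i h
  proof -
    have "x + h \<in> A n" "x \<in> A n"
      using ball that \<open>r > 0\<close> by (auto simp: subset_iff dist_norm)
    then have "\<bar>f i (x + h)\<bar> \<le> real n" "\<bar>f i x\<bar> \<le> real n"
      using \<open>i \<in> I\<close> by (auto simp: A_def)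
    moreover have "f i (x + h) = f i x + f i h"
      using lin[OF \<open>i \<in> I\<close>] by (simp add: linear_add bounded_linear.linear)
    ultimately show ?thesis
      by linarith
  qed
  show ?thesis
  proof (rule that[of "4 * real n / r"])
    show "0 \<le> 4 * real n / r"
      using \<open>r > 0\<close> by simp
    fix i y assume "i \<in> I"
    show "\<bar>f i y\<bar> \<le> 4 * real n / r * norm y"
    proof (cases "y = 0")
      case True
      then show ?thesis
        using lin[OF \<open>i \<in> I\<close>] by (simp add: linear_0 bounded_linear.linear)
    next
      case False
      define c where "c = r / (2 * norm y)"
      have "c > 0"
        using False \<open>r > 0\<close> by (simp add: c_def)
      have "\<bar>f i (c *\<^sub>R y)\<bar> \<le> 2 * real n"
        using small[OF \<open>i \<in> I\<close>, of "c *\<^sub>R y"] False \<open>r > 0\<close> by (simp add: c_def)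
      then have "c * \<bar>f i y\<bar> \<le> 2 * real n"
        using lin[OF \<open>i \<in> I\<close>] \<open>c > 0\<close> by (simp add: linear_scale bounded_linear.linear abs_mult)
      then show ?thesis
        using False \<open>r > 0\<close> by (simp add: c_def field_simps)
    qed
  qed
qed

text \<open>A functional that vanishes on the common kernel of finitely many functionals is a linear
  combination of them. Eliminating one functional at a time works inside the family \<open>p\<close>, because
  linear combinations of the \<open>p y'\<close> are again of this form.\<close>

lemma functional_in_span:
  fixes \<phi> :: "'a::real_vector \<Rightarrow> real" and p :: "'b::real_vector \<Rightarrow> 'a \<Rightarrow> real"
  assumes "finite A" "linear \<phi>" "\<And>y'. linear (p y')" "\<And>y. linear (\<lambda>y'. p y' y)"
    and "\<And>y. (\<forall>y'\<in>A. p y' y = 0) \<Longrightarrow> \<phi> y = 0"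
  shows "\<exists>z'. \<forall>y. p z' y = \<phi> y"
  using assms(1,2,5)
proof (induction A arbitrary: \<phi> rule: finite_induct)
  case empty
  have "p 0 y = 0" for y
    using assms(4) linear_0 by blast
  then show ?case
    using empty by (intro exI[of _ 0]) simp
next
  case (insert a A)
  show ?case
  proof (cases "\<forall>y. (\<forall>y'\<in>A. p y' y = 0) \<longrightarrow> p a y = 0")
    case True
    then show ?thesis
      using insert.IH[OF insert.prems(1)] insert.prems(2) by simp
  next
    case False
    then obtain e where e: "\<forall>y'\<in>A. p y' e = 0" "p a e \<noteq> 0"
      by blast
    define c where "c = \<phi> e / p a e"
    define \<psi> where "\<psi> y = \<phi> y - c * p a y" for y
    have [simp]: "p y' (u - r *\<^sub>R v) = p y' u - r * p y' v" for y' u v r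
      using assms(3) by (simp add: linear_diff linear_scale)
    have "linear \<psi>"
      unfolding \<psi>_def using insert.prems(1) assms(3)
      by (intro linear_compose_sub) (auto intro!: linearI simp: linear_add linear_scale algebra_simps)
    moreover have "\<psi> y = 0" if y: "\<forall>y'\<in>A. p y' y = 0" for y
    proof -
      have "\<phi> (y - (p a y / p a e) *\<^sub>R e) = 0"
        using y e by (intro insert.prems(2)) auto
      then show ?thesis
        using insert.prems(1) by (simp add: \<psi>_def c_def linear_diff linear_scale)
    qed
    ultimately obtain z' where z': "\<forall>y. p z' y = \<psi> y"
      using insert.IH by blast
    have "p (z' + c *\<^sub>R a) y = \<phi> y" for y
      using z' by (simp add: linear_add[OF assms(4)] linear_scale[OF assms(4)] \<psi>_def)
    then show ?thesis
      by blast
  qed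
qed

text \<open>Finite intersections of the generating sets form a neighbourhood basis.\<close>

lemma openin_pairing_topology_nhd:
  assumes "openin (pairing_topology p) U" "x \<in> U"
  obtains A where "finite A" "\<And>y' V. (y', V) \<in> A \<Longrightarrow> open V \<and> p y' x \<in> V"
    "\<And>z. (\<forall>(y', V)\<in>A. p y' z \<in> V) \<Longrightarrow> z \<in> U"
proof -
  have "generate_topology_on {{y. p y' y \<in> U} | y' U. open U} U"
    using assms(1) unfolding pairing_topology_def by (rule openin_topology_generated_by)
  then have "x \<in> U \<Longrightarrow> \<exists>A. finite A \<and> (\<forall>(y', V)\<in>A. open V \<and> p y' x \<in> V) \<and>
      (\<forall>z. (\<forall>(y', V)\<in>A. p y' z \<in> V) \<longrightarrow> z \<in> U)"
  proof induction
    case Empty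
    then show ?case by simp
  next
    case (Int a b)
    then obtain A B where
      A: "finite A" "\<forall>(y', V)\<in>A. open V \<and> p y' x \<in> V" "\<forall>z. (\<forall>(y', V)\<in>A. p y' z \<in> V) \<longrightarrow> z \<in> a" and
      B: "finite B" "\<forall>(y', V)\<in>B. open V \<and> p y' x \<in> V" "\<forall>z. (\<forall>(y', V)\<in>B. p y' z \<in> V) \<longrightarrow> z \<in> b"
      by auto
    show ?case
      by (rule exI[of _ "A \<union> B"]) (use A B in auto)
  next
    case (UN K)
    then obtain k where k: "k \<in> K" "x \<in> k"
      by blast
    from UN.IH[OF k] obtain A where
      A: "finite A \<and> (\<forall>(y', V)\<in>A. open V \<and> p y' x \<in> V) \<and>
        (\<forall>z. (\<forall>(y', V)\<in>A. p y' z \<in> V) \<longrightarrow> z \<in> k)"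
      by (rule exE)
    then show ?case
      using k(1) by (intro exI[of _ A]) (metis UnionI)
  next
    case (Basis s)
    then obtain y' V where s: "s = {y. p y' y \<in> V}" "open V"
      by blast
    show ?case
      by (rule exI[of _ "{(y', V)}"]) (use s Basis in auto)
  qed
  then show ?thesis
    using assms(2) that by blast
qed

lemma topspace_pairing_topology [simp]: "topspace (pairing_topology p) = UNIV"
  unfolding pairing_topology_def topology_generated_by_topspace by auto

lemma limitin_pairing_topology:
  "limitin (pairing_topology p) x l F \<longleftrightarrow> (\<forall>y'. ((\<lambda>i. p y' (x i)) \<longlongrightarrow> p y' l) F)"
proof
  assume L: "limitin (pairing_topology p) x l F"
  show "\<forall>y'. ((\<lambda>i. p y' (x i)) \<longlongrightarrow> p y' l) F"
  proof (intro allI topological_tendstoI)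
    fix y' V assume "open V" "p y' l \<in> V"
    moreover from \<open>open V\<close> have "openin (pairing_topology p) {y. p y' y \<in> V}"
      unfolding pairing_topology_def by (intro topology_generated_by_Basis) blast
    ultimately show "\<forall>\<^sub>F i in F. p y' (x i) \<in> V"
      using limitinD[OF L, of "{y. p y' y \<in> V}"] by simp
  qed
next
  assume R: "\<forall>y'. ((\<lambda>i. p y' (x i)) \<longlongrightarrow> p y' l) F"
  show "limitin (pairing_topology p) x l F"
    unfolding limitin_def
  proof (intro conjI allI impI)
    fix U assume "openin (pairing_topology p) U \<and> l \<in> U"
    then obtain A where A: "finite A" "\<And>y' V. (y', V) \<in> A \<Longrightarrow> open V \<and> p y' l \<in> V"
        "\<And>z. (\<forall>(y', V)\<in>A. p y' z \<in> V) \<Longrightarrow> z \<in> U"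
      using openin_pairing_topology_nhd[of p U l] by metis
    have "\<forall>\<^sub>F i in F. \<forall>a\<in>A. p (fst a) (x i) \<in> snd a"
      using A(1) A(2) R by (intro eventually_ball_finite) (auto simp: tendsto_def)
    then show "\<forall>\<^sub>F i in F. x i \<in> U"
      by eventually_elim (rule A(3), auto)
  qed simp
qed

text \<open>Weak Cauchy sequences are those for which each scalar sequence converges, since a weak
  neighbourhood tests only finitely many functionals.\<close>

lemma sequentially_complete_pairingD:
  assumes "sequentially_complete (pairing_topology p)" "\<And>y'. linear (p y')"
    and "\<And>y'. convergent (\<lambda>n. p y' (x n))"
  obtains l where "\<And>y'. (\<lambda>n. p y' (x n)) \<longlonglongrightarrow> p y' l"
proof -
  have "\<exists>N. \<forall>m\<ge>N. \<forall>n\<ge>N. x m - x n \<in> U"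
    if U: "openin (pairing_topology p) U" "0 \<in> U" for U
  proof -
    obtain A where A: "finite A" "\<And>y' V. (y', V) \<in> A \<Longrightarrow> open V \<and> p y' 0 \<in> V"
        "\<And>z. (\<forall>(y', V)\<in>A. p y' z \<in> V) \<Longrightarrow> z \<in> U"
      using openin_pairing_topology_nhd[OF U] by metis
    have "\<forall>a\<in>A. \<exists>N. \<forall>m\<ge>N. \<forall>n\<ge>N. p (fst a) (x m - x n) \<in> snd a"
    proof
      fix a assume "a \<in> A"
      obtain y' V where a: "a = (y', V)" by (cases a)
      have "p y' 0 = 0" using assms(2) by (rule linear_0)
      with A(2) a \<open>a \<in> A\<close> obtain e where e: "e > 0" "ball 0 e \<subseteq> V"
        by (metis openE)
      have "Cauchy (\<lambda>n. p y' (x n))"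
        using assms(3) by (rule convergent_Cauchy)
      then obtain N where "\<forall>m\<ge>N. \<forall>n\<ge>N. dist (p y' (x m)) (p y' (x n)) < e"
        using e(1) unfolding Cauchy_def by blast
      then have "\<forall>m\<ge>N. \<forall>n\<ge>N. p y' (x m - x n) \<in> V"
        using e(2) assms(2) by (auto simp: subset_iff dist_real_def linear_diff)
      then show "\<exists>N. \<forall>m\<ge>N. \<forall>n\<ge>N. p (fst a) (x m - x n) \<in> snd a"
        using a by auto
    qed
    then obtain N where N: "\<And>a. a \<in> A \<Longrightarrow> \<forall>m\<ge>N a. \<forall>n\<ge>N a. p (fst a) (x m - x n) \<in> snd a"
      by metis
    have "x m - x n \<in> U" if mn: "m \<ge> Max (N ` A)" "n \<ge> Max (N ` A)" for m n
    proof (rule A(3), clarify)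
      fix y' V assume "(y', V) \<in> A"
      moreover from this have "N (y', V) \<le> Max (N ` A)"
        using A(1) by simp
      ultimately show "p y' (x m - x n) \<in> V"
        using N[of "(y', V)"] mn by (auto dest: order_trans)
    qed
    then show ?thesis by blast
  qed
  then obtain l where "limitin (pairing_topology p) x l sequentially"
    using assms(1) unfolding sequentially_complete_def by blast
  then show ?thesis
    unfolding limitin_pairing_topology using that by blast
qed

text \<open>A weakly continuous functional is bounded by 1 on a set cut out by finitely many conditions on
  \<open>p y' y\<close>; by scaling it vanishes where these finitely many functionals do.\<close>

lemma continuous_functional_represented:
  fixes p :: "'b::real_vector \<Rightarrow> 'a::real_vector \<Rightarrow> real"
  assumes lin: "\<And>y'. linear (p y')" "\<And>y. linear (\<lambda>y'. p y' y)" and "linear \<phi>"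
    and cont: "continuous_map (pairing_topology p) euclideanreal \<phi>"
  shows "\<exists>z'. \<forall>y. p z' y = \<phi> y"
proof -
  define U where "U = {y. \<phi> y \<in> ball 0 1}"
  have U: "openin (pairing_topology p) U" "0 \<in> U"
    using openin_continuous_map_preimage[OF cont, of "ball 0 1"] linear_0[OF \<open>linear \<phi>\<close>]
    by (auto simp: U_def)
  obtain A where A: "finite A" "\<And>y' V. (y', V) \<in> A \<Longrightarrow> open V \<and> p y' 0 \<in> V"
      "\<And>z. (\<forall>(y', V)\<in>A. p y' z \<in> V) \<Longrightarrow> z \<in> U"
    using openin_pairing_topology_nhd[OF U] by metis
  have "\<phi> y = 0" if y: "\<forall>y'\<in>fst ` A. p y' y = 0" for y
  proof (rule ccontr)
    assume "\<phi> y \<noteq> 0"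
    have "(2 / \<phi> y) *\<^sub>R y \<in> U"
    proof (rule A(3), clarify)
      fix y' V assume *: "(y', V) \<in> A"
      have "p y' ((2 / \<phi> y) *\<^sub>R y) = 0"
        using y * by (force simp: linear_scale[OF lin(1)])
      then show "p y' ((2 / \<phi> y) *\<^sub>R y) \<in> V"
        using A(2)[OF *] linear_0[OF lin(1)] by simp
    qed
    then show False
      using \<open>\<phi> y \<noteq> 0\<close> by (simp add: U_def linear_scale[OF \<open>linear \<phi>\<close>])
  qed
  then show ?thesis
    using functional_in_span[of "fst ` A" \<phi> p] A(1) assms(3) lin by blast
qed

section \<open>Total variation\<close>

lemma sum_lessThan_shift:
  fixes f :: "nat \<Rightarrow> real"
  shows "(\<Sum>i<m + k. f i) = (\<Sum>i<m. f i) + (\<Sum>i<k. f (m + i))"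
  by (induction k) auto

lemma variation_sumsI:
  assumes "mono x" "\<And>i. x i \<in> {a..b}"
  shows "(\<Sum>i<m. norm (F (x (Suc i)) - F (x i))) \<in> variation_sums F a b"
proof -
  have "range x \<subseteq> {a..b}"
    using assms(2) by blast
  with assms(1) show ?thesis
    unfolding variation_sums_def by (intro CollectI exI[of _ m] exI[of _ x] conjI refl)
qed

text \<open>Two partitions of adjacent intervals are joined; the increment between the last point of the
  first and the first point of the second can only increase the sum.\<close>

lemma variation_sums_concat:
  assumes "a \<le> s" "s \<le> b" "u \<in> variation_sums F a s" "v \<in> variation_sums F s b"
  obtains w where "w \<in> variation_sums F a b" "u + v \<le> w"
proof -
  obtain m :: nat and x where x: "mono x" "range x \<subseteq> {a..s}"
    and u: "u = (\<Sum>i<m. norm (F (x (Suc i)) - F (x i)))"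
    using assms(3) unfolding variation_sums_def by blast
  obtain n :: nat and y where y: "mono y" "range y \<subseteq> {s..b}"
    and v: "v = (\<Sum>i<n. norm (F (y (Suc i)) - F (y i)))"
    using assms(4) unfolding variation_sums_def by blast
  define z where "z i = (if i \<le> m then x i else y (i - Suc m))" for i
  define w where "w = (\<Sum>i<m + Suc n. norm (F (z (Suc i)) - F (z i)))"
  have "mono z"
  proof (rule monoI)
    fix i j :: nat assume "i \<le> j"
    have "x i \<le> s" "s \<le> y j'" for j'
      using x(2) y(2) by (auto simp: subset_iff)
    then show "z i \<le> z j"
      using \<open>i \<le> j\<close> monoD[OF x(1), of i j] monoD[OF y(1), of "i - Suc m" "j - Suc m"]
      by (auto simp: z_def intro: order_trans)
  qed
  moreover have "range z \<subseteq> {a..b}"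
  proof -
    have "x i \<in> {a..s}" "y i \<in> {s..b}" for i
      using x(2) y(2) by blast+
    then have "z i \<in> {a..b}" for i
      using assms(1,2) by (simp add: z_def order_trans[of _ s b] order_trans[of a s])
    then show ?thesis by blast
  qed
  ultimately have "w \<in> variation_sums F a b"
    unfolding variation_sums_def w_def by blast
  moreover have "u + v \<le> w"
    unfolding w_def sum_lessThan_shift u v sum.lessThan_Suc_shift
    by (auto simp: z_def)
  ultimately show ?thesis
    by (rule that)
qed

lemma increment_in_variation_sums:
  "a \<le> b \<Longrightarrow> norm (F b - F a) \<in> variation_sums F a b"
  unfolding variation_sums_def
  by (intro CollectI exI[of _ "1::nat"] exI[of _ "\<lambda>i. if i = 0 then a else b"] conjI)
     (auto simp: mono_def)

lemma NBV_locD: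
  assumes "NBV_loc F"
  shows "bdd_above (variation_sums F 0 t)" "F 0 = 0"
    "t > 0 \<Longrightarrow> continuous (at_right t) F"
proof -
  show "bdd_above (variation_sums F 0 t)"
  proof (cases "t \<ge> 0")
    case True
    then show ?thesis using assms by (simp add: NBV_loc_def)
  next
    case False
    then have "variation_sums F 0 t = {}"
      by (auto simp: variation_sums_def)
    then show ?thesis by simp
  qed
qed (use assms in \<open>auto simp: NBV_loc_def\<close>)

lemma total_variation_upper:
  "NBV_loc F \<Longrightarrow> u \<in> variation_sums F 0 t \<Longrightarrow> u \<le> total_variation F t"
  unfolding total_variation_def by (intro cSup_upper NBV_locD)

lemma total_variation_concat:
  assumes "NBV_loc F" "0 \<le> s" "s \<le> t" "v \<in> variation_sums F s t"
  shows "total_variation F s + v \<le> total_variation F t"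
proof -
  have "u \<le> total_variation F t - v" if u: "u \<in> variation_sums F 0 s" for u
  proof -
    obtain w where "w \<in> variation_sums F 0 t" "u + v \<le> w"
      using variation_sums_concat[OF assms(2,3) u assms(4)] .
    then show ?thesis
      using total_variation_upper[OF assms(1)] by fastforce
  qed
  moreover have "variation_sums F 0 s \<noteq> {}"
    using increment_in_variation_sums[OF assms(2), of F] by auto
  ultimately have "total_variation F s \<le> total_variation F t - v"
    unfolding total_variation_def[of F s] by (intro cSup_least)
  then show ?thesis by simp
qed

lemma total_variation_increment:
  assumes "NBV_loc F" "0 \<le> s" "s \<le> t"
  shows "total_variation F s + \<bar>F t - F s\<bar> \<le> total_variation F t"
  using total_variation_concat[OF assms increment_in_variation_sums[OF assms(3), of F]]
  unfolding real_norm_def .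

lemma variation_sums_point:
  assumes "u \<in> variation_sums F a a"
  shows "u = 0"
proof -
  from assms obtain m :: nat and x where x: "mono x" "range x \<subseteq> {a..a}"
    and u: "u = (\<Sum>i<m. norm (F (x (Suc i)) - F (x i)))"
    unfolding variation_sums_def by blast
  have "x i = a" for i
    using x(2) by (simp add: image_subset_iff)
  then show ?thesis
    by (simp add: u)
qed

lemma total_variation_0 [simp]: "total_variation F 0 = 0"
proof -
  have "variation_sums F 0 0 = {0}"
    using variation_sums_point[of _ F 0] increment_in_variation_sums[of 0 0 F] by auto
  then show ?thesis
    by (simp add: total_variation_def)
qed

text \<open>Take a partition of \<open>[0, t + 1]\<close> that is optimal up to \<open>e / 2\<close>, and \<open>s > t\<close> so close that no
  partition point lies strictly between \<open>t\<close> and \<open>s\<close>. Cutting the partition at \<open>t\<close> and \<open>s\<close> shows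
  that the variation between \<open>t\<close> and \<open>s\<close> is at most \<open>e / 2 + \<bar>F s - F t\<bar>\<close>.\<close>

lemma total_variation_right_continuous:
  assumes F: "NBV_loc F" and "t > 0"
  shows "continuous (at_right t) (total_variation F)"
proof -
  have Fc: "((\<lambda>s. F s) \<longlongrightarrow> F t) (at_right t)"
    using NBV_locD(3)[OF F \<open>t > 0\<close>] by (simp add: continuous_within)
  show ?thesis
    unfolding continuous_within
  proof (rule tendstoI)
    fix e :: real assume "e > 0"
    define T where "T = t + 1"
    have "variation_sums F 0 T \<noteq> {}"
      using increment_in_variation_sums[of 0 T F] \<open>t > 0\<close> by (auto simp: T_def)
    then obtain u where u: "u \<in> variation_sums F 0 T" "total_variation F T - e / 2 < u"
      using less_cSupD[of "variation_sums F 0 T" "total_variation F T - e / 2"] \<open>e > 0\<close>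
      by (auto simp: total_variation_def)
    obtain m :: nat and x where x: "mono x" "range x \<subseteq> {0..T}"
      and u_eq: "u = (\<Sum>i<m. norm (F (x (Suc i)) - F (x i)))"
      using u(1) unfolding variation_sums_def by blast
    define d where "d = Min (insert T (x ` {i. i \<le> m \<and> x i > t}))"
    have "d > t"
      unfolding d_def T_def by (subst Min_gr_iff) auto
    have d_le: "d \<le> x i" if "i \<le> m" "x i > t" for i
      unfolding d_def using that by (intro Min_le) auto
    have "d \<le> T"
      unfolding d_def by (intro Min_le) auto
    have key: "total_variation F s - total_variation F t < e / 2 + \<bar>F s - F t\<bar>"
      if s: "t < s" "s < d" for s
    proof -
      \<comment> \<open>Telescoping \<open>\<phi>\<close> counts the jump over \<open>(t, s)\<close> exactly once.\<close>
      define \<phi> where "\<phi> r = (if r \<le> t then 0 else \<bar>F s - F t\<bar>)" for r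
      have step: "norm (F (x (Suc i)) - F (x i)) \<le>
          norm (F (min (x (Suc i)) t) - F (min (x i) t)) + (\<phi> (x (Suc i)) - \<phi> (x i)) +
          norm (F (max (x (Suc i)) s) - F (max (x i) s))" if "i < m" for i
      proof -
        have "x i \<le> x (Suc i)"
          using x(1) by (simp add: monoD)
        moreover have "x j \<le> t \<or> s \<le> x j" if "j \<le> m" for j
          using d_le[OF that] s by force
        then have "x i \<le> t \<or> s \<le> x i" "x (Suc i) \<le> t \<or> s \<le> x (Suc i)"
          using \<open>i < m\<close> by auto
        ultimately consider "x (Suc i) \<le> t" "x i \<le> t" | "s \<le> x i" "s \<le> x (Suc i)"
          | "x i \<le> t" "s \<le> x (Suc i)"
          by linarith
        then show ?thesis
          using s by cases (auto simp: \<phi>_def min_def max_def)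
      qed
      have left: "(\<Sum>i<m. norm (F (min (x (Suc i)) t) - F (min (x i) t))) \<in> variation_sums F 0 t"
      proof -
        have xi: "x i \<in> {0..T}" for i
          using x(2) by blast
        show ?thesis
        proof (rule variation_sumsI[where x = "\<lambda>i. min (x i) t"])
          show "mono (\<lambda>i. min (x i) t)"
            by (intro monoI min.mono monoD[OF x(1)]) auto
          show "min (x i) t \<in> {0..t}" for i
            using xi[of i] s \<open>t > 0\<close> \<open>d \<le> T\<close> by auto
        qed
      qed
      have right: "(\<Sum>i<m. norm (F (max (x (Suc i)) s) - F (max (x i) s))) \<in> variation_sums F s T"
      proof -
        have xi: "x i \<in> {0..T}" for i
          using x(2) by blast
        show ?thesis
        proof (rule variation_sumsI[where x = "\<lambda>i. max (x i) s"])
          show "mono (\<lambda>i. max (x i) s)"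
            by (intro monoI max.mono monoD[OF x(1)]) auto
          show "max (x i) s \<in> {s..T}" for i
            using xi[of i] s \<open>t > 0\<close> \<open>d \<le> T\<close> by auto
        qed
      qed
      have "u \<le> (\<Sum>i<m. norm (F (min (x (Suc i)) t) - F (min (x i) t)) + (\<phi> (x (Suc i)) - \<phi> (x i)) +
          norm (F (max (x (Suc i)) s) - F (max (x i) s)))"
        unfolding u_eq by (intro sum_mono step) auto
      also have "\<dots> = (\<Sum>i<m. norm (F (min (x (Suc i)) t) - F (min (x i) t))) + (\<phi> (x m) - \<phi> (x 0)) +
          (\<Sum>i<m. norm (F (max (x (Suc i)) s) - F (max (x i) s)))"
        by (simp add: sum.distrib sum_lessThan_telescope[of "\<lambda>i. \<phi> (x i)"])
      also have "\<dots> \<le> total_variation F t + \<bar>F s - F t\<bar> + (total_variation F T - total_variation F s)"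
      proof (intro add_mono)
        show "\<phi> (x m) - \<phi> (x 0) \<le> \<bar>F s - F t\<bar>"
          by (auto simp: \<phi>_def)
        have "0 \<le> s" "s \<le> T"
          using s \<open>t > 0\<close> \<open>d \<le> T\<close> by linarith+
        from total_variation_concat[OF F this right]
        show "(\<Sum>i<m. norm (F (max (x (Suc i)) s) - F (max (x i) s)))
            \<le> total_variation F T - total_variation F s"
          by linarith
      qed (rule total_variation_upper[OF F left])
      finally show ?thesis
        using u(2) by linarith
    qed
    have "\<forall>\<^sub>F s in at_right t. dist (F s) (F t) < e / 2"
      using Fc \<open>e > 0\<close> by (intro tendstoD) auto
    moreover have "\<forall>\<^sub>F s in at_right t. t < s \<and> s < d"
      using eventually_at_right_real[OF \<open>d > t\<close>] by simp
    ultimately show "\<forall>\<^sub>F s in at_right t. dist (total_variation F s) (total_variation F t) < e"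
    proof eventually_elim
      case (elim s)
      have "total_variation F t \<le> total_variation F s"
        using total_variation_increment[OF F, of t s] elim \<open>t > 0\<close> by force
      then show ?case
        using key[of s] elim by (auto simp: dist_real_def)
    qed
  qed
qed

section \<open>Distribution functions on the half-line\<close>

lemma mono_tendsto_at_right:
  fixes A :: "real \<Rightarrow> real"
  assumes mono: "\<And>s t. a < s \<Longrightarrow> s \<le> t \<Longrightarrow> A s \<le> A t" and lower: "\<And>s. a < s \<Longrightarrow> c \<le> A s"
  shows "(A \<longlongrightarrow> (INF s\<in>{a<..}. A s)) (at_right a)"
proof (rule order_tendstoI)
  have bdd: "bdd_below (A ` {a<..})"
    using lower by (auto intro!: bdd_belowI[of _ c])
  fix b
  {
    assume "b < (INF s\<in>{a<..}. A s)"
    then have "b < A s" if "s > a" for s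
      using cINF_lower[OF bdd, of s] that by force
    then show "\<forall>\<^sub>F s in at_right a. b < A s"
      using eventually_at_right_less[of a] by (auto elim: eventually_mono)
  next
    assume "(INF s\<in>{a<..}. A s) < b"
    then obtain s where s: "s > a" "A s < b"
      using cINF_less_iff[OF _ bdd, of b] by auto
    then have "A r < b" if "a < r" "r < s" for r
      using mono[of r s] that by force
    then show "\<forall>\<^sub>F r in at_right a. A r < b"
      using eventually_at_right_real[OF s(1)] by (auto elim!: eventually_mono)
  }
qed

text \<open>The positive and negative variation functions satisfy these conditions, but need not be
  continuous from the right at 0; passing to \<open>distribution_ext\<close> repairs that.\<close>

locale mono_distribution =
  fixes A :: "real \<Rightarrow> real"
  assumes zero: "A 0 = 0"
    and mono: "0 \<le> s \<Longrightarrow> s \<le> t \<Longrightarrow> A s \<le> A t"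
    and right_cont: "t > 0 \<Longrightarrow> continuous (at_right t) A"
begin

lemma nonneg: "0 \<le> t \<Longrightarrow> 0 \<le> A t"
  using mono[of 0 t] zero by simp

lemma lim_0: "(A \<longlongrightarrow> distribution_ext A 0) (at_right 0)"
proof -
  have *: "(A \<longlongrightarrow> (INF s\<in>{0<..}. A s)) (at_right 0)"
    using mono nonneg by (intro mono_tendsto_at_right[where c = 0]) auto
  then have "Lim (at_right 0) A = (INF s\<in>{0<..}. A s)"
    by (intro tendsto_Lim) auto
  with * show ?thesis
    by (simp add: distribution_ext_def)
qed

lemma ext_0_le: "0 < t \<Longrightarrow> distribution_ext A 0 \<le> A t"
  using lim_0 by (rule tendsto_upperbound)
    (auto intro!: eventually_mono[OF eventually_at_right_real[of 0 t]] mono)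

lemma ext_0_nonneg: "0 \<le> distribution_ext A 0"
  using lim_0 by (rule tendsto_lowerbound)
    (auto intro!: eventually_mono[OF eventually_at_right_less[of 0]] nonneg)

lemma ext_pos: "t > 0 \<Longrightarrow> distribution_ext A t = A t"
  and ext_neg: "t < 0 \<Longrightarrow> distribution_ext A t = 0"
  by (auto simp: distribution_ext_def)

lemma ext_mono: "s \<le> t \<Longrightarrow> distribution_ext A s \<le> distribution_ext A t"
  using ext_0_le[of t] ext_0_nonneg nonneg[of t] mono[of s t]
  by (cases "s < 0"; cases "s = 0"; cases "t = 0"; cases "t < 0") (auto simp: ext_pos ext_neg)

lemma ext_right_cont: "continuous (at_right t) (distribution_ext A)"
proof -
  consider "t < 0" | "t = 0" | "t > 0" by linarith
  then show ?thesis
  proof cases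
    case 1
    have "\<forall>\<^sub>F s in at_right t. distribution_ext A s = 0"
      using eventually_at_right_real[OF 1] by eventually_elim (auto simp: ext_neg)
    then show ?thesis
      using 1 by (simp add: continuous_within ext_neg tendsto_eventually)
  next
    case 2
    have "\<forall>\<^sub>F s in at_right 0. A s = distribution_ext A s"
      using eventually_at_right_less[of 0] by eventually_elim (auto simp: ext_pos)
    then show ?thesis
      using 2 lim_0 by (auto simp: continuous_within intro: Lim_transform_eventually)
  next
    case 3
    have "\<forall>\<^sub>F s in at_right t. A s = distribution_ext A s"
      using eventually_at_right_less[of t] by eventually_elim (use 3 in \<open>auto simp: ext_pos\<close>)
    then show ?thesis
      using 3 right_cont[OF 3]
      by (auto simp: continuous_within ext_pos intro: Lim_transform_eventually)
  qed
qed

end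

lemma NBV_parts:
  assumes "NBV_loc F"
  shows "mono_distribution (\<lambda>t. (total_variation F t + F t) / 2)"
    and "mono_distribution (\<lambda>t. (total_variation F t - F t) / 2)"
proof -
  have "total_variation F s + \<bar>F t - F s\<bar> \<le> total_variation F t" if "0 \<le> s" "s \<le> t" for s t
    by (rule total_variation_increment[OF assms that])
  note V = this
  show "mono_distribution (\<lambda>t. (total_variation F t + F t) / 2)"
    using NBV_locD[OF assms] total_variation_right_continuous[OF assms]
    by unfold_locales (auto intro!: continuous_intros dest: V)
  show "mono_distribution (\<lambda>t. (total_variation F t - F t) / 2)"
    using NBV_locD[OF assms] total_variation_right_continuous[OF assms]
    by unfold_locales (auto intro!: continuous_intros dest: V)
qed

text \<open>The Jordan decomposition at the level of distribution functions. The value at 0 has to be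
  treated by limits, because it is defined by one.\<close>

lemma NBV_ext:
  assumes "NBV_loc F"
  shows "distribution_ext F t = distribution_ext (\<lambda>t. (total_variation F t + F t) / 2) t -
    distribution_ext (\<lambda>t. (total_variation F t - F t) / 2) t" (is "_ = ?P t - ?N t")
proof -
  interpret P: mono_distribution "\<lambda>t. (total_variation F t + F t) / 2"
    using assms by (rule NBV_parts)
  interpret N: mono_distribution "\<lambda>t. (total_variation F t - F t) / 2"
    using assms by (rule NBV_parts)
  have "F t = (total_variation F t + F t) / 2 - (total_variation F t - F t) / 2" for t
    by (simp add: field_simps)
  moreover have "((\<lambda>t. (total_variation F t + F t) / 2 - (total_variation F t - F t) / 2)
      \<longlongrightarrow> ?P 0 - ?N 0) (at_right 0)"
    by (intro tendsto_diff P.lim_0 N.lim_0)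
  ultimately have "(F \<longlongrightarrow> ?P 0 - ?N 0) (at_right 0)"
    by simp
  then have "Lim (at_right 0) F = ?P 0 - ?N 0"
    by (intro tendsto_Lim) auto
  then have "distribution_ext F 0 = ?P 0 - ?N 0"
    by (simp add: distribution_ext_def)
  then show ?thesis
    by (cases "t = 0"; cases "t < 0") (auto simp: P.ext_pos P.ext_neg N.ext_pos N.ext_neg distribution_ext_def field_simps)
qed

lemma NBV_lim_0:
  assumes "NBV_loc F"
  shows "(F \<longlongrightarrow> distribution_ext F 0) (at_right 0)"
proof -
  interpret P: mono_distribution "\<lambda>t. (total_variation F t + F t) / 2"
    using assms by (rule NBV_parts)
  interpret N: mono_distribution "\<lambda>t. (total_variation F t - F t) / 2"
    using assms by (rule NBV_parts)
  have "F t = (total_variation F t + F t) / 2 - (total_variation F t - F t) / 2" for t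
    by (simp add: field_simps)
  then show ?thesis
    using tendsto_diff[OF P.lim_0 N.lim_0] by (simp add: NBV_ext[OF assms])
qed

lemma NBV_ext_right_cont:
  assumes "NBV_loc F"
  shows "continuous (at_right t) (distribution_ext F)"
proof -
  have "continuous (at_right t) (\<lambda>t. distribution_ext (\<lambda>t. (total_variation F t + F t) / 2) t -
    distribution_ext (\<lambda>t. (total_variation F t - F t) / 2) t)"
    using NBV_parts[OF assms] by (intro continuous_intros mono_distribution.ext_right_cont)
  then show ?thesis
    by (simp add: NBV_ext[OF assms, abs_def])
qed

lemma borel_measurable_NBV_ext [measurable]:
  assumes "NBV_loc F"
  shows "distribution_ext F \<in> borel_measurable borel"
proof -
  have "mono (distribution_ext (\<lambda>t. (total_variation F t + F t) / 2))"
    "mono (distribution_ext (\<lambda>t. (total_variation F t - F t) / 2))"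
    using NBV_parts[OF assms] by (auto intro!: monoI mono_distribution.ext_mono)
  then have "(\<lambda>t. distribution_ext (\<lambda>t. (total_variation F t + F t) / 2) t -
    distribution_ext (\<lambda>t. (total_variation F t - F t) / 2) t) \<in> borel_measurable borel"
    by (intro borel_measurable_diff borel_measurable_mono)
  then show ?thesis
    by (simp add: NBV_ext[OF assms, abs_def])
qed

section \<open>Measures on the half-line\<close>

text \<open>The test functions for measures on \<open>[0, \<infinity>)\<close>. Values on the negative axis are left free, so
  that reflected functions \<open>\<tau> \<mapsto> g (t - \<tau>)\<close> with \<open>g\<close> growing at infinity are covered.\<close>

definition bdd_borel :: "real \<Rightarrow> (real \<Rightarrow> real) \<Rightarrow> bool" where
  "bdd_borel T g \<longleftrightarrow> g \<in> borel_measurable borel \<and> (\<exists>B. \<forall>x\<ge>0. \<bar>g x\<bar> \<le> B) \<and> (\<forall>x>T. g x = 0)"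

definition bdd_borel2 :: "real \<Rightarrow> (real \<Rightarrow> real \<Rightarrow> real) \<Rightarrow> bool" where
  "bdd_borel2 T h \<longleftrightarrow> case_prod h \<in> borel_measurable (borel \<Otimes>\<^sub>M borel) \<and>
     (\<exists>B. \<forall>x\<ge>0. \<forall>y\<ge>0. \<bar>h x y\<bar> \<le> B) \<and> (\<forall>x\<ge>0. \<forall>y\<ge>0. x > T \<or> y > T \<longrightarrow> h x y = 0)"

locale half_line_measure =
  fixes M :: "real measure"
  assumes sets_eq [measurable_cong]: "sets M = sets borel"
    and null: "emeasure M {..<0} = 0"
    and finite_Iic: "emeasure M {..T} < \<infinity>"
begin

lemma space_eq [simp]: "space M = UNIV"
  using sets_eq_imp_space_eq[OF sets_eq] by simp

sublocale sigma_finite_measure M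
proof
  show "\<exists>A. countable A \<and> A \<subseteq> sets M \<and> \<Union> A = space M \<and> (\<forall>a\<in>A. emeasure M a \<noteq> \<infinity>)"
  proof (intro exI[of _ "range (\<lambda>n::nat. {..real n})"] conjI)
    show "\<Union> (range (\<lambda>n::nat. {..real n})) = space M"
      by (auto intro: real_arch_simple)
    show "\<forall>a\<in>range (\<lambda>n::nat. {..real n}). emeasure M a \<noteq> \<infinity>"
      using finite_Iic by (auto simp: less_top[symmetric])
  qed (auto simp: sets_eq)
qed

lemma AE_nonneg: "AE x in M. 0 \<le> x"
proof (rule AE_I)
  show "{x \<in> space M. \<not> 0 \<le> x} \<subseteq> {..<0}"
    by auto
qed (auto simp: null sets_eq)

lemma integrable_dominating: "integrable M (\<lambda>x. B * indicator {..T} x :: real)"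
  by (intro integrable_mult_right integrable_real_indicator finite_Iic) (simp add: sets_eq)

lemma bdd_borel_dominated:
  assumes "bdd_borel T g" "\<And>x. 0 \<le> x \<Longrightarrow> \<bar>g x\<bar> \<le> B"
  shows "AE x in M. norm (g x) \<le> B * indicator {..T} x"
  using AE_nonneg by eventually_elim (use assms in \<open>auto simp: bdd_borel_def indicator_def\<close>)

lemma integrable_bdd_borel:
  assumes "bdd_borel T g"
  shows "integrable M g"
proof -
  obtain B where B: "\<And>x. 0 \<le> x \<Longrightarrow> \<bar>g x\<bar> \<le> B"
    using assms by (auto simp: bdd_borel_def)
  have "g \<in> borel_measurable M"
    using assms by (simp add: bdd_borel_def measurable_cong_sets[OF sets_eq refl])
  moreover have "AE x in M. norm (g x) \<le> norm (B * indicator {..T} x)"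
    using bdd_borel_dominated[OF assms, of B] B by (auto elim: eventually_mono)
  ultimately show ?thesis
    by (intro Bochner_Integration.integrable_bound[OF integrable_dominating])
qed

lemma integral_bdd_borel_bound:
  assumes "bdd_borel T g" "\<And>x. 0 \<le> x \<Longrightarrow> \<bar>g x\<bar> \<le> B"
  shows "\<bar>integral\<^sup>L M g\<bar> \<le> B * measure M {..T}"
proof -
  have "\<bar>integral\<^sup>L M g\<bar> \<le> (\<integral>x. \<bar>g x\<bar> \<partial>M)"
    by (rule integral_abs_bound)
  also have "\<dots> \<le> (\<integral>x. B * indicator {..T} x \<partial>M)"
    using bdd_borel_dominated[OF assms] integrable_bdd_borel[OF assms(1)] integrable_dominating
    by (intro integral_mono_AE) auto
  finally show ?thesis
    by (simp add: sets_eq)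
qed

lemma integral_cong_nonneg:
  fixes f g :: "real \<Rightarrow> real"
  assumes "f \<in> borel_measurable borel" "g \<in> borel_measurable borel"
    and "\<And>x. 0 \<le> x \<Longrightarrow> f x = g x"
  shows "integral\<^sup>L M f = integral\<^sup>L M g"
proof (rule integral_cong_AE)
  show "AE x in M. f x = g x"
    using AE_nonneg by eventually_elim (rule assms)
qed (use assms in \<open>auto simp: measurable_cong_sets[OF sets_eq refl]\<close>)

lemma bdd_borel_dominated_convergence:
  fixes f :: "nat \<Rightarrow> real \<Rightarrow> real"
  assumes "\<And>n. bdd_borel T (f n)" "\<And>n x. 0 \<le> x \<Longrightarrow> \<bar>f n x\<bar> \<le> B" "bdd_borel T g"
    and "\<And>x. 0 \<le> x \<Longrightarrow> (\<lambda>n. f n x) \<longlonglongrightarrow> g x"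
  shows "(\<lambda>n. integral\<^sup>L M (f n)) \<longlonglongrightarrow> integral\<^sup>L M g"
proof (rule integral_dominated_convergence[OF _ _ integrable_dominating])
  show "AE x in M. (\<lambda>n. f n x) \<longlonglongrightarrow> g x"
    using AE_nonneg by eventually_elim (rule assms)
  show "AE x in M. norm (f n x) \<le> B * indicator {..T} x" for n
    using assms(1,2) by (rule bdd_borel_dominated)
qed (use assms in \<open>auto simp: bdd_borel_def measurable_cong_sets[OF sets_eq refl]\<close>)

lemma borel_measurable_parametric_integral:
  fixes h :: "real \<Rightarrow> real \<Rightarrow> real"
  assumes "case_prod h \<in> borel_measurable (borel \<Otimes>\<^sub>M borel)"
  shows "(\<lambda>x. \<integral>y. h x y \<partial>M) \<in> borel_measurable borel"
proof -
  have "case_prod h \<in> borel_measurable (borel \<Otimes>\<^sub>M M)"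
    using assms by (simp add: measurable_cong_sets[OF sets_pair_measure_cong[OF refl sets_eq] refl])
  then show ?thesis
    using borel_measurable_lebesgue_integral[of h borel] by simp
qed

end

lemma bdd_borel2_section_measurable:
  assumes "bdd_borel2 T h" "0 \<le> x"
  shows "(\<lambda>y. h x y) \<in> borel_measurable borel"
proof -
  have [measurable]: "case_prod h \<in> borel_measurable (borel \<Otimes>\<^sub>M borel)"
    using assms by (simp add: bdd_borel2_def)
  have "(\<lambda>y. case_prod h (x, y)) \<in> borel_measurable borel"
    by measurable
  then show ?thesis by simp
qed

text \<open>Cutting \<open>h\<close> to the positive quadrant changes no integral and makes it bounded with support of
  finite measure.\<close>

lemma half_line_Fubini:
  assumes M: "half_line_measure M" and N: "half_line_measure N" and h: "bdd_borel2 T h"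
  shows "(\<integral>x. (\<integral>y. h x y \<partial>N) \<partial>M) = (\<integral>y. (\<integral>x. h x y \<partial>M) \<partial>N)"
proof -
  interpret M: half_line_measure M by fact
  interpret N: half_line_measure N by fact
  interpret P: pair_sigma_finite M N ..
  define k where "k x y = indicator {0..} x * (indicator {0..} y * h x y)" for x y
  have h_meas [measurable]: "case_prod h \<in> borel_measurable (borel \<Otimes>\<^sub>M borel)"
    using h by (simp add: bdd_borel2_def)
  have k_meas [measurable]: "case_prod k \<in> borel_measurable (borel \<Otimes>\<^sub>M borel)"
    unfolding k_def by measurable
  obtain B where B: "\<And>x y. 0 \<le> x \<Longrightarrow> 0 \<le> y \<Longrightarrow> \<bar>h x y\<bar> \<le> B"
    using h unfolding bdd_borel2_def by blast
  have sets_MN: "sets (M \<Otimes>\<^sub>M N) = sets (borel \<Otimes>\<^sub>M borel)"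
    by (intro sets_pair_measure_cong M.sets_eq N.sets_eq)
  have "emeasure (M \<Otimes>\<^sub>M N) ({..T} \<times> {..T}) = emeasure M {..T} * emeasure N {..T}"
    by (intro N.emeasure_pair_measure_Times) (auto simp: M.sets_eq N.sets_eq)
  then have fin: "emeasure (M \<Otimes>\<^sub>M N) ({..T} \<times> {..T}) < \<infinity>"
    using M.finite_Iic[of T] N.finite_Iic[of T] by (simp add: ennreal_mult_less_top)
  have "integrable (M \<Otimes>\<^sub>M N) (\<lambda>z. B * indicator ({..T} \<times> {..T}) z :: real)"
    using fin by (intro integrable_mult_right integrable_real_indicator) (auto simp: sets_MN)
  then have "integrable (M \<Otimes>\<^sub>M N) (case_prod k)"
  proof (rule Bochner_Integration.integrable_bound)
    show "case_prod k \<in> borel_measurable (M \<Otimes>\<^sub>M N)"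
      using k_meas by (simp add: measurable_cong_sets[OF sets_MN refl])
    have "\<bar>k x y\<bar> \<le> \<bar>B * indicator ({..T} \<times> {..T}) (x, y)\<bar>" for x y
    proof (cases "0 \<le> x \<and> 0 \<le> y")
      case True
      then show ?thesis
        using B[of x y] h by (auto simp: k_def bdd_borel2_def indicator_def)
    qed (auto simp: k_def indicator_def)
    then show "AE z in M \<Otimes>\<^sub>M N. norm (case_prod k z) \<le> norm (B * indicator ({..T} \<times> {..T}) z)"
      by (intro AE_I2) auto
  qed
  then have "(\<integral>y. (\<integral>x. k x y \<partial>M) \<partial>N) = (\<integral>x. (\<integral>y. k x y \<partial>N) \<partial>M)"
    by (rule P.Fubini_integral)
  moreover have "(\<integral>x. k x y \<partial>M) = indicator {0..} y * (\<integral>x. h x y \<partial>M)" for y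
  proof -
    have [measurable]: "(\<lambda>x. h x y) \<in> borel_measurable borel"
      by measurable
    have "(\<integral>x. k x y \<partial>M) = (\<integral>x. indicator {0..} y * h x y \<partial>M)"
      by (rule M.integral_cong_nonneg) (auto simp: k_def)
    then show ?thesis by simp
  qed
  moreover have "(\<integral>y. k x y \<partial>N) = indicator {0..} x * (\<integral>y. h x y \<partial>N)" for x
  proof -
    have [measurable]: "(\<lambda>y. h x y) \<in> borel_measurable borel"
      by measurable
    have "(\<integral>y. k x y \<partial>N) = (\<integral>y. indicator {0..} x * h x y \<partial>N)"
      by (rule N.integral_cong_nonneg) (auto simp: k_def)
    then show ?thesis by simp
  qed
  moreover have "(\<integral>x. indicator {0..} x * (\<integral>y. h x y \<partial>N) \<partial>M) = (\<integral>x. (\<integral>y. h x y \<partial>N) \<partial>M)"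
    using N.borel_measurable_parametric_integral[OF h_meas]
    by (intro M.integral_cong_nonneg) auto
  moreover have "(\<integral>y. indicator {0..} y * (\<integral>x. h x y \<partial>M) \<partial>N) = (\<integral>y. (\<integral>x. h x y \<partial>M) \<partial>N)"
  proof -
    have "(\<lambda>(y, x). h x y) \<in> borel_measurable (borel \<Otimes>\<^sub>M borel)"
      by measurable
    then show ?thesis
      using M.borel_measurable_parametric_integral
      by (intro N.integral_cong_nonneg) auto
  qed
  ultimately show ?thesis
    by simp
qed

lemma half_line_interval_measure:
  assumes "mono_distribution A"
  shows "half_line_measure (interval_measure (distribution_ext A))"
    and "emeasure (interval_measure (distribution_ext A)) {..t} = distribution_ext A t"
proof -
  interpret mono_distribution A by fact
  let ?M = "interval_measure (distribution_ext A)"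
  have Ioc: "emeasure ?M {a<..b} = distribution_ext A b - distribution_ext A a" if "a \<le> b" for a b
    by (rule emeasure_interval_measure_Ioc[OF that ext_mono ext_right_cont])
  have Iic: "emeasure ?M {..t} = distribution_ext A t" for t
  proof -
    have "(\<lambda>n. emeasure ?M {- real n<..t}) \<longlonglongrightarrow> emeasure ?M (\<Union>n. {- real n<..t})"
      by (intro Lim_emeasure_incseq) (auto simp: incseq_def)
    moreover have "(\<Union>n. {- real n<..t}) = {..t}"
    proof -
      have "\<exists>n. - real n < x" for x
        using reals_Archimedean2[of "- x"] by (auto intro: minus_less_iff[THEN iffD1])
      then show ?thesis by auto
    qed
    moreover have "\<forall>\<^sub>F n in sequentially. emeasure ?M {- real n<..t} = distribution_ext A t"
    proof -
      obtain n0 :: nat where n0: "max 1 (- t) \<le> real n0"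
        using real_arch_simple by blast
      show ?thesis
        using eventually_ge_at_top[of n0]
      proof eventually_elim
        case (elim n)
        then have "- real n \<le> t" "- real n < 0"
          using n0 by auto
        then show ?case
          by (simp add: Ioc ext_neg)
      qed
    qed
    ultimately show ?thesis
      by (metis LIMSEQ_unique tendsto_eventually)
  qed
  then show "emeasure ?M {..t} = distribution_ext A t" .
  show "half_line_measure ?M"
  proof
    have "{..<0} = (\<Union>n. {..- 1 / real (Suc n)})"
    proof -
      have "\<exists>n. x \<le> - 1 / real (Suc n)" if neg: "x < 0" for x :: real
        proof -
        obtain n where "inverse (real (Suc n)) < - x"
          using reals_Archimedean[of "- x"] neg by auto
        then show ?thesis
          by (intro exI[of _ n]) (simp add: divide_inverse del: of_nat_Suc)
      qed
      moreover have "- 1 / real (Suc n) < 0" for n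
        by simp
      ultimately show ?thesis
        by (auto intro: le_less_trans)
    qed
    moreover have "(\<Union>n. {..- 1 / real (Suc n)}) \<in> null_sets ?M"
      by (intro null_sets_UN null_setsI) (auto simp: Iic ext_neg)
    ultimately show "emeasure ?M {..<0} = 0"
      by auto
  qed (auto simp: Iic)
qed

section \<open>A monotone class argument on the half-line\<close>

lemma bdd_borelI:
  assumes "g \<in> borel_measurable borel" "\<And>x. 0 \<le> x \<Longrightarrow> \<bar>g x\<bar> \<le> B" "\<And>x. x > T \<Longrightarrow> g x = 0"
  shows "bdd_borel T g"
  using assms by (auto simp: bdd_borel_def)

lemma bdd_borelE:
  assumes "bdd_borel T g"
  obtains B where "g \<in> borel_measurable borel" "\<And>x. 0 \<le> x \<Longrightarrow> \<bar>g x\<bar> \<le> B"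
    "\<And>x. x > T \<Longrightarrow> g x = 0" "0 \<le> B"
proof -
  obtain B where B: "\<And>x. 0 \<le> x \<Longrightarrow> \<bar>g x\<bar> \<le> B"
    using assms by (auto simp: bdd_borel_def)
  then have "0 \<le> B"
    using order_trans[OF abs_ge_zero B[of 0]] by simp
  with B show ?thesis
    using assms by (intro that[of B]) (auto simp: bdd_borel_def)
qed

lemma bdd_borel_measurable: "bdd_borel T g \<Longrightarrow> g \<in> borel_measurable borel"
  by (simp add: bdd_borel_def)

lemma bdd_borel_indicator_mult:
  assumes "bdd_borel T g" "A \<in> sets borel"
  shows "bdd_borel T (\<lambda>x. indicator A x * g x)"
proof -
  obtain B where B: "g \<in> borel_measurable borel" "\<And>x. 0 \<le> x \<Longrightarrow> \<bar>g x\<bar> \<le> B"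
      "\<And>x. x > T \<Longrightarrow> g x = 0" "0 \<le> B"
    by (rule bdd_borelE[OF assms(1)]) (rule that; assumption)
  show ?thesis
    using B assms by (intro bdd_borelI[where B = B]) (auto simp: bdd_borel_def indicator_def)
qed

lemma bdd_borel_indicator:
  assumes "A \<in> sets borel" "A \<subseteq> {..T}"
  shows "bdd_borel T (indicator A)"
  using assms by (intro bdd_borelI[where B = 1]) (auto simp: indicator_def)

lemma bdd_borel_lin:
  assumes "bdd_borel T f" "bdd_borel T g"
  shows "bdd_borel T (\<lambda>x. a * f x + b * g x)"
proof -
  obtain B where B': "f \<in> borel_measurable borel" "\<And>x. 0 \<le> x \<Longrightarrow> \<bar>f x\<bar> \<le> B"
      "\<And>x. x > T \<Longrightarrow> f x = 0" "0 \<le> B"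
    by (rule bdd_borelE[OF assms(1)]) (rule that; assumption)
  note B = B'(2,4)
  obtain C where C': "g \<in> borel_measurable borel" "\<And>x. 0 \<le> x \<Longrightarrow> \<bar>g x\<bar> \<le> C"
      "\<And>x. x > T \<Longrightarrow> g x = 0" "0 \<le> C"
    by (rule bdd_borelE[OF assms(2)]) (rule that; assumption)
  note C = C'(2,4)
  have "\<bar>a * f x + b * g x\<bar> \<le> \<bar>a\<bar> * B + \<bar>b\<bar> * C" if "0 \<le> x" for x
    using B(1)[OF that] C(1)[OF that]
    by (intro order_trans[OF abs_triangle_ineq] add_mono) (auto simp: abs_mult mult_left_mono)
  then show ?thesis
    using assms by (intro bdd_borelI[where B = "\<bar>a\<bar> * B + \<bar>b\<bar> * C"]) (auto simp: bdd_borel_def)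
qed

lemma bdd_borel_zero: "bdd_borel T (\<lambda>_. 0)"
  by (rule bdd_borelI[where B = 0]) auto

lemma bdd_borel_add: "bdd_borel T f \<Longrightarrow> bdd_borel T g \<Longrightarrow> bdd_borel T (\<lambda>x. f x + g x)"
  using bdd_borel_lin[of T f g 1 1] by simp

lemma bdd_borel_cmult: "bdd_borel T f \<Longrightarrow> bdd_borel T (\<lambda>x. c * f x)"
  using bdd_borel_lin[of T f f c 0] by simp

lemma bdd_borel_sum: "(\<And>i. i \<in> I \<Longrightarrow> bdd_borel T (f i)) \<Longrightarrow> bdd_borel T (\<lambda>x. \<Sum>i\<in>I. f i x)"
  by (induction I rule: infinite_finite_induct) (auto intro: bdd_borel_add bdd_borel_zero)

lemma bdd_borel_mono: "bdd_borel T g \<Longrightarrow> T \<le> T' \<Longrightarrow> bdd_borel T' g"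
  by (auto simp: bdd_borel_def)

lemma bdd_borel_shift:
  assumes "bdd_borel T g" "0 \<le> t"
  shows "bdd_borel (T + t) (\<lambda>\<tau>. indicator {t<..} \<tau> * g (\<tau> - t))"
proof -
  obtain B where B: "g \<in> borel_measurable borel" "\<And>x. 0 \<le> x \<Longrightarrow> \<bar>g x\<bar> \<le> B"
      "\<And>x. x > T \<Longrightarrow> g x = 0" "0 \<le> B"
    by (rule bdd_borelE[OF assms(1)]) (rule that; assumption)
  note B(1)[measurable]
  show ?thesis
    using B assms(2) by (intro bdd_borelI[where B = B]) (auto simp: indicator_def)
qed

text \<open>The functional form of the monotone class theorem: the half-lines \<open>(-\<infinity>, s]\<close> form an
  intersection-stable generator, so the property spreads to Borel sets, to nonnegative functions
  and finally to differences of those. Half-lines with \<open>s \<le> 0\<close> are reached by limits and by \<open>eq\<close>,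
  which expresses that the negative axis does not matter.\<close>

lemma bdd_borel_induct [consumes 2, case_names eq ind lin lim]:
  assumes g: "bdd_borel T g" and "T > 0"
    and eq: "\<And>f h. bdd_borel T f \<Longrightarrow> bdd_borel T h \<Longrightarrow> (\<And>x. 0 \<le> x \<Longrightarrow> f x = h x) \<Longrightarrow> P f \<Longrightarrow> P h"
    and ind: "\<And>s. 0 < s \<Longrightarrow> s \<le> T \<Longrightarrow> P (indicator {..s})"
    and lin: "\<And>f h a b. bdd_borel T f \<Longrightarrow> bdd_borel T h \<Longrightarrow> P f \<Longrightarrow> P h \<Longrightarrow> P (\<lambda>x. a * f x + b * h x)"
    and lim: "\<And>f h B. (\<And>n. bdd_borel T (f n)) \<Longrightarrow> (\<And>n. P (f n)) \<Longrightarrow> (\<And>(n::nat) x. 0 \<le> x \<Longrightarrow> \<bar>f n x\<bar> \<le> B) \<Longrightarrow>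
      bdd_borel T h \<Longrightarrow> (\<And>x. 0 \<le> x \<Longrightarrow> (\<lambda>n. f n x) \<longlonglongrightarrow> h x) \<Longrightarrow> P h"
  shows "P g"
proof -
  have bdd_borel_ind: "bdd_borel T (indicator (A \<inter> {..T}))" if "A \<in> sets borel" for A
    using that by (intro bdd_borel_indicator) auto
  have P_zero: "P (\<lambda>_. 0)"
    using lin[of "indicator {..T}" "indicator {..T}" 0 0] ind[of T] bdd_borel_indicator[of "{..T}" T] \<open>T > 0\<close>
    by simp
  have Iic: "P (indicator {..s})" if "s \<le> T" for s
  proof -
    consider "s > 0" | "s = 0" | "s < 0" by linarith
    then show ?thesis
    proof cases
      case 1
      then show ?thesis using ind that by blast
    next
      case 2
      show ?thesis
      proof (rule lim[where f = "\<lambda>n. indicator {..min T (1 / real (Suc n))}" and B = 1])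
        show "bdd_borel T (indicator {..min T (1 / real (Suc n))})" for n
          by (intro bdd_borel_indicator) auto
        show "bdd_borel T (indicator {..s})"
          using that by (intro bdd_borel_indicator) auto
        show "P (indicator {..min T (1 / real (Suc n))})" for n
          using \<open>T > 0\<close> by (intro ind) auto
        show "(\<lambda>n. indicator {..min T (1 / real (Suc n))} x :: real) \<longlonglongrightarrow> indicator {..s} x" if "0 \<le> x" for x
        proof (cases "x = 0")
          case True
          then show ?thesis using 2 \<open>T > 0\<close> by simp
        next
          case False
          then obtain n0 where n0: "1 / real (Suc n0) < x"
            using nat_approx_posE[of x] \<open>0 \<le> x\<close> by auto
          have "\<forall>\<^sub>F n in sequentially. indicator {..min T (1 / real (Suc n))} x = (0 :: real)"
            using eventually_ge_at_top[of n0]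
          proof eventually_elim
            case (elim n)
            then have "1 / real (Suc n) \<le> 1 / real (Suc n0)"
              by (intro divide_left_mono) auto
            then show ?case
              using n0 by (auto simp: indicator_def)
          qed
          moreover have "indicator {..s} x = (0 :: real)"
            using False 2 that by (auto simp: indicator_def)
          ultimately show ?thesis
            using tendsto_eventually by metis
        qed
      qed (auto simp: indicator_def)
    next
      case 3
      show ?thesis
        by (rule eq[OF bdd_borel_zero _ _ P_zero]) (use 3 that in \<open>auto intro: bdd_borel_indicator simp: indicator_def\<close>)
    qed
  qed
  have set: "P (indicator (A \<inter> {..T}))" if "A \<in> sets borel" for A
  proof -
    have "A \<in> sigma_sets UNIV (range (\<lambda>a::real. {..a}))"
      using that by (simp add: borel_eq_atMost sets_measure_of)
    then show ?thesis
    proof (rule sigma_sets_induct_disjoint[rotated 2, where P = "\<lambda>A. P (indicator (A \<inter> {..T}))"])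
      show "Int_stable (range (\<lambda>a::real. {..a}))"
        by (auto simp: Int_stable_def)
      show "range (\<lambda>a::real. {..a}) \<subseteq> Pow UNIV"
        by auto
      show "P (indicator ({} \<inter> {..T}))"
        using P_zero by (simp add: indicator_def[abs_def])
    next
      fix A assume "A \<in> range (\<lambda>a::real. {..a})"
      then obtain a where "A = {..a}" by blast
      then have "A \<inter> {..T} = {..min a T}" by auto
      then show "P (indicator (A \<inter> {..T}))"
        using Iic[of "min a T"] by simp
    next
      fix A assume A: "A \<in> sigma_sets UNIV (range (\<lambda>a::real. {..a}))" "P (indicator (A \<inter> {..T}))"
      then have A_meas: "A \<in> sets borel"
        by (simp add: borel_eq_atMost sets_measure_of)
      have "P (\<lambda>x. 1 * indicator {..T} x + (- 1) * indicator (A \<inter> {..T}) x)"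
        using A(2) Iic[of T] bdd_borel_ind[OF A_meas] by (intro lin) (auto intro: bdd_borel_indicator)
      moreover have "(\<lambda>x. 1 * indicator {..T} x + (- 1) * indicator (A \<inter> {..T}) x) =
          (indicator ((UNIV - A) \<inter> {..T}) :: real \<Rightarrow> real)"
        by (auto simp: indicator_def fun_eq_iff)
      ultimately show "P (indicator ((UNIV - A) \<inter> {..T}))"
        by simp
    next
      fix A :: "nat \<Rightarrow> real set"
      assume disj: "disjoint_family A" and A: "range A \<subseteq> sigma_sets UNIV (range (\<lambda>a::real. {..a}))"
        and PA: "\<And>i. P (indicator (A i \<inter> {..T}))"
      have A_meas: "A i \<in> sets borel" for i
        using A by (auto simp: borel_eq_atMost sets_measure_of)
      define f where "f n x = (\<Sum>i<n. indicator (A i \<inter> {..T}) x :: real)" for n x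
      have f_bdd_borel: "bdd_borel T (f n)" for n
        unfolding f_def by (intro bdd_borel_sum bdd_borel_ind A_meas)
      have f_P: "P (f n)" for n
      proof (induction n)
        case 0
        then show ?case using P_zero by (simp add: f_def[abs_def])
      next
        case (Suc n)
        have "P (\<lambda>x. 1 * f n x + 1 * indicator (A n \<inter> {..T}) x)"
          by (intro lin f_bdd_borel Suc PA bdd_borel_ind A_meas)
        then show ?case
          by (simp add: f_def[abs_def])
      qed
      have f_eq: "f n = indicator ((\<Union>i<n. A i) \<inter> {..T})" for n
      proof (induction n)
        case 0
        then show ?case by (simp add: f_def[abs_def])
      next
        case (Suc n)
        have "A n \<inter> (\<Union>i<n. A i) = {}"
        proof -
          have "A n \<inter> A i = {}" if "i < n" for i
            using disj that unfolding disjoint_family_on_def by simp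
          then show ?thesis by blast
        qed
        moreover have "f (Suc n) x = f n x + indicator (A n \<inter> {..T}) x" for x
          by (simp add: f_def)
        ultimately show ?case
          using Suc by (auto simp: fun_eq_iff indicator_def less_Suc_eq)
      qed
      show "P (indicator (\<Union> (range A) \<inter> {..T}))"
      proof (rule lim[OF f_bdd_borel f_P, where B = 1])
        show "bdd_borel T (indicator (\<Union> (range A) \<inter> {..T}))"
          using A_meas by (intro bdd_borel_ind) auto
        show "(\<lambda>n. f n x) \<longlonglongrightarrow> indicator (\<Union> (range A) \<inter> {..T}) x" for x
        proof (cases "x \<in> \<Union> (range A) \<inter> {..T}")
          case True
          then obtain i where i: "x \<in> A i" "x \<le> T" by auto
          have "\<forall>\<^sub>F n in sequentially. f n x = 1"
            using eventually_gt_at_top[of i] by eventually_elim (use i in \<open>auto simp: f_eq indicator_def\<close>)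
          then show ?thesis
            using True by (simp add: tendsto_eventually)
        next
          case False
          then have "f n x = 0" for n
            by (auto simp: f_eq indicator_def)
          then show ?thesis
            using False by (auto simp: indicator_def)
        qed
      qed (auto simp: f_eq indicator_def)
    qed
  qed
  have pos: "\<forall>B. (\<forall>x. u x \<le> B) \<longrightarrow> P (\<lambda>x. indicator {..T} x * u x)"
    if u: "u \<in> borel_measurable borel" "\<And>x. 0 \<le> u x" for u
    using u
  proof (induction u rule: borel_measurable_induct_real)
    case (set A)
    have "(\<lambda>x. indicator {..T} x * indicator A x :: real) = indicator (A \<inter> {..T})"
      by (auto simp: indicator_def fun_eq_iff)
    then show ?case
      using \<open>\<And>A. A \<in> sets borel \<Longrightarrow> P (indicator (A \<inter> {..T}))\<close>[OF set] by simp
  next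
    case (mult u c)
    show ?case
    proof (intro allI impI)
      fix B assume B: "\<forall>x. c * u x \<le> B"
      show "P (\<lambda>x. indicator {..T} x * (c * u x))"
      proof (cases "c = 0")
        case True
        then show ?thesis using P_zero by simp
      next
        case False
        then have "\<forall>x. u x \<le> B / c"
          using B mult(1) by (simp add: field_simps)
        moreover from this have "0 \<le> B / c"
          using mult(3)[of 0] order_trans by blast
        ultimately have "P (\<lambda>x. indicator {..T} x * u x)" and "bdd_borel T (\<lambda>x. indicator {..T} x * u x)"
          using mult by (auto intro!: bdd_borelI[where B = "B / c"] simp: indicator_def intro: order_trans)
        then show ?thesis
          using lin[of "\<lambda>x. indicator {..T} x * u x" "\<lambda>x. indicator {..T} x * u x" c 0]
          by (simp add: mult.left_commute)
      qed
    qed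
  next
    case (add u v)
    show ?case
    proof (intro allI impI)
      fix B assume B: "\<forall>x. v x + u x \<le> B"
      have uB: "\<forall>x. u x \<le> B" and vB: "\<forall>x. v x \<le> B"
        using B add by (meson add_increasing add_increasing2 order_trans order_refl)+
      then have Pu: "P (\<lambda>x. indicator {..T} x * u x)" and Pv: "P (\<lambda>x. indicator {..T} x * v x)"
        using add by auto
      have "0 \<le> B"
        using uB add(2)[of 0] order_trans by blast
      have "bdd_borel T (\<lambda>x. indicator {..T} x * u x)" "bdd_borel T (\<lambda>x. indicator {..T} x * v x)"
        using add uB vB \<open>0 \<le> B\<close> by (auto intro!: bdd_borelI[where B = B] simp: indicator_def)
      from lin[OF this Pu Pv, of 1 1] show "P (\<lambda>x. indicator {..T} x * (v x + u x))"
        by (simp add: algebra_simps)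
    qed
  next
    case (seq U)
    show ?case
    proof (intro allI impI)
      fix B assume B: "\<forall>x. u x \<le> B"
      have le: "U i x \<le> u x" for i x
      proof (rule incseq_le)
        show "incseq (\<lambda>i. U i x)"
          using seq.hyps(3) by (auto simp: incseq_def le_fun_def)
        show "(\<lambda>i. U i x) \<longlonglongrightarrow> u x"
          by (rule seq.hyps(4)) simp
      qed
      then have UB: "\<forall>x. U i x \<le> B" for i
        using B order_trans by blast
      have "0 \<le> B"
        using UB[of 0] seq.hyps(2)[of 0 0] order_trans by blast
      have bU: "bdd_borel T (\<lambda>x. indicator {..T} x * U i x)" for i
        using seq.hyps(1,2) UB \<open>0 \<le> B\<close> by (auto intro!: bdd_borelI[where B = B] simp: indicator_def)
      have bu: "bdd_borel T (\<lambda>x. indicator {..T} x * u x)"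
        using u B \<open>0 \<le> B\<close> by (auto intro!: bdd_borelI[where B = B] simp: indicator_def)
      show "P (\<lambda>x. indicator {..T} x * u x)"
      proof (rule lim[OF bU _ _ bu, where B = B])
        show "P (\<lambda>x. indicator {..T} x * U i x)" for i
          using seq.IH[of i] UB by blast
        show "\<bar>indicator {..T} x * U n x\<bar> \<le> B" for n x
          using seq.hyps(2)[of n x] UB \<open>0 \<le> B\<close> by (auto simp: indicator_def)
        show "(\<lambda>n. indicator {..T} x * U n x) \<longlonglongrightarrow> indicator {..T} x * u x" for x
          using seq.hyps(4)[of x] by (intro tendsto_intros) auto
      qed
    qed
  qed
  obtain B where B: "g \<in> borel_measurable borel" "\<And>x. 0 \<le> x \<Longrightarrow> \<bar>g x\<bar> \<le> B"
      "\<And>x. x > T \<Longrightarrow> g x = 0" "0 \<le> B"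
    by (rule bdd_borelE[OF g]) (rule that; assumption)
  define up where "up x = indicator {0..} x * max 0 (g x)" for x
  define un where "un x = indicator {0..} x * max 0 (- g x)" for x
  have [measurable]: "up \<in> borel_measurable borel" "un \<in> borel_measurable borel"
    unfolding up_def un_def using B(1) by measurable
  have nonneg: "0 \<le> up x" "0 \<le> un x" for x
    by (auto simp: up_def un_def)
  have upB: "up x \<le> B" "un x \<le> B" for x
    using B(2)[of x] B(4) by (auto simp: up_def un_def indicator_def)
  have P: "P (\<lambda>x. indicator {..T} x * up x)" "P (\<lambda>x. indicator {..T} x * un x)"
    using pos[THEN spec[of _ B], THEN mp, of up] pos[THEN spec[of _ B], THEN mp, of un] nonneg upB
    by simp_all
  have b: "bdd_borel T (\<lambda>x. indicator {..T} x * up x)" "bdd_borel T (\<lambda>x. indicator {..T} x * un x)"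
    using nonneg upB B(4) by (auto intro!: bdd_borelI[where B = B] simp: indicator_def)
  show ?thesis
  proof (rule eq[OF bdd_borel_lin[OF b, of 1 "- 1"] g _ lin[OF b P, of 1 "- 1"]])
    fix x :: real assume "0 \<le> x"
    then show "1 * (indicator {..T} x * up x) + - 1 * (indicator {..T} x * un x) = g x"
      using B(3)[of x] by (auto simp: up_def un_def indicator_def)
  qed
qed

section \<open>Integration against functions of locally bounded variation\<close>

definition nbv_int :: "(real \<Rightarrow> real) \<Rightarrow> (real \<Rightarrow> real) \<Rightarrow> real" where
  "nbv_int F g = integral\<^sup>L (NBV_pos F) g - integral\<^sup>L (NBV_neg F) g"

lemma half_line_NBV_pos: "NBV_loc F \<Longrightarrow> half_line_measure (NBV_pos F)"
  and half_line_NBV_neg: "NBV_loc F \<Longrightarrow> half_line_measure (NBV_neg F)"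
  unfolding NBV_pos_def NBV_neg_def by (intro half_line_interval_measure NBV_parts; assumption)+

lemma nbv_int_cong:
  assumes "NBV_loc F" "f \<in> borel_measurable borel" "g \<in> borel_measurable borel"
    and "\<And>x. 0 \<le> x \<Longrightarrow> f x = g x"
  shows "nbv_int F f = nbv_int F g"
  unfolding nbv_int_def
  using half_line_measure.integral_cong_nonneg[OF half_line_NBV_pos[OF assms(1)] assms(2-4)]
    half_line_measure.integral_cong_nonneg[OF half_line_NBV_neg[OF assms(1)] assms(2-4)]
  by simp

lemma nbv_int_lin:
  assumes "NBV_loc F" "bdd_borel T f" "bdd_borel T g"
  shows "nbv_int F (\<lambda>x. a * f x + b * g x) = a * nbv_int F f + b * nbv_int F g"
  using half_line_measure.integrable_bdd_borel[OF half_line_NBV_pos[OF assms(1)]]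
    half_line_measure.integrable_bdd_borel[OF half_line_NBV_neg[OF assms(1)]] assms(2,3)
  unfolding nbv_int_def by (simp add: algebra_simps)

lemma nbv_int_zero [simp]: "nbv_int F (\<lambda>_. 0) = 0"
  by (simp add: nbv_int_def)

lemma nbv_int_cmult: "nbv_int F (\<lambda>x. c * g x) = c * nbv_int F g"
  by (simp add: nbv_int_def algebra_simps)

lemma nbv_int_add:
  "NBV_loc F \<Longrightarrow> bdd_borel T f \<Longrightarrow> bdd_borel T g \<Longrightarrow> nbv_int F (\<lambda>x. f x + g x) = nbv_int F f + nbv_int F g"
  using nbv_int_lin[of F T f g 1 1] by simp

lemma nbv_int_diff:
  "NBV_loc F \<Longrightarrow> bdd_borel T f \<Longrightarrow> bdd_borel T g \<Longrightarrow> nbv_int F (\<lambda>x. f x - g x) = nbv_int F f - nbv_int F g"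
  using nbv_int_lin[of F T f g 1 "- 1"] by simp

lemma nbv_int_sum:
  assumes "NBV_loc F" "\<And>i. i \<in> I \<Longrightarrow> bdd_borel T (f i)"
  shows "nbv_int F (\<lambda>x. \<Sum>i\<in>I. f i x) = (\<Sum>i\<in>I. nbv_int F (f i))"
  using assms(2)
proof (induction I rule: infinite_finite_induct)
  case (insert i I)
  have "nbv_int F (\<lambda>x. \<Sum>i\<in>insert i I. f i x) = nbv_int F (\<lambda>x. f i x + (\<Sum>i\<in>I. f i x))"
    using insert(1,2) by simp
  also have "\<dots> = nbv_int F (f i) + nbv_int F (\<lambda>x. \<Sum>i\<in>I. f i x)"
    using insert.prems by (intro nbv_int_add[OF assms(1)] bdd_borel_sum) auto
  finally show ?case
    using insert by simp
qed auto

lemma nbv_int_indicator: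
  assumes "NBV_loc F"
  shows "nbv_int F (indicator {..s}) = distribution_ext F s"
proof -
  have eq: "emeasure (NBV_pos F) {..s} = distribution_ext (\<lambda>t. (total_variation F t + F t) / 2) s"
    "emeasure (NBV_neg F) {..s} = distribution_ext (\<lambda>t. (total_variation F t - F t) / 2) s"
    unfolding NBV_pos_def NBV_neg_def using NBV_parts[OF assms]
    by (auto intro: half_line_interval_measure(2))
  interpret P: mono_distribution "\<lambda>t. (total_variation F t + F t) / 2"
    using assms by (rule NBV_parts)
  interpret N: mono_distribution "\<lambda>t. (total_variation F t - F t) / 2"
    using assms by (rule NBV_parts)
  have nn: "0 \<le> distribution_ext (\<lambda>t. (total_variation F t + F t) / 2) s"
    "0 \<le> distribution_ext (\<lambda>t. (total_variation F t - F t) / 2) s"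
    using P.ext_mono[of "min s (-1)" s] P.ext_neg[of "min s (-1)"]
      N.ext_mono[of "min s (-1)" s] N.ext_neg[of "min s (-1)"] by auto
  have "measure (NBV_pos F) {..s} = distribution_ext (\<lambda>t. (total_variation F t + F t) / 2) s"
    "measure (NBV_neg F) {..s} = distribution_ext (\<lambda>t. (total_variation F t - F t) / 2) s"
    using eq nn by (simp_all add: measure_def)
  moreover have "{..s} \<inter> space (NBV_pos F) = {..s}" "{..s} \<inter> space (NBV_neg F) = {..s}"
    by (simp_all add: NBV_pos_def NBV_neg_def)
  ultimately show ?thesis
    using NBV_ext[OF assms, of s] by (simp add: nbv_int_def)
qed

lemma NBV_pos_neg_measure_Iic:
  assumes "NBV_loc F" "T > 0"
  shows "measure (NBV_pos F) {..T} + measure (NBV_neg F) {..T} = total_variation F T"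
proof -
  interpret P: mono_distribution "\<lambda>t. (total_variation F t + F t) / 2"
    using assms(1) by (rule NBV_parts)
  interpret N: mono_distribution "\<lambda>t. (total_variation F t - F t) / 2"
    using assms(1) by (rule NBV_parts)
  have "emeasure (NBV_pos F) {..T} = (total_variation F T + F T) / 2"
    "emeasure (NBV_neg F) {..T} = (total_variation F T - F T) / 2"
    unfolding NBV_pos_def NBV_neg_def using half_line_interval_measure(2)[OF P.mono_distribution_axioms, of T]
      half_line_interval_measure(2)[OF N.mono_distribution_axioms, of T] assms(2) P.ext_pos N.ext_pos
    by simp_all
  then show ?thesis
    using P.nonneg[of T] N.nonneg[of T] assms(2) by (simp add: measure_def field_simps)
qed

lemma nbv_int_bound:
  assumes "NBV_loc F" "T > 0" "bdd_borel T g" "\<And>x. 0 \<le> x \<Longrightarrow> \<bar>g x\<bar> \<le> B"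
  shows "\<bar>nbv_int F g\<bar> \<le> B * total_variation F T"
proof -
  have "\<bar>nbv_int F g\<bar> \<le> \<bar>integral\<^sup>L (NBV_pos F) g\<bar> + \<bar>integral\<^sup>L (NBV_neg F) g\<bar>"
    unfolding nbv_int_def by linarith
  also have "\<dots> \<le> B * measure (NBV_pos F) {..T} + B * measure (NBV_neg F) {..T}"
    using assms by (intro add_mono half_line_measure.integral_bdd_borel_bound half_line_NBV_pos half_line_NBV_neg)
  also have "\<dots> = B * total_variation F T"
    using NBV_pos_neg_measure_Iic[OF assms(1,2)] by (simp flip: distrib_left)
  finally show ?thesis .
qed

lemma nbv_int_convergence:
  fixes f :: "nat \<Rightarrow> real \<Rightarrow> real"
  assumes "NBV_loc F" "\<And>n. bdd_borel T (f n)" "\<And>n x. 0 \<le> x \<Longrightarrow> \<bar>f n x\<bar> \<le> B" "bdd_borel T g"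
    and "\<And>x. 0 \<le> x \<Longrightarrow> (\<lambda>n. f n x) \<longlonglongrightarrow> g x"
  shows "(\<lambda>n. nbv_int F (f n)) \<longlonglongrightarrow> nbv_int F g"
  unfolding nbv_int_def using assms
  by (intro tendsto_diff half_line_measure.bdd_borel_dominated_convergence half_line_NBV_pos half_line_NBV_neg)

lemma nbv_int_parametric_measurable:
  fixes h :: "real \<Rightarrow> real \<Rightarrow> real"
  assumes "NBV_loc F" "case_prod h \<in> borel_measurable (borel \<Otimes>\<^sub>M borel)"
  shows "(\<lambda>x. nbv_int F (h x)) \<in> borel_measurable borel"
  unfolding nbv_int_def
  using half_line_measure.borel_measurable_parametric_integral[OF half_line_NBV_pos[OF assms(1)] assms(2)]
    half_line_measure.borel_measurable_parametric_integral[OF half_line_NBV_neg[OF assms(1)] assms(2)]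
  by simp

lemma bdd_borel2I:
  assumes "case_prod h \<in> borel_measurable (borel \<Otimes>\<^sub>M borel)"
    and "\<And>x y. 0 \<le> x \<Longrightarrow> 0 \<le> y \<Longrightarrow> \<bar>h x y\<bar> \<le> B"
    and "\<And>x y. 0 \<le> x \<Longrightarrow> 0 \<le> y \<Longrightarrow> x > T \<or> y > T \<Longrightarrow> h x y = 0"
  shows "bdd_borel2 T h"
  unfolding bdd_borel2_def using assms by blast

lemma bdd_borel2_swap:
  assumes "bdd_borel2 T h"
  shows "bdd_borel2 T (\<lambda>x y. h y x)"
proof -
  obtain B where B: "\<forall>x\<ge>0. \<forall>y\<ge>0. \<bar>h x y\<bar> \<le> B"
    using assms unfolding bdd_borel2_def by blast
  have [measurable]: "case_prod h \<in> borel_measurable (borel \<Otimes>\<^sub>M borel)"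
    using assms by (simp add: bdd_borel2_def)
  show ?thesis
  proof (rule bdd_borel2I)
    show "(\<lambda>(x, y). h y x) \<in> borel_measurable (borel \<Otimes>\<^sub>M borel)"
      by measurable
  qed (use assms B in \<open>auto simp: bdd_borel2_def\<close>)
qed

lemma bdd_borel2_section:
  assumes "bdd_borel2 T h" "0 \<le> x" "T > 0"
  shows "bdd_borel T (h x)"
proof -
  obtain B where B: "\<forall>x\<ge>0. \<forall>y\<ge>0. \<bar>h x y\<bar> \<le> B"
    using assms(1) unfolding bdd_borel2_def by blast
  show ?thesis
  proof (rule bdd_borelI)
    show "h x \<in> borel_measurable borel"
      using bdd_borel2_section_measurable[OF assms(1,2)] by simp
    show "h x y = 0" if "y > T" for y
    proof -
      have "0 \<le> y" using that assms(3) by simp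
      then show ?thesis using that assms by (auto simp: bdd_borel2_def)
    qed
  qed (use B assms(2) in auto)
qed

lemma bdd_borel_nbv_int:
  assumes "NBV_loc F" "bdd_borel2 T h" "T > 0"
  shows "bdd_borel T (\<lambda>x. nbv_int F (h x))"
proof -
  obtain B where B: "\<And>x y. 0 \<le> x \<Longrightarrow> 0 \<le> y \<Longrightarrow> \<bar>h x y\<bar> \<le> B"
    using assms(2) unfolding bdd_borel2_def by blast
  show ?thesis
  proof (rule bdd_borelI)
    show "(\<lambda>x. nbv_int F (h x)) \<in> borel_measurable borel"
      using assms by (intro nbv_int_parametric_measurable) (auto simp: bdd_borel2_def)
    show "\<bar>nbv_int F (h x)\<bar> \<le> B * total_variation F T" if "0 \<le> x" for x
      using assms that B bdd_borel2_section[OF assms(2) that assms(3)] by (intro nbv_int_bound) auto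
    show "nbv_int F (h x) = 0" if "x > T" for x
    proof -
      have "nbv_int F (h x) = nbv_int F (\<lambda>_. 0)"
        using assms that by (intro nbv_int_cong bdd_borel2_section_measurable[of T]) (auto simp: bdd_borel2_def)
      then show ?thesis by simp
    qed
  qed
qed

lemma bdd_borel_parametric_integral:
  assumes "half_line_measure M" "bdd_borel2 T h" "T > 0"
  shows "bdd_borel T (\<lambda>x. \<integral>y. h x y \<partial>M)"
proof -
  interpret half_line_measure M by fact
  obtain B where B: "\<And>x y. 0 \<le> x \<Longrightarrow> 0 \<le> y \<Longrightarrow> \<bar>h x y\<bar> \<le> B"
    using assms(2) unfolding bdd_borel2_def by blast
  show ?thesis
  proof (rule bdd_borelI)
    show "(\<lambda>x. \<integral>y. h x y \<partial>M) \<in> borel_measurable borel"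
      using assms(2) by (intro borel_measurable_parametric_integral) (auto simp: bdd_borel2_def)
    show "\<bar>\<integral>y. h x y \<partial>M\<bar> \<le> B * measure M {..T}" if "0 \<le> x" for x
      using B that bdd_borel2_section[OF assms(2) that assms(3)] by (intro integral_bdd_borel_bound) auto
    show "(\<integral>y. h x y \<partial>M) = 0" if "x > T" for x
    proof -
      have "(\<integral>y. h x y \<partial>M) = (\<integral>y. 0 \<partial>M)"
        using assms(2,3) that
        by (intro integral_cong_nonneg bdd_borel2_section_measurable[of T]) (auto simp: bdd_borel2_def)
      then show ?thesis by simp
    qed
  qed
qed

lemma nbv_Fubini:
  assumes F: "NBV_loc F" and G: "NBV_loc G" and h: "bdd_borel2 T h" and "T > 0"
  shows "nbv_int F (\<lambda>x. nbv_int G (\<lambda>y. h x y)) = nbv_int G (\<lambda>y. nbv_int F (\<lambda>x. h x y))"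
proof -
  note hl = half_line_NBV_pos[OF F] half_line_NBV_neg[OF F] half_line_NBV_pos[OF G] half_line_NBV_neg[OF G]
  have int: "integrable M (\<lambda>x. \<integral>y. h x y \<partial>N)" "integrable N (\<lambda>y. \<integral>x. h x y \<partial>M)"
    if M: "half_line_measure M" and N: "half_line_measure N" for M N
    using half_line_measure.integrable_bdd_borel[OF M bdd_borel_parametric_integral[OF N h \<open>T > 0\<close>]]
      half_line_measure.integrable_bdd_borel[OF N bdd_borel_parametric_integral[OF M bdd_borel2_swap[OF h] \<open>T > 0\<close>]]
    by simp_all
  show ?thesis
    unfolding nbv_int_def
    using int[OF hl(1) hl(3)] int[OF hl(1) hl(4)] int[OF hl(2) hl(3)] int[OF hl(2) hl(4)]
      half_line_Fubini[OF hl(1) hl(3) h] half_line_Fubini[OF hl(1) hl(4) h]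
      half_line_Fubini[OF hl(2) hl(3) h] half_line_Fubini[OF hl(2) hl(4) h]
    by simp
qed

text \<open>Lebesgue measure on \<open>[0, \<infinity>)\<close> is treated as one more measure on the half-line, so that
  \<open>half_line_Fubini\<close> also exchanges measure integrals with ordinary ones.\<close>

lemma half_line_lborel: "half_line_measure (density lborel (indicator {0::real..}))"
proof
  show "emeasure (density lborel (indicator {0..})) {..<0::real} = 0"
    by (subst emeasure_density) (auto simp: nn_integral_0_iff_AE indicator_def)
  show "emeasure (density lborel (indicator {0..})) {..T::real} < \<infinity>" for T
  proof -
    have "emeasure (density lborel (indicator {0..})) {..T} = emeasure lborel {0..T}"
      by (subst emeasure_density) (auto simp: indicator_inter_arith[symmetric] atLeastAtMost_def Int_commute)
    then show ?thesis
      by (simp add: emeasure_lborel_Icc_eq)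
  qed
qed auto

lemma integral_half_line_lborel:
  fixes g :: "real \<Rightarrow> real"
  assumes "g \<in> borel_measurable borel"
  shows "integral\<^sup>L (density lborel (indicator {0::real..})) g = (\<integral>x. indicator {0..} x * g x \<partial>lborel)"
proof -
  have eq: "density lborel (indicator {0::real..}) = density lborel (\<lambda>x. ennreal (indicator {0..} x))"
    by (intro density_cong) (auto simp: indicator_def)
  show ?thesis
    unfolding eq using assms by (subst integral_density) auto
qed

lemma bdd_borel_parametric_lborel_integral:
  assumes h: "bdd_borel2 T h" and "T > 0"
  shows "bdd_borel T (\<lambda>x. \<integral>u. indicator {0..} u * h x u \<partial>lborel)"
proof -
  have [measurable]: "case_prod h \<in> borel_measurable (borel \<Otimes>\<^sub>M borel)"
    using h by (simp add: bdd_borel2_def)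
  have "(\<lambda>u. h x u) \<in> borel_measurable borel" for x
    by measurable
  then show ?thesis
    using bdd_borel_parametric_integral[OF half_line_lborel assms] by (simp add: integral_half_line_lborel)
qed

lemma nbv_lborel_Fubini:
  assumes F: "NBV_loc F" and h: "bdd_borel2 T h" and "T > 0"
  shows "nbv_int F (\<lambda>x. \<integral>u. indicator {0..} u * h x u \<partial>lborel) =
    (\<integral>u. indicator {0..} u * nbv_int F (\<lambda>x. h x u) \<partial>lborel)"
proof -
  define L where "L = density lborel (indicator {0::real..})"
  interpret L: half_line_measure L
    unfolding L_def by (rule half_line_lborel)
  have [measurable]: "case_prod h \<in> borel_measurable (borel \<Otimes>\<^sub>M borel)"
    using h by (simp add: bdd_borel2_def)
  have hs: "(\<lambda>u. h x u) \<in> borel_measurable borel" for x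
    by measurable
  have int: "integrable L (\<lambda>u. \<integral>x. h x u \<partial>M)" if M: "half_line_measure M" for M
    by (rule L.integrable_bdd_borel[OF bdd_borel_parametric_integral[OF M bdd_borel2_swap[OF h] \<open>T > 0\<close>]])
  have "nbv_int F (\<lambda>x. \<integral>u. h x u \<partial>L) = (\<integral>u. nbv_int F (\<lambda>x. h x u) \<partial>L)"
    unfolding nbv_int_def
    using half_line_Fubini[OF half_line_NBV_pos[OF F] L.half_line_measure_axioms h]
      half_line_Fubini[OF half_line_NBV_neg[OF F] L.half_line_measure_axioms h]
      int[OF half_line_NBV_pos[OF F]] int[OF half_line_NBV_neg[OF F]]
    by simp
  moreover have "(\<integral>u. h x u \<partial>L) = (\<integral>u. indicator {0..} u * h x u \<partial>lborel)" for x
    unfolding L_def by (rule integral_half_line_lborel[OF hs])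
  moreover have "(\<integral>u. nbv_int F (\<lambda>x. h x u) \<partial>L) = (\<integral>u. indicator {0..} u * nbv_int F (\<lambda>x. h x u) \<partial>lborel)"
    unfolding L_def
    by (rule integral_half_line_lborel[OF bdd_borel_measurable[OF bdd_borel_nbv_int[OF F bdd_borel2_swap[OF h] \<open>T > 0\<close>]]])
  ultimately show ?thesis
    by simp
qed

lemma NBV_integral_eq_nbv_int:
  assumes "NBV_loc F" "g \<in> borel_measurable borel"
  shows "NBV_integral F {0..t} g = nbv_int F (\<lambda>x. indicator {..t} x * g x)"
    and "NBV_integral F {0..} g = nbv_int F g"
proof -
  have "NBV_integral F {0..t} g = nbv_int F (\<lambda>x. indicator {0..t} x * g x)"
    by (simp add: NBV_integral_def nbv_int_def set_lebesgue_integral_def)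
  also have "\<dots> = nbv_int F (\<lambda>x. indicator {..t} x * g x)"
    using assms by (intro nbv_int_cong) (auto simp: indicator_def)
  finally show "NBV_integral F {0..t} g = nbv_int F (\<lambda>x. indicator {..t} x * g x)" .
  have "NBV_integral F {0..} g = nbv_int F (\<lambda>x. indicator {0..} x * g x)"
    by (simp add: NBV_integral_def nbv_int_def set_lebesgue_integral_def)
  also have "\<dots> = nbv_int F g"
    using assms by (intro nbv_int_cong) (auto simp: indicator_def)
  finally show "NBV_integral F {0..} g = nbv_int F g" .
qed

lemma NBV_measure_Icc:
  assumes "NBV_loc F"
  shows "NBV_measure F {0..c} = distribution_ext F c"
proof -
  have "measure M {0..c} = measure M {..c}" if "half_line_measure M" for M
  proof -
    interpret half_line_measure M by fact
    have "AE x in M. x \<in> {0..c} \<longleftrightarrow> x \<in> {..c}"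
      using AE_nonneg by eventually_elim auto
    then show ?thesis
      by (intro measure_eq_AE) (auto simp: sets_eq)
  qed
  then have "NBV_measure F {0..c} = nbv_int F (indicator {..c})"
    using half_line_NBV_pos[OF assms] half_line_NBV_neg[OF assms]
    by (simp add: NBV_measure_def nbv_int_def half_line_measure.space_eq)
  then show ?thesis
    by (simp add: nbv_int_indicator[OF assms])
qed

lemma NBV_conv_Icc:
  assumes F: "NBV_loc F" and G: "NBV_loc G"
  shows "NBV_conv F G {0..c} = nbv_int G (\<lambda>t. distribution_ext F (c - t))"
proof -
  have [measurable]: "distribution_ext F \<in> borel_measurable borel"
    by (rule borel_measurable_NBV_ext[OF F])
  have "NBV_measure F {s. 0 \<le> s \<and> s + t \<in> {0..c}} = distribution_ext F (c - t)" if "0 \<le> t" for t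
  proof -
    have "{s. 0 \<le> s \<and> s + t \<in> {0..c}} = {0..c - t}"
      using that by auto
    then show ?thesis
      by (simp add: NBV_measure_Icc[OF F])
  qed
  then have "indicator {0..} t *\<^sub>R NBV_measure F {s. 0 \<le> s \<and> s + t \<in> {0..c}} =
      indicator {0..} t *\<^sub>R distribution_ext F (c - t)" for t
    by (cases "0 \<le> t") (auto simp: indicator_def)
  then have "NBV_conv F G {0..c} = NBV_integral G {0..} (\<lambda>t. distribution_ext F (c - t))"
    unfolding NBV_conv_def NBV_integral_def set_lebesgue_integral_def by presburger
  also have "\<dots> = nbv_int G (\<lambda>t. distribution_ext F (c - t))"
    using F by (intro NBV_integral_eq_nbv_int[OF G]) measurable
  finally show ?thesis .
qed

section \<open>Convolution of measures with causal functions\<close>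

text \<open>Convolution with a measure on \<open>[0, \<infinity>)\<close> maps this class to itself; at time \<open>s\<close> it sees only
  values at times up to \<open>s\<close>, so local bounds are enough for all integrals to exist.\<close>

definition causal :: "(real \<Rightarrow> real) \<Rightarrow> bool" where
  "causal g \<longleftrightarrow> g \<in> borel_measurable borel \<and> (\<forall>s<0. g s = 0) \<and> (\<forall>T. \<exists>B. \<forall>s\<le>T. \<bar>g s\<bar> \<le> B)"

definition conv :: "(real \<Rightarrow> real) \<Rightarrow> (real \<Rightarrow> real) \<Rightarrow> real \<Rightarrow> real" where
  "conv F g s = nbv_int F (\<lambda>\<tau>. g (s - \<tau>))"

text \<open>Convolution with this function integrates: \<open>conv F heaviside\<close> is the distribution function of
  \<open>F\<close>. Writing distribution functions in this way reduces their convolution identities to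
  commutativity.\<close>

definition heaviside :: "real \<Rightarrow> real" where
  "heaviside = indicator {0..}"

lemma causalD:
  assumes "causal g"
  shows "g \<in> borel_measurable borel" "s < 0 \<Longrightarrow> g s = 0"
  using assms by (auto simp: causal_def)

lemma causal_boundE:
  assumes "causal g"
  obtains B where "0 \<le> B" "\<forall>s\<le>T. \<bar>g s\<bar> \<le> B"
proof -
  obtain B where B: "\<forall>s\<le>T. \<bar>g s\<bar> \<le> B"
    using assms unfolding causal_def by blast
  then have "0 \<le> B"
    using order_trans[OF abs_ge_zero, of "g T" B] by simp
  from this B show ?thesis
    by (rule that)
qed

lemma causal_lin:
  assumes "causal f" "causal g"
  shows "causal (\<lambda>x. a * f x + b * g x)"
  unfolding causal_def
proof (intro conjI allI)
  fix T
  obtain B where B: "\<forall>s\<le>T. \<bar>f s\<bar> \<le> B" by (rule causal_boundE[OF assms(1), of T])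
  obtain C where C: "\<forall>s\<le>T. \<bar>g s\<bar> \<le> C" by (rule causal_boundE[OF assms(2), of T])
  have "\<bar>a * f s + b * g s\<bar> \<le> \<bar>a\<bar> * B + \<bar>b\<bar> * C" if "s \<le> T" for s
    using B C that
    by (intro order_trans[OF abs_triangle_ineq] add_mono) (auto simp: abs_mult mult_left_mono)
  then show "\<exists>B. \<forall>s\<le>T. \<bar>a * f s + b * g s\<bar> \<le> B" by blast
qed (use assms in \<open>auto simp: causal_def\<close>)

lemma causal_add: "causal f \<Longrightarrow> causal g \<Longrightarrow> causal (\<lambda>x. f x + g x)"
  using causal_lin[of f g 1 1] by simp

lemma causal_zero: "causal (\<lambda>_. 0)"
  by (auto simp: causal_def)

lemma causal_sum: "(\<And>i. i \<in> I \<Longrightarrow> causal (f i)) \<Longrightarrow> causal (\<lambda>x. \<Sum>i\<in>I. f i x)"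
  by (induction I rule: infinite_finite_induct) (auto intro: causal_add causal_zero)

lemma causal_heaviside: "causal heaviside"
  unfolding causal_def heaviside_def by (auto intro!: exI[of _ 1] simp: indicator_def)

lemma causal_bdd_borel:
  assumes "causal g" "c \<le> T"
  shows "bdd_borel T (\<lambda>\<tau>. g (c - \<tau>))"
proof -
  obtain B where B: "\<forall>s\<le>c. \<bar>g s\<bar> \<le> B" by (rule causal_boundE[OF assms(1), of c])
  have [measurable]: "g \<in> borel_measurable borel"
    by (rule causalD[OF assms(1)])
  show ?thesis
    using B assms(2) causalD[OF assms(1)] by (intro bdd_borelI[where B = B]) auto
qed

lemma causal_bdd_borel2:
  assumes "causal g" "c \<le> T"
  shows "bdd_borel2 T (\<lambda>\<tau> \<rho>. g (c - \<tau> - \<rho>))"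
proof -
  obtain B where B: "\<forall>s\<le>c. \<bar>g s\<bar> \<le> B" by (rule causal_boundE[OF assms(1), of c])
  have [measurable]: "g \<in> borel_measurable borel"
    by (rule causalD[OF assms(1)])
  show ?thesis
    using B assms(2) causalD[OF assms(1)] by (intro bdd_borel2I[where B = B]) (auto intro!: causalD(2)[OF assms(1)])
qed

lemma causal_conv:
  assumes F: "NBV_loc F" and g: "causal g"
  shows "causal (conv F g)"
  unfolding causal_def
proof (intro conjI allI impI)
  have [measurable]: "g \<in> borel_measurable borel"
    by (rule causalD[OF g])
  show "conv F g \<in> borel_measurable borel"
    unfolding conv_def[abs_def]
    by (rule nbv_int_parametric_measurable[OF F]) measurable
  show "conv F g s = 0" if "s < 0" for s
  proof -
    have "conv F g s = nbv_int F (\<lambda>_. 0)"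
      unfolding conv_def using that by (intro nbv_int_cong[OF F]) (auto simp: causalD(2)[OF g])
    then show ?thesis by simp
  qed
  fix T
  obtain B where B: "\<forall>s\<le>T. \<bar>g s\<bar> \<le> B" by (rule causal_boundE[OF g, of T])
  have "\<bar>conv F g s\<bar> \<le> B * total_variation F (max T 1)" if "s \<le> T" for s
    unfolding conv_def using B that by (intro nbv_int_bound[OF F] causal_bdd_borel[OF g]) auto
  then show "\<exists>B. \<forall>s\<le>T. \<bar>conv F g s\<bar> \<le> B" by blast
qed

lemma conv_heaviside:
  assumes "NBV_loc F"
  shows "conv F heaviside = distribution_ext F"
proof
  fix s
  have "(\<lambda>\<tau>. heaviside (s - \<tau>)) = indicator {..s}"
    by (auto simp: heaviside_def indicator_def fun_eq_iff)
  then show "conv F heaviside s = distribution_ext F s"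
    by (simp add: conv_def nbv_int_indicator[OF assms])
qed

lemma causal_ext: "NBV_loc F \<Longrightarrow> causal (distribution_ext F)"
  using causal_conv[OF _ causal_heaviside] conv_heaviside by metis

lemma conv_commute:
  assumes "NBV_loc F" "NBV_loc G" "causal g"
  shows "conv F (conv G g) = conv G (conv F g)"
proof
  fix s
  have "conv F (conv G g) s = nbv_int F (\<lambda>\<tau>. nbv_int G (\<lambda>\<rho>. g (s - \<tau> - \<rho>)))"
    by (simp add: conv_def)
  also have "\<dots> = nbv_int G (\<lambda>\<rho>. nbv_int F (\<lambda>\<tau>. g (s - \<tau> - \<rho>)))"
    by (rule nbv_Fubini[where T = "max s 1"]) (use assms in \<open>auto intro: causal_bdd_borel2\<close>)
  finally show "conv F (conv G g) s = conv G (conv F g) s"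
    by (simp add: conv_def algebra_simps)
qed

lemma conv_add:
  assumes "NBV_loc F" "causal f" "causal g"
  shows "conv F (\<lambda>x. f x + g x) s = conv F f s + conv F g s"
  unfolding conv_def using assms by (intro nbv_int_add[where T = s] causal_bdd_borel) auto

lemma conv_diff:
  assumes "NBV_loc F" "causal f" "causal g"
  shows "conv F (\<lambda>x. f x - g x) s = conv F f s - conv F g s"
  unfolding conv_def using assms by (intro nbv_int_diff[where T = s] causal_bdd_borel) auto

lemma conv_sum:
  assumes "NBV_loc F" "\<And>i. i \<in> I \<Longrightarrow> causal (f i)"
  shows "conv F (\<lambda>x. \<Sum>i\<in>I. f i x) s = (\<Sum>i\<in>I. conv F (f i) s)"
  unfolding conv_def using assms by (intro nbv_int_sum[where T = s] causal_bdd_borel) auto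

lemma conv_right_continuous:
  assumes F: "NBV_loc F" and g: "causal g" and rc: "\<And>s. continuous (at_right s) g"
  shows "continuous (at_right t) (conv F g)"
  unfolding continuous_within_sequentially comp_def
proof (intro allI impI, elim conjE)
  fix x :: "nat \<Rightarrow> real" assume x: "\<forall>n. x n \<in> {t<..}" "x \<longlonglongrightarrow> t"
  obtain T where T: "\<And>n. \<bar>x n\<bar> \<le> T"
    using convergent_imp_Bseq[OF convergentI[OF x(2)]] by (auto simp: Bseq_def)
  obtain B where B: "\<forall>s\<le>T. \<bar>g s\<bar> \<le> B" by (rule causal_boundE[OF g, of T])
  have xT: "x n \<le> T" for n using T[of n] by linarith
  have tT: "t \<le> T" using xT[of 0] x(1) by (auto intro: order_trans less_imp_le)
  show "(\<lambda>n. conv F g (x n)) \<longlonglongrightarrow> conv F g t"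
    unfolding conv_def
  proof (rule nbv_int_convergence[OF F, where T = T and B = B])
    show "(\<lambda>n. g (x n - \<tau>)) \<longlonglongrightarrow> g (t - \<tau>)" for \<tau>
    proof -
      have "(\<lambda>n. x n - \<tau>) \<longlonglongrightarrow> t - \<tau>"
        using x(2) by (intro tendsto_intros)
      then show ?thesis
        using rc[of "t - \<tau>"] x(1) unfolding continuous_within_sequentially comp_def by auto
    qed
    show "\<bar>g (x n - \<tau>)\<bar> \<le> B" if "0 \<le> \<tau>" for n \<tau>
      using B xT[of n] that by auto
  qed (use g xT tT in \<open>auto intro: causal_bdd_borel\<close>)
qed

section \<open>Closure properties of locally bounded variation\<close>

lemma NBV_loc_add:
  fixes f g :: "real \<Rightarrow> 'v::real_normed_vector"
  assumes "NBV_loc f" "NBV_loc g"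
  shows "NBV_loc (\<lambda>t. f t + g t)"
  unfolding NBV_loc_def
proof (intro conjI allI impI)
  fix T :: real assume "T \<ge> 0"
  obtain B where B: "\<And>u. u \<in> variation_sums f 0 T \<Longrightarrow> u \<le> B"
    using assms(1) \<open>T \<ge> 0\<close> unfolding NBV_loc_def bdd_above_def by blast
  obtain C where C: "\<And>u. u \<in> variation_sums g 0 T \<Longrightarrow> u \<le> C"
    using assms(2) \<open>T \<ge> 0\<close> unfolding NBV_loc_def bdd_above_def by blast
  have "u \<le> B + C" if u: "u \<in> variation_sums (\<lambda>t. f t + g t) 0 T" for u
  proof -
    obtain m :: nat and x where x: "mono x" "range x \<subseteq> {0..T}"
      and u_eq: "u = (\<Sum>i<m. norm ((f (x (Suc i)) + g (x (Suc i))) - (f (x i) + g (x i))))"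
      using u unfolding variation_sums_def by blast
    have xi: "x i \<in> {0..T}" for i
      using x(2) by blast
    have "u \<le> (\<Sum>i<m. norm (f (x (Suc i)) - f (x i)) + norm (g (x (Suc i)) - g (x i)))"
      unfolding u_eq by (intro sum_mono) (metis add_diff_add norm_triangle_ineq)
    also have "\<dots> \<le> B + C"
      unfolding sum.distrib
      by (intro add_mono B C variation_sumsI x(1) xi)
    finally show ?thesis .
  qed
  then show "bdd_above (variation_sums (\<lambda>t. f t + g t) 0 T)"
    by (rule bdd_aboveI)
qed (use assms in \<open>auto simp: NBV_loc_def intro!: continuous_intros\<close>)

lemma NBV_loc_zero: "NBV_loc (\<lambda>_. 0)"
proof -
  have "u = 0" if "u \<in> variation_sums (\<lambda>_. 0 :: 'v::real_normed_vector) 0 T" for u T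
    using that by (auto simp: variation_sums_def)
  then show ?thesis
    by (auto simp: NBV_loc_def bdd_above_def)
qed

lemma NBV_loc_sum:
  "(\<And>i. i \<in> I \<Longrightarrow> NBV_loc (f i)) \<Longrightarrow> NBV_loc (\<lambda>t. \<Sum>i\<in>I. f i t)"
  by (induction I rule: infinite_finite_induct) (auto intro: NBV_loc_add NBV_loc_zero)

lemma bdd_above_variation_sums_diff:
  fixes f :: "real \<Rightarrow> real"
  assumes "bdd_above (variation_sums u a b)" "bdd_above (variation_sums v a b)"
    and "\<And>t. f t = u t - v t"
  shows "bdd_above (variation_sums f a b)"
proof -
  obtain B where B: "\<And>w. w \<in> variation_sums u a b \<Longrightarrow> w \<le> B"
    using assms(1) unfolding bdd_above_def by blast
  obtain C where C: "\<And>w. w \<in> variation_sums v a b \<Longrightarrow> w \<le> C"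
    using assms(2) unfolding bdd_above_def by blast
  have "w \<le> B + C" if w: "w \<in> variation_sums f a b" for w
  proof -
    obtain m :: nat and x where x: "mono x" "range x \<subseteq> {a..b}"
      and w_eq: "w = (\<Sum>i<m. norm (f (x (Suc i)) - f (x i)))"
      using w unfolding variation_sums_def by blast
    have xi: "x i \<in> {a..b}" for i
      using x(2) by blast
    have "w \<le> (\<Sum>i<m. norm (u (x (Suc i)) - u (x i)) + norm (v (x (Suc i)) - v (x i)))"
      unfolding w_eq assms(3) by (intro sum_mono) (auto simp: real_norm_def)
    also have "\<dots> \<le> B + C"
      unfolding sum.distrib by (intro add_mono B C variation_sumsI x(1) xi)
    finally show ?thesis .
  qed
  then show ?thesis
    by (rule bdd_aboveI)
qed

text \<open>The convention \<open>F 0 = 0\<close> of normalised functions, which hides the atom \<open>F(0+)\<close> at 0.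
  \<open>distribution_ext\<close> undoes it.\<close>

definition normalise_at_0 :: "(real \<Rightarrow> real) \<Rightarrow> real \<Rightarrow> real" where
  "normalise_at_0 g t = (if t = 0 then 0 else g t)"

lemma continuous_normalise:
  assumes "t > 0" "continuous (at_right t) g"
  shows "continuous (at_right t) (normalise_at_0 g)"
proof -
  have "\<forall>\<^sub>F s in at_right t. g s = normalise_at_0 g s"
    using eventually_at_right_less[of t] by eventually_elim (use assms in \<open>auto simp: normalise_at_0_def\<close>)
  then show ?thesis
    using assms by (auto simp: continuous_within normalise_at_0_def intro: Lim_transform_eventually)
qed

lemma distribution_ext_normalise:
  assumes "\<And>s. s < 0 \<Longrightarrow> g s = 0" "continuous (at_right 0) g"
  shows "distribution_ext (normalise_at_0 g) = g"
proof -
  have "\<forall>\<^sub>F s in at_right 0. g s = normalise_at_0 g s"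
    using eventually_at_right_less[of 0] by eventually_elim (auto simp: normalise_at_0_def)
  then have "(normalise_at_0 g \<longlongrightarrow> g 0) (at_right 0)"
    using assms(2) by (auto simp: continuous_within intro: Lim_transform_eventually)
  then have "Lim (at_right 0) (normalise_at_0 g) = g 0"
    by (intro tendsto_Lim) auto
  then show ?thesis
    using assms(1) by (auto simp: distribution_ext_def normalise_at_0_def fun_eq_iff)
qed

text \<open>Splitting both measures by Jordan writes the convolution as a difference of two nondecreasing
  functions that are nonnegative on \<open>[0, \<infinity>)\<close>; setting them to 0 at 0 keeps them nondecreasing there.\<close>

lemma NBV_loc_conv:
  assumes F: "NBV_loc F" and G: "NBV_loc G"
  shows "NBV_loc (normalise_at_0 (conv F (distribution_ext G)))"
proof -
  define a where "a = distribution_ext (\<lambda>t. (total_variation G t + G t) / 2)"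
  define b where "b = distribution_ext (\<lambda>t. (total_variation G t - G t) / 2)"
  interpret A: mono_distribution "\<lambda>t. (total_variation G t + G t) / 2"
    using G by (rule NBV_parts)
  interpret B: mono_distribution "\<lambda>t. (total_variation G t - G t) / 2"
    using G by (rule NBV_parts)
  have mono: "mono a" "mono b"
    by (auto simp: a_def b_def intro!: monoI A.ext_mono B.ext_mono)
  have causal: "causal a" "causal b"
  proof -
    have "causal g" if "mono g" "\<And>s. s < 0 \<Longrightarrow> g s = 0" for g :: "real \<Rightarrow> real"
      unfolding causal_def
    proof (intro conjI allI)
      show "g \<in> borel_measurable borel"
        using that(1) by (rule borel_measurable_mono)
      have nonneg: "0 \<le> g s" for s
        using monoD[OF that(1), of "min s (- 1)" s] that(2)[of "min s (- 1)"] by auto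
      show "\<exists>B. \<forall>s\<le>T. \<bar>g s\<bar> \<le> B" for T
        using monoD[OF that(1)] nonneg by (intro exI[of _ "g T"]) auto
    qed (use that in auto)
    then show "causal a" "causal b"
      using mono A.ext_neg B.ext_neg by (auto simp: a_def b_def)
  qed
  have mono_int: "(\<integral>\<tau>. g (s - \<tau>) \<partial>M) \<le> (\<integral>\<tau>. g (t - \<tau>) \<partial>M)"
    if "half_line_measure M" "mono g" "causal g" "s \<le> t" for M g s t
  proof -
    interpret half_line_measure M by fact
    show ?thesis
      using that by (intro integral_mono integrable_bdd_borel[where T = t] causal_bdd_borel) (auto simp: monoD)
  qed
  let ?P = "\<lambda>g s. \<integral>\<tau>. g (s - \<tau>) \<partial>NBV_pos F" and ?N = "\<lambda>g s. \<integral>\<tau>. g (s - \<tau>) \<partial>NBV_neg F"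
  define u where "u s = ?P a s + ?N b s" for s
  define v where "v s = ?P b s + ?N a s" for s
  have uv_mono: "u s \<le> u t" "v s \<le> v t" if "s \<le> t" for s t
    unfolding u_def v_def using that mono causal half_line_NBV_pos[OF F] half_line_NBV_neg[OF F]
    by (auto intro!: add_mono mono_int)
  have zero: "(\<integral>\<tau>. g (s - \<tau>) \<partial>M) = 0" if "half_line_measure M" "causal g" "s < 0" for M g s
  proof -
    interpret half_line_measure M by fact
    have [measurable]: "g \<in> borel_measurable borel"
      by (rule causalD[OF that(2)])
    have "(\<integral>\<tau>. g (s - \<tau>) \<partial>M) = (\<integral>\<tau>. 0 \<partial>M)"
      using that by (intro integral_cong_nonneg) (auto intro: causalD(2)[OF that(2)])
    then show ?thesis by simp
  qed
  have "u (- 1) = 0" "v (- 1) = 0"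
    unfolding u_def v_def using causal half_line_NBV_pos[OF F] half_line_NBV_neg[OF F]
    by (simp_all add: zero del: minus_diff_eq)
  then have uv_nonneg: "0 \<le> u s" "0 \<le> v s" if "0 \<le> s" for s
    using uv_mono[of "- 1" s] that by auto
  have ext: "distribution_ext G s = a s - b s" for s
    unfolding a_def b_def by (rule NBV_ext[OF G])
  have conv_eq: "conv F (distribution_ext G) s = u s - v s" for s
  proof -
    have "integrable (NBV_pos F) (\<lambda>\<tau>. a (s - \<tau>))" "integrable (NBV_pos F) (\<lambda>\<tau>. b (s - \<tau>))"
      "integrable (NBV_neg F) (\<lambda>\<tau>. a (s - \<tau>))" "integrable (NBV_neg F) (\<lambda>\<tau>. b (s - \<tau>))"
      using causal by (auto intro!: half_line_measure.integrable_bdd_borel[where T = s] causal_bdd_borel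
          half_line_NBV_pos[OF F] half_line_NBV_neg[OF F])
    then show ?thesis
      by (simp add: conv_def nbv_int_def ext u_def v_def)
  qed
  have rc: "continuous (at_right t) (conv F (distribution_ext G))" for t
    by (intro conv_right_continuous F causal_ext G NBV_ext_right_cont)
  show ?thesis
    unfolding NBV_loc_def
  proof (intro conjI allI impI)
    fix T :: real assume "T \<ge> 0"
    have *: "bdd_above (variation_sums (normalise_at_0 w) 0 T)"
      if w: "\<And>s t. s \<le> t \<Longrightarrow> w s \<le> w t" "\<And>s. 0 \<le> s \<Longrightarrow> 0 \<le> w s" for w :: "real \<Rightarrow> real"
    proof -
      have "z \<le> normalise_at_0 w T" if z: "z \<in> variation_sums (normalise_at_0 w) 0 T" for z
      proof -
        obtain m :: nat and x where x: "mono x" "range x \<subseteq> {0..T}"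
          and z_eq: "z = (\<Sum>i<m. norm (normalise_at_0 w (x (Suc i)) - normalise_at_0 w (x i)))"
          using z unfolding variation_sums_def by blast
        have xi: "x i \<in> {0..T}" for i
          using x(2) by blast
        have m: "normalise_at_0 w r \<le> normalise_at_0 w t" if "0 \<le> r" "r \<le> t" for r t
          using w(1)[OF that(2)] w(2)[of t] that by (auto simp: normalise_at_0_def)
        have "z = (\<Sum>i<m. normalise_at_0 w (x (Suc i)) - normalise_at_0 w (x i))"
          unfolding z_eq using xi x(1) m by (intro sum.cong) (auto simp: monoD)
        also have "\<dots> = normalise_at_0 w (x m) - normalise_at_0 w (x 0)"
          by (rule sum_lessThan_telescope[of "\<lambda>i. normalise_at_0 w (x i)"])
        also have "\<dots> \<le> normalise_at_0 w T"
          using m[of "x m" T] m[of 0 "x 0"] xi[of m] xi[of 0] by (auto simp: normalise_at_0_def)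
        finally show ?thesis .
      qed
      then show ?thesis
        by (rule bdd_aboveI)
    qed
    show "bdd_above (variation_sums (normalise_at_0 (conv F (distribution_ext G))) 0 T)"
    proof (rule bdd_above_variation_sums_diff)
      show "bdd_above (variation_sums (normalise_at_0 u) 0 T)" "bdd_above (variation_sums (normalise_at_0 v) 0 T)"
        using uv_mono uv_nonneg by (auto intro!: *)
    qed (simp add: normalise_at_0_def conv_eq)
  qed (auto simp: continuous_normalise rc, simp add: normalise_at_0_def)
qed

lemma NBV_loc_vec_component:
  fixes F :: "real \<Rightarrow> 'v::real_normed_vector ^ 'n"
  assumes "NBV_loc F"
  shows "NBV_loc (\<lambda>t. F t $ i)"
  unfolding NBV_loc_def
proof (intro conjI allI impI)
  fix T :: real assume "T \<ge> 0"
  obtain B where B: "\<And>u. u \<in> variation_sums F 0 T \<Longrightarrow> u \<le> B"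
    using assms \<open>T \<ge> 0\<close> unfolding NBV_loc_def bdd_above_def by blast
  have "u \<le> B" if u: "u \<in> variation_sums (\<lambda>t. F t $ i) 0 T" for u
  proof -
    obtain m :: nat and x where x: "mono x" "range x \<subseteq> {0..T}"
      and u_eq: "u = (\<Sum>k<m. norm (F (x (Suc k)) $ i - F (x k) $ i))"
      using u unfolding variation_sums_def by blast
    have xi: "x i \<in> {0..T}" for i
      using x(2) by blast
    have "u \<le> (\<Sum>k<m. norm (F (x (Suc k)) - F (x k)))"
      unfolding u_eq by (intro sum_mono) (metis Finite_Cartesian_Product.norm_nth_le vector_minus_component)
    also have "\<dots> \<le> B"
      by (intro B variation_sumsI x(1) xi)
    finally show ?thesis .
  qed
  then show "bdd_above (variation_sums (\<lambda>t. F t $ i) 0 T)"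
    by (rule bdd_aboveI)
qed (use assms in \<open>auto simp: NBV_loc_def intro!: continuous_intros\<close>)

lemma NBV_loc_vecI:
  fixes F :: "real \<Rightarrow> real ^ 'n"
  assumes "\<And>i. NBV_loc (\<lambda>t. F t $ i)"
  shows "NBV_loc F"
  unfolding NBV_loc_def
proof (intro conjI allI impI)
  fix T :: real assume "T \<ge> 0"
  have "\<exists>B. \<forall>u\<in>variation_sums (\<lambda>t. F t $ i) 0 T. u \<le> B" for i
    using assms[of i] \<open>T \<ge> 0\<close> unfolding NBV_loc_def bdd_above_def by blast
  then obtain B where B: "\<And>i u. u \<in> variation_sums (\<lambda>t. F t $ i) 0 T \<Longrightarrow> u \<le> B i"
    by metis
  have "u \<le> (\<Sum>i\<in>UNIV. B i)" if u: "u \<in> variation_sums F 0 T" for u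
  proof -
    obtain m :: nat and x where x: "mono x" "range x \<subseteq> {0..T}"
      and u_eq: "u = (\<Sum>k<m. norm (F (x (Suc k)) - F (x k)))"
      using u unfolding variation_sums_def by blast
    have xi: "x i \<in> {0..T}" for i
      using x(2) by blast
    have "u \<le> (\<Sum>k<m. \<Sum>i\<in>UNIV. norm (F (x (Suc k)) $ i - F (x k) $ i))"
      unfolding u_eq by (intro sum_mono order_trans[OF norm_le_l1_cart]) simp
    also have "\<dots> = (\<Sum>i\<in>UNIV. \<Sum>k<m. norm (F (x (Suc k)) $ i - F (x k) $ i))"
      by (rule sum.swap)
    also have "\<dots> \<le> (\<Sum>i\<in>UNIV. B i)"
      by (intro sum_mono B variation_sumsI[where F = "\<lambda>t. F t $ _"] x(1) xi)
    finally show ?thesis .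
  qed
  then show "bdd_above (variation_sums F 0 T)"
    by (rule bdd_aboveI)
next
  show "F 0 = 0"
    using assms by (simp add: NBV_loc_def vec_eq_iff)
  show "continuous (at_right t) F" if "t > 0" for t
    using assms that by (auto simp: NBV_loc_def continuous_within intro!: vec_tendstoI)
qed

section \<open>Comparison of measures through their distribution functions\<close>

lemma bdd_borel_bdd_borel2_add:
  assumes "bdd_borel T g"
  shows "bdd_borel2 T (\<lambda>\<rho> \<tau>. g (\<tau> + \<rho>))"
proof -
  obtain B where B: "g \<in> borel_measurable borel" "\<And>x. 0 \<le> x \<Longrightarrow> \<bar>g x\<bar> \<le> B"
      "\<And>x. x > T \<Longrightarrow> g x = 0" "0 \<le> B"
    by (rule bdd_borelE[OF assms]) (rule that; assumption)
  note B(1)[measurable]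
  show ?thesis
    by (rule bdd_borel2I[where B = B]) (use B in auto)
qed

text \<open>Both sides are linear in \<open>g\<close> and respect bounded convergence, and on indicators of half-lines
  the equation is the hypothesis on distribution functions.\<close>

lemma nbv_int_composite:
  fixes F0 :: "real \<Rightarrow> real" and F R :: "'i \<Rightarrow> real \<Rightarrow> real"
  assumes F0: "NBV_loc F0" and F: "\<And>i. NBV_loc (F i)" and R: "\<And>i. NBV_loc (R i)"
    and W: "NBV_loc W" and W_eq: "\<And>s. distribution_ext W s =
      distribution_ext F0 s + (\<Sum>i\<in>I. conv (R i) (distribution_ext (F i)) s)"
    and g: "bdd_borel T g" and T: "T > 0"
  shows "nbv_int W g = nbv_int F0 g + (\<Sum>i\<in>I. nbv_int (R i) (\<lambda>\<rho>. nbv_int (F i) (\<lambda>\<tau>. g (\<tau> + \<rho>))))"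
  using g T
proof (induction g rule: bdd_borel_induct)
  case (eq f h)
  note meas [measurable] = bdd_borel_measurable[OF eq(1)] bdd_borel_measurable[OF eq(2)]
  have "nbv_int W f = nbv_int W h"
    by (rule nbv_int_cong[OF W meas eq(3)])
  moreover have "nbv_int F0 f = nbv_int F0 h"
    by (rule nbv_int_cong[OF F0 meas eq(3)])
  moreover have "nbv_int (R i) (\<lambda>\<rho>. nbv_int (F i) (\<lambda>\<tau>. f (\<tau> + \<rho>))) =
      nbv_int (R i) (\<lambda>\<rho>. nbv_int (F i) (\<lambda>\<tau>. h (\<tau> + \<rho>)))" for i
  proof (rule nbv_int_cong[OF R])
    show "nbv_int (F i) (\<lambda>\<tau>. f (\<tau> + \<rho>)) = nbv_int (F i) (\<lambda>\<tau>. h (\<tau> + \<rho>))" if "0 \<le> \<rho>" for \<rho>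
      using eq(3) that by (intro nbv_int_cong[OF F]) auto
    show "(\<lambda>\<rho>. nbv_int (F i) (\<lambda>\<tau>. f (\<tau> + \<rho>))) \<in> borel_measurable borel"
      "(\<lambda>\<rho>. nbv_int (F i) (\<lambda>\<tau>. h (\<tau> + \<rho>))) \<in> borel_measurable borel"
      by (intro bdd_borel_measurable[of T] bdd_borel_nbv_int[OF F bdd_borel_bdd_borel2_add T] eq)+
  qed
  ultimately show ?case
    using eq(4) by simp
next
  case (ind s)
  have "(\<lambda>\<rho>. nbv_int (F i) (\<lambda>\<tau>. indicator {..s} (\<tau> + \<rho>))) = (\<lambda>\<rho>. distribution_ext (F i) (s - \<rho>))" for i
  proof
    fix \<rho>
    have "(\<lambda>\<tau>. indicator {..s} (\<tau> + \<rho>) :: real) = indicator {..s - \<rho>}"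
      by (auto simp: indicator_def fun_eq_iff)
    then show "nbv_int (F i) (\<lambda>\<tau>. indicator {..s} (\<tau> + \<rho>)) = distribution_ext (F i) (s - \<rho>)"
      by (simp add: nbv_int_indicator[OF F])
  qed
  then show ?case
    using W_eq[of s] by (simp add: nbv_int_indicator W F0 conv_def)
next
  case (lin f h a b)
  have inner: "nbv_int (F i) (\<lambda>\<tau>. a * f (\<tau> + \<rho>) + b * h (\<tau> + \<rho>)) =
      a * nbv_int (F i) (\<lambda>\<tau>. f (\<tau> + \<rho>)) + b * nbv_int (F i) (\<lambda>\<tau>. h (\<tau> + \<rho>))" if "0 \<le> \<rho>" for i \<rho>
    using lin(1,2) that bdd_borel2_section[OF bdd_borel_bdd_borel2_add _ T, of _ \<rho>] by (intro nbv_int_lin[OF F]) auto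
  have "nbv_int (R i) (\<lambda>\<rho>. nbv_int (F i) (\<lambda>\<tau>. a * f (\<tau> + \<rho>) + b * h (\<tau> + \<rho>))) =
      nbv_int (R i) (\<lambda>\<rho>. a * nbv_int (F i) (\<lambda>\<tau>. f (\<tau> + \<rho>)) + b * nbv_int (F i) (\<lambda>\<tau>. h (\<tau> + \<rho>)))" for i
  proof (rule nbv_int_cong[OF R])
    have "bdd_borel2 T (\<lambda>\<rho> \<tau>. a * f (\<tau> + \<rho>) + b * h (\<tau> + \<rho>))"
      by (rule bdd_borel_bdd_borel2_add[OF bdd_borel_lin[OF lin(1,2)]])
    then show "(\<lambda>\<rho>. nbv_int (F i) (\<lambda>\<tau>. a * f (\<tau> + \<rho>) + b * h (\<tau> + \<rho>))) \<in> borel_measurable borel"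
      using bdd_borel_nbv_int[OF F _ T] bdd_borel_measurable by blast
    show "(\<lambda>\<rho>. a * nbv_int (F i) (\<lambda>\<tau>. f (\<tau> + \<rho>)) + b * nbv_int (F i) (\<lambda>\<tau>. h (\<tau> + \<rho>))) \<in> borel_measurable borel"
      by (intro bdd_borel_measurable[of T] bdd_borel_lin bdd_borel_nbv_int[OF F] bdd_borel_bdd_borel2_add lin T)
  qed (rule inner)
  also have "\<dots> i = a * nbv_int (R i) (\<lambda>\<rho>. nbv_int (F i) (\<lambda>\<tau>. f (\<tau> + \<rho>))) +
      b * nbv_int (R i) (\<lambda>\<rho>. nbv_int (F i) (\<lambda>\<tau>. h (\<tau> + \<rho>)))" for i
    by (intro nbv_int_lin[OF R, of T] bdd_borel_nbv_int[OF F] bdd_borel_bdd_borel2_add lin T)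
  finally show ?case
    using lin(3,4) nbv_int_lin[OF W lin(1,2)] nbv_int_lin[OF F0 lin(1,2)]
    by (simp add: sum.distrib sum_distrib_left algebra_simps)
next
  case (lim f h B)
  have "(\<lambda>n. nbv_int (R i) (\<lambda>\<rho>. nbv_int (F i) (\<lambda>\<tau>. f n (\<tau> + \<rho>))))
      \<longlonglongrightarrow> nbv_int (R i) (\<lambda>\<rho>. nbv_int (F i) (\<lambda>\<tau>. h (\<tau> + \<rho>)))" for i
  proof (rule nbv_int_convergence[OF R, where T = T and B = "B * total_variation (F i) T"])
    show "bdd_borel T (\<lambda>\<rho>. nbv_int (F i) (\<lambda>\<tau>. f n (\<tau> + \<rho>)))" for n
      by (intro bdd_borel_nbv_int[OF F] bdd_borel_bdd_borel2_add lim.hyps(1) T)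
    show "bdd_borel T (\<lambda>\<rho>. nbv_int (F i) (\<lambda>\<tau>. h (\<tau> + \<rho>)))"
      by (intro bdd_borel_nbv_int[OF F] bdd_borel_bdd_borel2_add lim.hyps(3) T)
    fix \<rho> :: real assume \<rho>: "0 \<le> \<rho>"
    show "\<bar>nbv_int (F i) (\<lambda>\<tau>. f n (\<tau> + \<rho>))\<bar> \<le> B * total_variation (F i) T" for n
      using lim.hyps(2) \<rho> by (intro nbv_int_bound[OF F T] bdd_borel2_section[OF bdd_borel_bdd_borel2_add[OF lim.hyps(1)] \<rho> T]) auto
    show "(\<lambda>n. nbv_int (F i) (\<lambda>\<tau>. f n (\<tau> + \<rho>))) \<longlonglongrightarrow> nbv_int (F i) (\<lambda>\<tau>. h (\<tau> + \<rho>))"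
      using lim.hyps(2,4) \<rho>
      by (intro nbv_int_convergence[OF F, where T = T and B = B] bdd_borel2_section[OF bdd_borel_bdd_borel2_add[OF lim.hyps(1)] \<rho> T]
          bdd_borel2_section[OF bdd_borel_bdd_borel2_add[OF lim.hyps(3)] \<rho> T]) auto
  qed
  then have "(\<lambda>n. nbv_int F0 (f n) + (\<Sum>i\<in>I. nbv_int (R i) (\<lambda>\<rho>. nbv_int (F i) (\<lambda>\<tau>. f n (\<tau> + \<rho>)))))
      \<longlonglongrightarrow> nbv_int F0 h + (\<Sum>i\<in>I. nbv_int (R i) (\<lambda>\<rho>. nbv_int (F i) (\<lambda>\<tau>. h (\<tau> + \<rho>))))"
    using lim by (intro tendsto_add tendsto_sum nbv_int_convergence[OF F0, where T = T and B = B]) auto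
  moreover have "(\<lambda>n. nbv_int W (f n)) \<longlonglongrightarrow> nbv_int W h"
    using lim by (intro nbv_int_convergence[OF W, where T = T and B = B]) auto
  ultimately show ?case
    using lim.IH by (simp add: LIMSEQ_unique)
qed

text \<open>The Jordan decomposition is not additive, so linearity of the integral in the integrator has to
  be obtained from the distribution functions.\<close>

lemma nbv_int_linear_distribution:
  assumes F: "NBV_loc F" and G: "NBV_loc G" and H: "NBV_loc H"
    and eq: "\<And>s. distribution_ext F s = a * distribution_ext G s + b * distribution_ext H s"
    and g: "bdd_borel T g"
  shows "nbv_int F g = a * nbv_int G g + b * nbv_int H g"
proof -
  have "bdd_borel (max T 1) g" "max T 1 > 0"
    using g by (auto intro: bdd_borel_mono)
  then show ?thesis
  proof (induction g rule: bdd_borel_induct)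
    case (eq f h)
    note meas = bdd_borel_measurable[OF eq(1)] bdd_borel_measurable[OF eq(2)]
    show ?case
      using nbv_int_cong[OF F meas eq(3)] nbv_int_cong[OF G meas eq(3)] nbv_int_cong[OF H meas eq(3)] eq(4)
      by simp
  next
    case (ind s)
    then show ?case
      using eq[of s] by (simp add: nbv_int_indicator F G H)
  next
    case (lin f h c d)
    then show ?case
      using nbv_int_lin[OF F lin(1,2)] nbv_int_lin[OF G lin(1,2)] nbv_int_lin[OF H lin(1,2)]
      by (simp add: algebra_simps)
  next
    case (lim f h B)
    note conv = nbv_int_convergence[OF _ lim.hyps(1) lim.hyps(2) lim.hyps(3) lim.hyps(4)]
    have "(\<lambda>n. a * nbv_int G (f n) + b * nbv_int H (f n)) \<longlonglongrightarrow> a * nbv_int G h + b * nbv_int H h"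
      by (intro tendsto_intros conv G H)
    then have "(\<lambda>n. nbv_int F (f n)) \<longlonglongrightarrow> a * nbv_int G h + b * nbv_int H h"
      by (simp only: lim.IH)
    moreover have "(\<lambda>n. nbv_int F (f n)) \<longlonglongrightarrow> nbv_int F h"
      by (intro conv F)
    ultimately show ?case
      by (rule LIMSEQ_unique[symmetric])
  qed
qed

text \<open>Each variation sum is the supremum over signs of finite linear combinations of values, and these
  are bounded linear in \<open>y'\<close>. They are bounded pointwise by the total variation, hence uniformly.\<close>

lemma total_variation_uniform_bound:
  fixes F :: "'b::banach \<Rightarrow> real \<Rightarrow> real"
  assumes NBV: "\<And>y'. NBV_loc (F y')" and lin: "\<And>t. 0 \<le> t \<Longrightarrow> bounded_linear (\<lambda>y'. F y' t)" and "0 \<le> T"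
  obtains C where "0 \<le> C" "\<And>y'. total_variation (F y') T \<le> C * norm y'"
proof -
  define I where "I = {(m :: nat, x :: nat \<Rightarrow> real, e :: nat \<Rightarrow> real). mono x \<and> (\<forall>i. x i \<in> {0..T}) \<and> (\<forall>i. \<bar>e i\<bar> \<le> 1)}"
  define f where "f = (\<lambda>(m :: nat, x :: nat \<Rightarrow> real, e :: nat \<Rightarrow> real) y'. \<Sum>i<m. e i * (F y' (x (Suc i)) - F y' (x i)))"
  have f_lin: "bounded_linear (f c)" if c: "c \<in> I" for c
  proof -
    obtain m x e where "c = (m, x, e)" by (cases c)
    with c show ?thesis
      by (auto simp: I_def f_def intro!: bounded_linear_sum bounded_linear_const_mult bounded_linear_sub lin)
  qed
  have f_le: "\<bar>f c y'\<bar> \<le> total_variation (F y') T" if c: "c \<in> I" for c y'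
  proof -
    obtain m x e where ce: "c = (m, x, e)" by (cases c)
    with c have x: "mono x" "\<And>i. x i \<in> {0..T}" and e: "\<And>i. \<bar>e i\<bar> \<le> 1"
      by (auto simp: I_def)
    have "\<bar>f c y'\<bar> \<le> (\<Sum>i<m. \<bar>e i * (F y' (x (Suc i)) - F y' (x i))\<bar>)"
      unfolding ce f_def by (simp add: sum_abs)
    also have "\<dots> \<le> (\<Sum>i<m. norm (F y' (x (Suc i)) - F y' (x i)))"
      using e by (intro sum_mono) (auto simp: abs_mult intro: mult_left_le_one_le)
    also have "\<dots> \<le> total_variation (F y') T"
      by (intro total_variation_upper NBV variation_sumsI x)
    finally show ?thesis .
  qed
  have ptw: "\<exists>B. \<forall>c\<in>I. \<bar>f c y'\<bar> \<le> B" for y'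
    using f_le by blast
  obtain C where C: "0 \<le> C" "\<And>c y'. c \<in> I \<Longrightarrow> \<bar>f c y'\<bar> \<le> C * norm y'"
    by (rule uniform_boundedness[OF f_lin ptw]) (assumption, (rule that; assumption))
  show ?thesis
  proof (rule that[OF C(1)])
    fix y'
    have "u \<le> C * norm y'" if u: "u \<in> variation_sums (F y') 0 T" for u
    proof -
      obtain m :: nat and x where x: "mono x" "range x \<subseteq> {0..T}"
        and u_eq: "u = (\<Sum>i<m. norm (F y' (x (Suc i)) - F y' (x i)))"
        using u unfolding variation_sums_def by blast
      \<comment> \<open>With these signs the linear combination is the variation sum.\<close>
      define e where "e i = sgn (F y' (x (Suc i)) - F y' (x i))" for i
      have "(m, x, e) \<in> I"
        using x by (auto simp: I_def e_def image_subset_iff sgn_if)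
      moreover have "f (m, x, e) y' = u"
        unfolding f_def u_eq e_def by (auto intro!: sum.cong simp: sgn_if)
      ultimately show ?thesis
        using C(2)[of "(m, x, e)" y'] by auto
    qed
    then show "total_variation (F y') T \<le> C * norm y'"
      unfolding total_variation_def
      using increment_in_variation_sums[OF \<open>0 \<le> T\<close>, of "F y'"] by (intro cSup_least) auto
  qed
qed

lemma NBV_loc_cong:
  assumes "NBV_loc F" "\<And>t. 0 \<le> t \<Longrightarrow> F t = G t"
  shows "NBV_loc G"
  unfolding NBV_loc_def
proof (intro conjI allI impI)
  show "bdd_above (variation_sums G 0 T)" if "0 \<le> T" for T
  proof -
    have "variation_sums G 0 T \<subseteq> variation_sums F 0 T"
    proof
      fix u assume u: "u \<in> variation_sums G 0 T"
      obtain m :: nat and x where x: "mono x" "range x \<subseteq> {0..T}"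
        and u_eq: "u = (\<Sum>i<m. norm (G (x (Suc i)) - G (x i)))"
        using u unfolding variation_sums_def by blast
      have xi: "x i \<in> {0..T}" for i
        using x(2) by blast
      have "G (x i) = F (x i)" for i
        using assms(2)[of "x i"] xi[of i] by simp
      then have "u = (\<Sum>i<m. norm (F (x (Suc i)) - F (x i)))"
        by (simp add: u_eq)
      then show "u \<in> variation_sums F 0 T"
        using variation_sumsI[OF x(1) xi] by simp
    qed
    moreover have "bdd_above (variation_sums F 0 T)"
      using assms(1) that by (simp add: NBV_loc_def)
    ultimately show ?thesis
      by (rule bdd_above_mono[rotated])
  qed
  show "G 0 = 0"
    using NBV_locD(2)[OF assms(1)] assms(2)[of 0] by simp
  show "continuous (at_right t) G" if "t > 0" for t
  proof -
    have "\<forall>\<^sub>F s in at_right t. F s = G s"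
      using eventually_at_right_less[of t] by eventually_elim (use that assms(2) in auto)
    moreover have "(F \<longlongrightarrow> G t) (at_right t)"
      using NBV_locD(3)[OF assms(1) that] assms(2)[of t] that by (simp add: continuous_within)
    ultimately show ?thesis
      by (auto simp: continuous_within intro: Lim_transform_eventually)
  qed
qed

lemma distribution_ext_cong:
  assumes "\<And>t. 0 < t \<Longrightarrow> F t = G t"
  shows "distribution_ext F = distribution_ext G"
proof -
  have "Lim (at_right 0) F = Lim (at_right 0) G"
  proof -
    have "\<forall>\<^sub>F s in at_right 0. F s = G s"
      using eventually_at_right_less[of 0] by eventually_elim (use assms in auto)
    then show ?thesis
      by (rule Lim_cong) simp
  qed
  then show ?thesis
    using assms by (auto simp: distribution_ext_def fun_eq_iff)
qed

lemma NBV_integral_cong: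
  assumes "\<And>x. x \<in> A \<Longrightarrow> f x = g x"
  shows "NBV_integral F A f = NBV_integral F A g"
proof -
  have "(\<lambda>x. indicator A x *\<^sub>R f x) = (\<lambda>x. indicator A x *\<^sub>R g x)"
    using assms by (auto simp: indicator_def fun_eq_iff)
  then show ?thesis
    by (simp add: NBV_integral_def set_lebesgue_integral_def)
qed

section \<open>Convolution with the tail of a measure\<close>

text \<open>Convolution of \<open>a\<close> with the restriction of \<open>\<mu>\<^sub>F\<close> to \<open>(\<sigma>, \<infinity>)\<close>, moved to the left by \<open>\<sigma>\<close>.\<close>

definition tail_conv :: "real \<Rightarrow> (real \<Rightarrow> real) \<Rightarrow> (real \<Rightarrow> real) \<Rightarrow> real \<Rightarrow> real" where
  "tail_conv \<sigma> F a s = nbv_int F (\<lambda>\<rho>. indicator {\<sigma><..} \<rho> * a (s + \<sigma> - \<rho>))"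

lemma causal_tail_bdd_borel:
  assumes "causal a" "c \<le> T"
  shows "bdd_borel T (\<lambda>\<rho>. indicator {\<sigma><..} \<rho> * a (c - \<rho>))" "bdd_borel T (\<lambda>\<rho>. indicator {..\<sigma>} \<rho> * a (c - \<rho>))"
  using assms by (auto intro!: bdd_borel_indicator_mult causal_bdd_borel)

lemma tail_conv_split:
  assumes F: "NBV_loc F" and a: "causal a"
  shows "nbv_int F (\<lambda>\<rho>. indicator {..\<sigma>} \<rho> * a (s + \<sigma> - \<rho>)) + tail_conv \<sigma> F a s = conv F a (s + \<sigma>)"
proof -
  have "conv F a (s + \<sigma>) =
      nbv_int F (\<lambda>\<rho>. indicator {..\<sigma>} \<rho> * a (s + \<sigma> - \<rho>) + indicator {\<sigma><..} \<rho> * a (s + \<sigma> - \<rho>))"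
    unfolding conv_def by (rule arg_cong[where f = "nbv_int F"]) (auto simp: indicator_def fun_eq_iff)
  also have "\<dots> = nbv_int F (\<lambda>\<rho>. indicator {..\<sigma>} \<rho> * a (s + \<sigma> - \<rho>)) + tail_conv \<sigma> F a s"
    unfolding tail_conv_def by (rule nbv_int_add[OF F causal_tail_bdd_borel(2)[OF a order_refl] causal_tail_bdd_borel(1)[OF a order_refl]])
  finally show ?thesis by simp
qed

lemma tail_conv_neg:
  assumes a: "causal a" and "s < 0"
  shows "tail_conv \<sigma> F a s = 0"
proof -
  have "(\<lambda>\<rho>. indicator {\<sigma><..} \<rho> * a (s + \<sigma> - \<rho>)) = (\<lambda>_. 0)"
    using assms by (auto simp: indicator_def fun_eq_iff intro: causalD(2))
  then show ?thesis
    by (simp add: tail_conv_def)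
qed

lemma causal_tail_conv:
  assumes F: "NBV_loc F" and a: "causal a" and \<sigma>: "0 \<le> \<sigma>"
  shows "causal (tail_conv \<sigma> F a)"
  unfolding causal_def
proof (intro conjI allI impI)
  have [measurable]: "a \<in> borel_measurable borel"
    by (rule causalD[OF a])
  show "tail_conv \<sigma> F a \<in> borel_measurable borel"
    unfolding tail_conv_def[abs_def]
    by (rule nbv_int_parametric_measurable[OF F]) measurable
  show "tail_conv \<sigma> F a s = 0" if "s < 0" for s
    using a that by (rule tail_conv_neg)
  fix T
  obtain B where B: "0 \<le> B" "\<forall>s\<le>T + \<sigma>. \<bar>a s\<bar> \<le> B" by (rule causal_boundE[OF a])
  have "\<bar>tail_conv \<sigma> F a s\<bar> \<le> B * total_variation F (max (T + \<sigma>) 1)" if "s \<le> T" for s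
    unfolding tail_conv_def
  proof (rule nbv_int_bound[OF F])
    show "bdd_borel (max (T + \<sigma>) 1) (\<lambda>\<rho>. indicator {\<sigma><..} \<rho> * a (s + \<sigma> - \<rho>))"
      using that by (intro causal_tail_bdd_borel[OF a]) auto
    show "\<bar>indicator {\<sigma><..} \<rho> * a (s + \<sigma> - \<rho>)\<bar> \<le> B" if "0 \<le> \<rho>" for \<rho>
      using that B \<open>s \<le> T\<close> by (auto simp: indicator_def)
  qed auto
  then show "\<exists>B. \<forall>s\<le>T. \<bar>tail_conv \<sigma> F a s\<bar> \<le> B" by blast
qed

lemma conv_tail_conv:
  assumes F: "NBV_loc F" and G: "NBV_loc G" and a: "causal a" and \<sigma>: "0 \<le> \<sigma>"
  shows "conv G (tail_conv \<sigma> F a) t = tail_conv \<sigma> F (conv G a) t"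
proof -
  have [measurable]: "a \<in> borel_measurable borel"
    by (rule causalD[OF a])
  obtain B where B: "0 \<le> B" "\<forall>s\<le>t + \<sigma>. \<bar>a s\<bar> \<le> B" by (rule causal_boundE[OF a])
  have "bdd_borel2 (max (t + \<sigma>) 1) (\<lambda>\<tau> \<rho>. indicator {\<sigma><..} \<rho> * a (t - \<tau> + \<sigma> - \<rho>))"
  proof (rule bdd_borel2I)
    show "(\<lambda>(\<tau>, \<rho>). indicator {\<sigma><..} \<rho> * a (t - \<tau> + \<sigma> - \<rho>)) \<in> borel_measurable (borel \<Otimes>\<^sub>M borel)"
      by measurable
    show "\<bar>indicator {\<sigma><..} \<rho> * a (t - \<tau> + \<sigma> - \<rho>)\<bar> \<le> B" if "0 \<le> \<tau>" "0 \<le> \<rho>" for \<tau> \<rho>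
      using that B by (auto simp: indicator_def)
    show "indicator {\<sigma><..} \<rho> * a (t - \<tau> + \<sigma> - \<rho>) = 0"
      if "0 \<le> \<tau>" "0 \<le> \<rho>" "max (t + \<sigma>) 1 < \<tau> \<or> max (t + \<sigma>) 1 < \<rho>" for \<tau> \<rho>
      using that by (auto simp: causalD(2)[OF a])
  qed
  from nbv_Fubini[OF G F this]
  have "conv G (tail_conv \<sigma> F a) t =
      nbv_int F (\<lambda>\<rho>. nbv_int G (\<lambda>\<tau>. indicator {\<sigma><..} \<rho> * a (t - \<tau> + \<sigma> - \<rho>)))"
    by (simp add: conv_def tail_conv_def)
  then show ?thesis
    by (simp add: conv_def tail_conv_def nbv_int_cmult algebra_simps)
qed

lemma tail_conv_diff:
  assumes "NBV_loc F" "causal f" "causal g"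
  shows "tail_conv \<sigma> F (\<lambda>x. f x - g x) s = tail_conv \<sigma> F f s - tail_conv \<sigma> F g s"
  unfolding tail_conv_def right_diff_distrib
  by (rule nbv_int_diff[OF assms(1) causal_tail_bdd_borel(1)[OF assms(2) order_refl] causal_tail_bdd_borel(1)[OF assms(3) order_refl]])

lemma tail_conv_sum:
  assumes "NBV_loc F" "\<And>i. i \<in> I \<Longrightarrow> causal (f i)"
  shows "tail_conv \<sigma> F (\<lambda>x. \<Sum>i\<in>I. f i x) s = (\<Sum>i\<in>I. tail_conv \<sigma> F (f i) s)"
  unfolding tail_conv_def sum_distrib_left
  by (rule nbv_int_sum[OF assms(1) causal_tail_bdd_borel(1)[OF assms(2) order_refl]])

lemma tail_conv_heaviside:
  assumes "NBV_loc F" "0 \<le> s"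
  shows "tail_conv \<sigma> F heaviside s = distribution_ext F (s + \<sigma>) - distribution_ext F \<sigma>"
proof -
  have "(\<lambda>\<rho>. indicator {\<sigma><..} \<rho> * heaviside (s + \<sigma> - \<rho>)) = (\<lambda>\<rho>. indicator {..s + \<sigma>} \<rho> - indicator {..\<sigma>} \<rho> :: real)"
    using assms(2) by (auto simp: heaviside_def indicator_def fun_eq_iff)
  then have "tail_conv \<sigma> F heaviside s = nbv_int F (\<lambda>\<rho>. indicator {..s + \<sigma>} \<rho> - indicator {..\<sigma>} \<rho>)"
    by (simp add: tail_conv_def)
  also have "\<dots> = nbv_int F (indicator {..s + \<sigma>}) - nbv_int F (indicator {..\<sigma>})"
    using assms by (intro nbv_int_diff[where T = "s + \<sigma>"] bdd_borel_indicator) auto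
  finally show ?thesis
    by (simp add: nbv_int_indicator assms)
qed

lemma conv_lin:
  assumes "NBV_loc F" "causal f" "causal g"
  shows "conv F (\<lambda>x. a * f x + b * g x) s = a * conv F f s + b * conv F g s"
  unfolding conv_def using assms by (intro nbv_int_lin[where T = s] causal_bdd_borel) auto

section \<open>Norming dual pairs and representability\<close>

text \<open>These are the standing assumptions on the pairing; the last one turns dominated convergence into
  representability.\<close>

locale norming_pair =
  fixes p :: "'b::banach \<Rightarrow> 'a::banach \<Rightarrow> real"
  assumes norming: "norming_dual_pair p"
    and complete: "sequentially_complete (pairing_topology p)"
    and seq_cont_imp_cont: "\<And>\<phi>. linear \<phi> \<Longrightarrow> seq_continuous_functional (pairing_topology p) \<phi> \<Longrightarrow>
           continuous_map (pairing_topology p) euclideanreal \<phi>"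
begin

sublocale p: bounded_bilinear p
  using norming by (simp add: norming_dual_pair_def)

lemma linear_p: "linear (p y')" "linear (\<lambda>y'. p y' y)"
  by (auto intro!: bounded_linear.linear p.bounded_linear_left p.bounded_linear_right)

lemma norm_right_eq: "norm y = (SUP y'\<in>cball 0 1. \<bar>p y' y\<bar>)"
  and norm_left_eq: "norm y' = (SUP y\<in>cball 0 1. \<bar>p y' y\<bar>)"
  using norming unfolding norming_dual_pair_def by blast+

lemma pairing_le_norm_right:
  assumes "norm y' \<le> 1"
  shows "\<bar>p y' y\<bar> \<le> norm y"
proof -
  obtain K where K: "\<And>a b. norm (p a b) \<le> norm a * norm b * K" and "K > 0"
    using p.pos_bounded by blast
  have bdd: "bdd_above ((\<lambda>y'. \<bar>p y' y\<bar>) ` cball 0 1)"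
  proof (rule bdd_aboveI2)
    fix x' :: 'b assume "x' \<in> cball 0 1"
    then have "norm x' * norm y * K \<le> 1 * norm y * K"
      using \<open>K > 0\<close> by (intro mult_right_mono) auto
    then show "\<bar>p x' y\<bar> \<le> 1 * norm y * K"
      using K[of x' y] by simp
  qed
  show ?thesis
    unfolding norm_right_eq using assms by (intro cSUP_upper[OF _ bdd]) simp
qed

text \<open>The norming property forces the constant 1 in the bound of the bilinear form.\<close>

lemma pairing_bound: "\<bar>p y' y\<bar> \<le> norm y' * norm y"
proof (cases "y' = 0")
  case True
  then show ?thesis by (simp add: p.zero_left)
next
  case False
  then have "\<bar>p ((1 / norm y') *\<^sub>R y') y\<bar> \<le> norm y"
    by (intro pairing_le_norm_right) simp
  then show ?thesis
    using False by (simp add: p.scaleR_left abs_mult field_simps)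
qed

lemma norm_right_le:
  assumes "\<And>y'. \<bar>p y' y\<bar> \<le> C * norm y'" "0 \<le> C"
  shows "norm y \<le> C"
proof -
  have "norm y = (SUP y'\<in>cball 0 1. \<bar>p y' y\<bar>)"
    by (rule norm_right_eq)
  also have "\<dots> \<le> C"
  proof (rule cSUP_least)
    fix x' :: 'b assume "x' \<in> cball 0 1"
    then have "C * norm x' \<le> C"
      using assms(2) by (simp add: mult_left_le)
    then show "\<bar>p x' y\<bar> \<le> C"
      using assms(1)[of x'] by simp
  qed simp
  finally show ?thesis .
qed

lemma norm_left_le:
  assumes "\<And>y. \<bar>p y' y\<bar> \<le> C * norm y" "0 \<le> C"
  shows "norm y' \<le> C"
proof -
  have "norm y' = (SUP y\<in>cball 0 1. \<bar>p y' y\<bar>)"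
    by (rule norm_left_eq)
  also have "\<dots> \<le> C"
  proof (rule cSUP_least)
    fix x :: 'a assume "x \<in> cball 0 1"
    then have "C * norm x \<le> C"
      using assms(2) by (simp add: mult_left_le)
    then show "\<bar>p y' x\<bar> \<le> C"
      using assms(1)[of x] by simp
  qed simp
  finally show ?thesis .
qed

lemma right_eqI: "(\<And>y'. p y' z = p y' w) \<Longrightarrow> z = w"
  using norm_right_le[of "z - w" 0] by (simp add: p.diff_right)

lemma left_eqI: "(\<And>y. p z' y = p w' y) \<Longrightarrow> z' = w'"
  using norm_left_le[of "z' - w'" 0] by (simp add: p.diff_left)

lemma twin_right_eqI: "(\<And>y'. p y' z = L y' y) \<Longrightarrow> twin_right p L y = z"
  unfolding twin_right_def by (rule the_equality) (auto intro: right_eqI)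

lemma twin_left_eqI: "(\<And>y. p z' y = L y' y) \<Longrightarrow> twin_left p L y' = z'"
  unfolding twin_left_def by (rule the_equality) (auto intro: left_eqI)

lemma pairing_twin_right:
  assumes "twin_operator p L"
  shows "p y' (twin_right p L y) = L y' y"
proof -
  obtain z where "\<And>y'. p y' z = L y' y"
    using assms unfolding twin_operator_def by blast
  then show ?thesis
    using twin_right_eqI[of z L y] by simp
qed

lemma pairing_twin_left:
  assumes "twin_operator p L"
  shows "p (twin_left p L y') y = L y' y"
proof -
  obtain z' where "\<And>y. p z' y = L y' y"
    using assms unfolding twin_operator_def by blast
  then show ?thesis
    using twin_left_eqI[of z' L y'] by simp
qed

lemma twin_comp_eq:
  assumes "twin_operator p L1" "twin_operator p L2"
  shows "twin_comp p L1 L2 y' y = L1 y' (twin_right p L2 y)"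
    and "twin_comp p L1 L2 y' y = L2 (twin_left p L1 y') y"
  unfolding twin_comp_def
  by (rule pairing_twin_left[OF assms(1)], rule pairing_twin_right[OF assms(2)])

text \<open>Uniform boundedness on the partner space; the norm of \<open>x n\<close> is recovered from its pairings by the
  norming property.\<close>

lemma weakly_convergent_bounded:
  assumes "\<And>y'. (\<lambda>n::nat. p y' (x n)) \<longlonglongrightarrow> p y' l"
  obtains B where "\<And>n. norm (x n) \<le> B" "norm l \<le> B" "0 \<le> B"
proof -
  have ptw: "\<exists>B. \<forall>n\<in>UNIV. \<bar>p y' (x n)\<bar> \<le> B" for y'
    using convergent_imp_Bseq[OF convergentI[OF assms[of y']]] by (auto simp: Bseq_def)
  obtain C where C: "C \<ge> 0" "\<And>n y'. n \<in> UNIV \<Longrightarrow> \<bar>p y' (x n)\<bar> \<le> C * norm y'"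
    by (rule uniform_boundedness[of UNIV "\<lambda>n y'. p y' (x n)", OF p.bounded_linear_left ptw])
      (rule that; assumption)
  have "norm (x n) \<le> C" for n
    by (rule norm_right_le) (simp_all add: C)
  then have "norm (x n) \<le> max C (norm l)" for n
    by (simp add: max.coboundedI1)
  then show ?thesis
    using C(1) by (intro that[of "max C (norm l)"]) auto
qed

lemma left_representable:
  assumes "linear \<phi>"
    and "\<And>x l. (\<And>y'. (\<lambda>n::nat. p y' (x n)) \<longlonglongrightarrow> p y' l) \<Longrightarrow> (\<lambda>n. \<phi> (x n)) \<longlonglongrightarrow> \<phi> l"
  shows "\<exists>z'. \<forall>y. p z' y = \<phi> y"
proof (rule continuous_functional_represented[OF linear_p assms(1)])
  show "continuous_map (pairing_topology p) euclideanreal \<phi>"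
    using assms(2)
    by (intro seq_cont_imp_cont assms(1)) (auto simp: seq_continuous_functional_def limitin_pairing_topology)
qed

text \<open>The functional is given by an element of the space itself. Elements defined by weak integrals
  are handled through their functionals, so that no vector-valued integral is needed.\<close>

definition right_rep :: "('b \<Rightarrow> real) \<Rightarrow> bool" where
  "right_rep \<phi> \<longleftrightarrow> (\<exists>z. \<forall>y'. p y' z = \<phi> y')"

lemma right_rep_pairing: "right_rep (\<lambda>y'. p y' z)"
  by (auto simp: right_rep_def)

lemma right_rep_lin:
  assumes "right_rep \<phi>" "right_rep \<psi>"
  shows "right_rep (\<lambda>y'. a * \<phi> y' + b * \<psi> y')"
proof -
  obtain z w where "\<And>y'. p y' z = \<phi> y'" "\<And>y'. p y' w = \<psi> y'"
    using assms by (auto simp: right_rep_def)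
  then have "p y' (a *\<^sub>R z + b *\<^sub>R w) = a * \<phi> y' + b * \<psi> y'" for y'
    by (simp add: p.add_right p.scaleR_right)
  then show ?thesis
    by (auto simp: right_rep_def)
qed

lemma right_rep_add: "right_rep \<phi> \<Longrightarrow> right_rep \<psi> \<Longrightarrow> right_rep (\<lambda>y'. \<phi> y' + \<psi> y')"
  using right_rep_lin[of \<phi> \<psi> 1 1] by simp

lemma right_rep_zero: "right_rep (\<lambda>_. 0)"
  using right_rep_pairing[of 0] by (simp add: p.zero_right)

lemma right_rep_sum: "(\<And>i. i \<in> I \<Longrightarrow> right_rep (\<phi> i)) \<Longrightarrow> right_rep (\<lambda>y'. \<Sum>i\<in>I. \<phi> i y')"
  by (induction I rule: infinite_finite_induct) (auto intro: right_rep_add right_rep_zero)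

text \<open>This is where sequential completeness enters.\<close>

lemma right_rep_limit:
  assumes "\<And>n::nat. right_rep (\<phi> n)" "\<And>y'. (\<lambda>n. \<phi> n y') \<longlonglongrightarrow> \<psi> y'"
  shows "right_rep \<psi>"
proof -
  obtain z where z: "\<And>n y'. p y' (z n) = \<phi> n y'"
    using assms(1) unfolding right_rep_def by metis
  obtain l where "\<And>y'. (\<lambda>n. p y' (z n)) \<longlonglongrightarrow> p y' l"
    by (rule sequentially_complete_pairingD[OF complete linear_p(1), of z])
      (use assms(2) z in \<open>auto simp: convergent_def\<close>)
  then have "p y' l = \<psi> y'" for y'
    using assms(2)[of y'] by (auto simp: z intro: LIMSEQ_unique)
  then show ?thesis
    by (auto simp: right_rep_def)
qed

text \<open>The weak integral of \<open>g\<close> against the vector measure whose distribution function takes its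
  values in the space.\<close>

lemma right_rep_nbv_int:
  assumes F: "\<And>y'. NBV_loc (F y')" and rep: "\<And>s. 0 < s \<Longrightarrow> right_rep (\<lambda>y'. distribution_ext (F y') s)"
    and g: "bdd_borel T g"
  shows "right_rep (\<lambda>y'. nbv_int (F y') g)"
proof -
  have "bdd_borel (max T 1) g" "max T 1 > 0"
    using g by (auto intro: bdd_borel_mono)
  then show ?thesis
  proof (induction g rule: bdd_borel_induct)
    case (eq f h)
    note meas = bdd_borel_measurable[OF eq(1)] bdd_borel_measurable[OF eq(2)]
    have "nbv_int (F y') h = nbv_int (F y') f" for y'
      by (rule nbv_int_cong[OF F meas eq(3), symmetric])
    then show ?case
      using eq(4) by simp
  next
    case (ind s)
    then show ?case
      using rep by (simp add: nbv_int_indicator F)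
  next
    case (lin f h a b)
    then show ?case
      by (simp add: nbv_int_lin[OF F lin(1,2)] right_rep_lin)
  next
    case (lim f h B)
    show ?case
      by (rule right_rep_limit[OF lim.IH]) (rule nbv_int_convergence[OF F lim.hyps])
  qed
qed

lemma right_rep_twin: "twin_operator p L \<Longrightarrow> right_rep (\<lambda>y'. L y' y)"
  unfolding right_rep_def twin_operator_def by blast

lemma twin_operator_bilinear: "twin_operator p L \<Longrightarrow> bounded_bilinear L"
  by (simp add: twin_operator_def)

lemma twin_operator_weak_continuity:
  assumes "twin_operator p L" "\<And>y'. (\<lambda>n::nat. p y' (x n)) \<longlonglongrightarrow> p y' l"
  shows "(\<lambda>n. L y' (x n)) \<longlonglongrightarrow> L y' l"
  using assms(2)[of "twin_left p L y'"] by (simp add: pairing_twin_left[OF assms(1)])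

lemma twin_operatorI:
  assumes "\<And>y'. linear (L y')" "\<And>y. linear (\<lambda>y'. L y' y)"
    and "\<And>y' y. \<bar>L y' y\<bar> \<le> C * norm y' * norm y"
    and "\<And>y. right_rep (\<lambda>y'. L y' y)"
    and "\<And>y' x l. (\<And>y'. (\<lambda>n::nat. p y' (x n)) \<longlonglongrightarrow> p y' l) \<Longrightarrow> (\<lambda>n. L y' (x n)) \<longlonglongrightarrow> L y' l"
  shows "twin_operator p L"
  unfolding twin_operator_def
proof (intro conjI allI)
  show "bounded_bilinear L"
  proof
    show "\<exists>K. \<forall>a b. norm (L a b) \<le> norm a * norm b * K"
      using assms(3) by (intro exI[of _ C]) (auto simp: ac_simps)
  qed (simp_all add: linear_add[OF assms(1)] linear_scale[OF assms(1)] linear_add[OF assms(2)]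
      linear_scale[OF assms(2)])
  show "\<exists>z'. \<forall>y. p z' y = L y' y" for y'
    using assms by (intro left_representable) auto
  show "\<exists>z. \<forall>y'. p y' z = L y' y" for y
    using assms(4) by (auto simp: right_rep_def)
qed

end

section \<open>The convolution equations of the perturbation problem\<close>

text \<open>The growth constants \<open>M\<^sub>0, \<omega>\<^sub>0\<close> are fixed as parameters of the locale; any admissible choice
  will do.\<close>

locale twin_perturbation = norming_pair p
  for p :: "'b::banach \<Rightarrow> 'a::banach \<Rightarrow> real" +
  fixes S\<^sub>0 :: "real \<Rightarrow> 'b \<Rightarrow> 'a \<Rightarrow> real"
    and q :: "'n::finite \<Rightarrow> 'a"
    and Q :: "'n \<Rightarrow> 'b"
    and R :: "real \<Rightarrow> real^'n^'n"
    and M\<^sub>0 \<omega>\<^sub>0 :: real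
  assumes semigroup: "twin_semigroup_bound p S\<^sub>0 M\<^sub>0 \<omega>\<^sub>0"
    and kernel_NBV: "\<And>i j. NBV_loc (\<lambda>t. pert_kernel p S\<^sub>0 q Q t $ i $ j)"
    and kernel_cont: "\<And>i j. continuous (at 0 within {0..}) (\<lambda>t. pert_kernel p S\<^sub>0 q Q t $ i $ j)"
    and resolvent: "is_resolvent (pert_kernel p S\<^sub>0 q Q) R"
    and W\<^sub>0_vec_NBV: "\<And>y'. NBV_loc (pert_W\<^sub>0 S\<^sub>0 q y')"
begin

abbreviation "SL \<equiv> \<lambda>t. twin_left p (S\<^sub>0 t)"
abbreviation "SR \<equiv> \<lambda>t. twin_right p (S\<^sub>0 t)"

lemma S0_twin: "0 \<le> t \<Longrightarrow> twin_operator p (S\<^sub>0 t)"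
  and S0_0: "S\<^sub>0 0 = p"
  and M0_ge_1: "1 \<le> M\<^sub>0"
  and S0_bound: "0 \<le> t \<Longrightarrow> \<bar>S\<^sub>0 t y' y\<bar> \<le> M\<^sub>0 * exp (\<omega>\<^sub>0 * t) * norm y * norm y'"
  using semigroup by (auto simp: twin_semigroup_bound_def)

lemma S0_left: "0 \<le> t \<Longrightarrow> p (SL t y') y = S\<^sub>0 t y' y"
  and S0_right: "0 \<le> t \<Longrightarrow> p y' (SR t y) = S\<^sub>0 t y' y"
  by (auto intro: pairing_twin_left pairing_twin_right S0_twin)

lemma S0_add_right: "0 \<le> t \<Longrightarrow> 0 \<le> s \<Longrightarrow> S\<^sub>0 t y' (SR s y) = S\<^sub>0 (t + s) y' y"
  and S0_add_left: "0 \<le> t \<Longrightarrow> 0 \<le> s \<Longrightarrow> S\<^sub>0 s (SL t y') y = S\<^sub>0 (t + s) y' y"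
proof -
  assume ts: "0 \<le> t" "0 \<le> s"
  then have eq: "S\<^sub>0 (t + s) = twin_comp p (S\<^sub>0 t) (S\<^sub>0 s)"
    using semigroup by (auto simp: twin_semigroup_bound_def)
  show "S\<^sub>0 t y' (SR s y) = S\<^sub>0 (t + s) y' y"
    unfolding eq by (rule twin_comp_eq(1)[symmetric]) (use ts S0_twin in auto)
  show "S\<^sub>0 s (SL t y') y = S\<^sub>0 (t + s) y' y"
    unfolding eq by (rule twin_comp_eq(2)[symmetric]) (use ts S0_twin in auto)
qed

lemma S0_bilinear: "0 \<le> t \<Longrightarrow> bounded_bilinear (S\<^sub>0 t)"
  by (intro twin_operator_bilinear S0_twin)

lemma S0_measurable: "(\<lambda>t. indicator {0..} t * S\<^sub>0 t y' y) \<in> borel_measurable borel"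
proof -
  have "(\<lambda>t. S\<^sub>0 t y' y) \<in> borel_measurable (restrict_space borel {0..})"
    using semigroup by (auto simp: twin_semigroup_bound_def)
  then show ?thesis
    by (subst (asm) borel_measurable_restrict_space_iff) (auto simp: mult.commute)
qed

text \<open>\<open>V\<^sub>0(s)y\<close> extended by zero to negative times. For \<open>y = q j\<close> it is the distribution function of
  \<open>K i j\<close>, see \<open>ext_K\<close>.\<close>

definition v :: "'a \<Rightarrow> 'n \<Rightarrow> real \<Rightarrow> real" where
  "v y i s = (if s < 0 then 0 else S\<^sub>0 s (Q i) y - p (Q i) y)"

definition W\<^sub>0 :: "'b \<Rightarrow> 'n \<Rightarrow> real \<Rightarrow> real" where
  "W\<^sub>0 y' j t = pert_W\<^sub>0 S\<^sub>0 q y' t $ j"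

definition w\<^sub>0 :: "'b \<Rightarrow> 'n \<Rightarrow> real \<Rightarrow> real" where
  "w\<^sub>0 y' j = distribution_ext (W\<^sub>0 y' j)"

definition K :: "'n \<Rightarrow> 'n \<Rightarrow> real \<Rightarrow> real" where
  "K i j t = pert_kernel p S\<^sub>0 q Q t $ i $ j"

definition Rc :: "'n \<Rightarrow> 'n \<Rightarrow> real \<Rightarrow> real" where
  "Rc i j t = R t $ i $ j"

definition r :: "'n \<Rightarrow> 'n \<Rightarrow> real \<Rightarrow> real" where
  "r i j = distribution_ext (Rc i j)"

definition W :: "'b \<Rightarrow> 'n \<Rightarrow> real \<Rightarrow> real" where
  "W y' j t = pert_W S\<^sub>0 q R y' t $ j"

text \<open>By \<open>ext_W\<close> this is the distribution function of \<open>W y' j\<close>. It is introduced by its formula because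
  bounded variation of \<open>W\<close>, without which its distribution function is meaningless, is derived from it.\<close>

definition w :: "'b \<Rightarrow> 'n \<Rightarrow> real \<Rightarrow> real" where
  "w y' j s = w\<^sub>0 y' j s + (\<Sum>i\<in>UNIV. conv (Rc i j) (w\<^sub>0 y' i) s)"

lemma W0_NBV: "NBV_loc (W\<^sub>0 y' j)"
  unfolding W\<^sub>0_def[abs_def] by (rule NBV_loc_vec_component[OF W\<^sub>0_vec_NBV])

lemma K_NBV: "NBV_loc (K i j)"
  unfolding K_def[abs_def] by (rule kernel_NBV)

lemma Rc_NBV: "NBV_loc (Rc i j)"
  unfolding Rc_def[abs_def] using resolvent
  by (intro NBV_loc_vec_component) (auto simp: is_resolvent_def intro: NBV_loc_vec_component)

lemma v_neg: "s < 0 \<Longrightarrow> v y i s = 0"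
  and v_nonneg: "0 \<le> s \<Longrightarrow> v y i s = S\<^sub>0 s (Q i) y - p (Q i) y"
  and v_0: "v y i 0 = 0"
  by (auto simp: v_def S0_0)

lemma S0_bound_upto:
  assumes "0 \<le> t" "t \<le> T"
  shows "\<bar>S\<^sub>0 t y' y\<bar> \<le> M\<^sub>0 * exp (\<bar>\<omega>\<^sub>0\<bar> * T) * norm y * norm y'"
proof -
  have "\<omega>\<^sub>0 * t \<le> \<bar>\<omega>\<^sub>0\<bar> * T"
    using assms by (intro mult_mono) auto
  then have "M\<^sub>0 * exp (\<omega>\<^sub>0 * t) * norm y * norm y' \<le> M\<^sub>0 * exp (\<bar>\<omega>\<^sub>0\<bar> * T) * norm y * norm y'"
    using M0_ge_1 by (intro mult_right_mono mult_left_mono) auto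
  then show ?thesis
    using S0_bound[OF assms(1)] by (rule order_trans[rotated])
qed

lemma v_bound:
  obtains C where "0 \<le> C" "\<And>y i s. s \<le> T \<Longrightarrow> \<bar>v y i s\<bar> \<le> C * norm y"
proof -
  define L where "L = (\<Sum>i\<in>UNIV. norm (Q i))"
  define C where "C = (M\<^sub>0 * exp (\<bar>\<omega>\<^sub>0\<bar> * \<bar>T\<bar>) + 1) * L"
  have Q: "norm (Q i) \<le> L" for i
    unfolding L_def by (rule member_le_sum) auto
  have "0 \<le> L" unfolding L_def by (intro sum_nonneg) auto
  then have "0 \<le> C"
    using M0_ge_1 by (simp add: C_def)
  moreover have "\<bar>v y i s\<bar> \<le> C * norm y" if "s \<le> T" for y i s
  proof (cases "s < 0")
    case True
    then show ?thesis using \<open>0 \<le> C\<close> by (simp add: v_neg)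
  next
    case False
    have "\<bar>S\<^sub>0 s (Q i) y\<bar> \<le> M\<^sub>0 * exp (\<bar>\<omega>\<^sub>0\<bar> * \<bar>T\<bar>) * norm y * norm (Q i)"
      using False that by (intro S0_bound_upto) auto
    also have "\<dots> \<le> M\<^sub>0 * exp (\<bar>\<omega>\<^sub>0\<bar> * \<bar>T\<bar>) * norm y * L"
      using M0_ge_1 Q by (intro mult_left_mono) auto
    finally have 1: "\<bar>S\<^sub>0 s (Q i) y\<bar> \<le> M\<^sub>0 * exp (\<bar>\<omega>\<^sub>0\<bar> * \<bar>T\<bar>) * norm y * L" .
    have 2: "\<bar>p (Q i) y\<bar> \<le> L * norm y"
      by (rule order_trans[OF pairing_bound]) (intro mult_right_mono Q norm_ge_zero)
    show ?thesis
      using False 1 2 by (simp add: v_nonneg C_def algebra_simps)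
  qed
  ultimately show ?thesis
    by (rule that)
qed

lemma causal_v: "causal (v y i)"
  unfolding causal_def
proof (intro conjI allI impI)
  have "v y i s = indicator {0..} s * S\<^sub>0 s (Q i) y - indicator {0..} s * p (Q i) y" for s
    by (auto simp: v_def indicator_def)
  then show "v y i \<in> borel_measurable borel"
    using S0_measurable[of "Q i" y] by (simp add: borel_measurable_diff cong: measurable_cong)
  show "v y i s = 0" if "s < 0" for s
    using that by (rule v_neg)
  show "\<exists>B. \<forall>s\<le>T. \<bar>v y i s\<bar> \<le> B" for T
  proof -
    obtain C where "0 \<le> C" "\<And>y i s. s \<le> T \<Longrightarrow> \<bar>v y i s\<bar> \<le> C * norm y"
      by (rule v_bound[of T]) (rule that; assumption)
    then show ?thesis by blast
  qed
qed

lemma v_lin: "v (a *\<^sub>R y + b *\<^sub>R z) i s = a * v y i s + b * v z i s"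
proof (cases "s < 0")
  case False
  then interpret S: bounded_bilinear "S\<^sub>0 s"
    by (intro S0_bilinear) auto
  show ?thesis
    using False by (simp add: v_nonneg S.add_right S.scaleR_right p.add_right p.scaleR_right algebra_simps)
qed (simp add: v_neg)

lemma v_weakly_continuous:
  assumes "\<And>y'. (\<lambda>n::nat. p y' (x n)) \<longlonglongrightarrow> p y' l"
  shows "(\<lambda>n. v (x n) i s) \<longlonglongrightarrow> v l i s"
proof (cases "s < 0")
  case False
  then show ?thesis
    using assms twin_operator_weak_continuity[OF S0_twin assms, of s "Q i"]
    by (simp add: v_nonneg tendsto_diff)
qed (simp add: v_neg)

lemma ext_K: "distribution_ext (K i j) = v (q j) i"
proof
  have K_eq: "K i j s = S\<^sub>0 s (Q i) (q j) - p (Q i) (q j)" for s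
    by (simp add: K_def pert_kernel_def)
  have "(K i j \<longlongrightarrow> K i j 0) (at 0 within {0..})"
    using kernel_cont[of i j] unfolding K_def[abs_def] by (simp add: continuous_within)
  then have "(K i j \<longlongrightarrow> K i j 0) (at_right 0)"
    by (rule tendsto_within_subset) auto
  then have "Lim (at_right 0) (K i j) = K i j 0"
    by (intro tendsto_Lim) auto
  then show "distribution_ext (K i j) s = v (q j) i s" for s
    by (auto simp: distribution_ext_def v_def K_eq)
qed

text \<open>The resolvent equations evaluated on \<open>[0, s]\<close>. The second one comes as an integral against
  \<open>K\<close>; commuting the convolutions gives an integral against \<open>R\<close>, which is the form used later.\<close>

lemma resolvent_left: "r i j s = v (q j) i s + (\<Sum>k\<in>UNIV. conv (Rc k j) (v (q k) i) s)"
  and resolvent_right: "r i j s = v (q j) i s + (\<Sum>k\<in>UNIV. conv (Rc i k) (v (q j) k) s)"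
proof -
  have "r i j s = v (q j) i s + (\<Sum>k\<in>UNIV. conv (Rc k j) (v (q k) i) s) \<and>
    r i j s = v (q j) i s + (\<Sum>k\<in>UNIV. conv (K k j) (r i k) s)"
  proof (cases "0 \<le> s")
    case True
    have "{0..s} \<in> sets borel" "bounded {0..s}" "{0..s} \<subseteq> {0..}"
      by auto
    then have "NBV_measure (\<lambda>t. R t $ i $ j) {0..s} =
          NBV_measure (\<lambda>t. pert_kernel p S\<^sub>0 q Q t $ i $ j) {0..s} +
          (\<Sum>k\<in>UNIV. NBV_conv (\<lambda>t. pert_kernel p S\<^sub>0 q Q t $ i $ k) (\<lambda>t. R t $ k $ j) {0..s}) \<and>
        NBV_measure (\<lambda>t. R t $ i $ j) {0..s} =
          NBV_measure (\<lambda>t. pert_kernel p S\<^sub>0 q Q t $ i $ j) {0..s} +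
          (\<Sum>k\<in>UNIV. NBV_conv (\<lambda>t. R t $ i $ k) (\<lambda>t. pert_kernel p S\<^sub>0 q Q t $ k $ j) {0..s})"
      using resolvent unfolding is_resolvent_def by blast
    then have "NBV_measure (Rc i j) {0..s} = NBV_measure (K i j) {0..s} +
          (\<Sum>k\<in>UNIV. NBV_conv (K i k) (Rc k j) {0..s}) \<and>
        NBV_measure (Rc i j) {0..s} = NBV_measure (K i j) {0..s} +
          (\<Sum>k\<in>UNIV. NBV_conv (Rc i k) (K k j) {0..s})"
      unfolding Rc_def K_def .
    then show ?thesis
      by (simp add: NBV_measure_Icc NBV_conv_Icc Rc_NBV K_NBV ext_K conv_def r_def)
  next
    case False
    then have s: "s < 0" by simp
    have "r i j s = 0" "v (q j) i s = 0" "conv (Rc k j) (v (q k) i) s = 0" "conv (K k j) (r i k) s = 0" for k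
      using s causalD(2)[OF causal_ext[OF Rc_NBV]] causalD(2)[OF causal_conv[OF Rc_NBV causal_v]]
        causalD(2)[OF causal_conv[OF K_NBV causal_ext[OF Rc_NBV]]]
      by (auto simp: r_def v_neg)
    then show ?thesis by simp
  qed
  then have 1: "r i j s = v (q j) i s + (\<Sum>k\<in>UNIV. conv (Rc k j) (v (q k) i) s)"
    and 2: "r i j s = v (q j) i s + (\<Sum>k\<in>UNIV. conv (K k j) (r i k) s)"
    by auto
  have "conv (K k j) (r i k) = conv (Rc i k) (v (q j) k)" for k
  proof -
    have "conv (K k j) (r i k) = conv (K k j) (conv (Rc i k) heaviside)"
      by (simp add: r_def conv_heaviside Rc_NBV)
    also have "\<dots> = conv (Rc i k) (conv (K k j) heaviside)"
      by (intro conv_commute K_NBV Rc_NBV causal_heaviside)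
    finally show ?thesis
      by (simp add: conv_heaviside K_NBV ext_K)
  qed
  then show "r i j s = v (q j) i s + (\<Sum>k\<in>UNIV. conv (Rc i k) (v (q j) k) s)"
    using 2 by simp
  show "r i j s = v (q j) i s + (\<Sum>k\<in>UNIV. conv (Rc k j) (v (q k) i) s)"
    by (rule 1)
qed

lemma w0_pos: "0 < t \<Longrightarrow> w\<^sub>0 y' j t = S\<^sub>0 t y' (q j)"
  and w0_neg: "t < 0 \<Longrightarrow> w\<^sub>0 y' j t = 0"
  by (auto simp: w\<^sub>0_def distribution_ext_def W\<^sub>0_def pert_W\<^sub>0_def)

lemma w0_right_cont: "continuous (at_right t) (w\<^sub>0 y' j)"
  unfolding w\<^sub>0_def by (rule NBV_ext_right_cont[OF W0_NBV])

lemma causal_w0: "causal (w\<^sub>0 y' j)"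
  unfolding w\<^sub>0_def by (rule causal_ext[OF W0_NBV])

lemma w0_0_eqI:
  assumes "((\<lambda>t. S\<^sub>0 t y' (q j)) \<longlongrightarrow> l) (at_right 0)"
  shows "w\<^sub>0 y' j 0 = l"
proof -
  have "\<forall>\<^sub>F t in at_right 0. S\<^sub>0 t y' (q j) = w\<^sub>0 y' j t"
    using eventually_at_right_less[of 0] by eventually_elim (simp add: w0_pos)
  then have "(w\<^sub>0 y' j \<longlongrightarrow> l) (at_right 0)"
    using assms by (rule Lim_transform_eventually[rotated])
  moreover have "(w\<^sub>0 y' j \<longlongrightarrow> w\<^sub>0 y' j 0) (at_right 0)"
    using w0_right_cont[of 0] by (simp add: continuous_within)
  ultimately show ?thesis
    by (intro tendsto_unique[of "at_right (0::real)"]) auto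
qed

lemma w0_lim_0: "((\<lambda>t. S\<^sub>0 t y' (q j)) \<longlongrightarrow> w\<^sub>0 y' j 0) (at_right 0)"
proof -
  have "\<forall>\<^sub>F t in at_right 0. w\<^sub>0 y' j t = S\<^sub>0 t y' (q j)"
    using eventually_at_right_less[of 0] by eventually_elim (simp add: w0_pos)
  moreover have "(w\<^sub>0 y' j \<longlongrightarrow> w\<^sub>0 y' j 0) (at_right 0)"
    using w0_right_cont[of 0] by (simp add: continuous_within)
  ultimately show ?thesis
    by (rule Lim_transform_eventually[rotated])
qed

text \<open>The semigroup law of \<open>S\<^sub>0\<close>. At \<open>s = 0\<close> the left side is a limit from the right, and the assumed
  right continuity of \<open>y'W\<^sub>0\<close> at \<open>t > 0\<close> gives the value.\<close>

lemma w0_shift: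
  assumes "0 < t"
  shows "w\<^sub>0 (SL t y') j s = (if s < 0 then 0 else w\<^sub>0 y' j (t + s))"
proof -
  consider "s < 0" | "s = 0" | "0 < s" by linarith
  then show ?thesis
  proof cases
    case 2
    have "filterlim (\<lambda>s. t + s) (at_right t) (at_right 0)"
      unfolding filterlim_at
    proof (intro conjI)
      show "((\<lambda>s. t + s) \<longlongrightarrow> t) (at_right 0)"
        by (auto intro!: tendsto_eq_intros)
      show "\<forall>\<^sub>F s in at_right 0. t + s \<in> {t<..} \<and> t + s \<noteq> t"
        using eventually_at_right_less[of 0] by eventually_elim auto
    qed
    moreover have "(w\<^sub>0 y' j \<longlongrightarrow> w\<^sub>0 y' j t) (at_right t)"
      using w0_right_cont[of t] by (simp add: continuous_within)
    ultimately have "((\<lambda>s. w\<^sub>0 y' j (t + s)) \<longlongrightarrow> w\<^sub>0 y' j t) (at_right 0)"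
      by (rule filterlim_compose[rotated])
    moreover have "\<forall>\<^sub>F s in at_right 0. w\<^sub>0 y' j (t + s) = S\<^sub>0 s (SL t y') (q j)"
      using eventually_at_right_less[of 0]
      by eventually_elim (use assms in \<open>simp add: w0_pos S0_add_left\<close>)
    ultimately have "((\<lambda>s. S\<^sub>0 s (SL t y') (q j)) \<longlongrightarrow> w\<^sub>0 y' j t) (at_right 0)"
      by (rule Lim_transform_eventually)
    then show ?thesis
      using 2 w0_0_eqI by auto
  qed (use assms in \<open>auto simp: w0_neg w0_pos S0_add_left\<close>)
qed

text \<open>For \<open>y' = Q i\<close> the shift formula extends to \<open>t = 0\<close>: continuity of \<open>K\<close> at 0 says that
  \<open>Q i\<close> does not see a possible jump of \<open>S\<^sub>0(\<cdot>)q\<close> at 0.\<close>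

lemma w0_shift_Q:
  assumes "0 \<le> t"
  shows "w\<^sub>0 (SL t (Q i)) j s = (if s < 0 then 0 else v (q j) i (t + s) + p (Q i) (q j))"
proof (cases "0 < t")
  case True
  then show ?thesis
    by (auto simp: w0_shift w0_pos v_nonneg)
next
  case False
  then have t: "t = 0" using assms by simp
  have SL0: "SL 0 (Q i) = Q i"
    by (rule twin_left_eqI) (simp add: S0_0)
  have "w\<^sub>0 (Q i) j 0 = p (Q i) (q j)"
  proof (rule w0_0_eqI)
    have "(K i j \<longlongrightarrow> v (q j) i 0) (at_right 0)"
      using NBV_lim_0[OF K_NBV, of i j] by (simp add: ext_K)
    then have "((\<lambda>t. K i j t + p (Q i) (q j)) \<longlongrightarrow> 0 + p (Q i) (q j)) (at_right 0)"
      unfolding v_0 by (intro tendsto_intros)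
    then show "((\<lambda>t. S\<^sub>0 t (Q i) (q j)) \<longlongrightarrow> p (Q i) (q j)) (at_right 0)"
      by (simp add: K_def pert_kernel_def)
  qed
  then show ?thesis
    unfolding t SL0 by (cases "s = 0"; cases "s < 0") (auto simp: w0_pos w0_neg v_nonneg v_0)
qed

lemma w0_lin: "w\<^sub>0 (a *\<^sub>R x' + b *\<^sub>R y') j s = a * w\<^sub>0 x' j s + b * w\<^sub>0 y' j s"
proof -
  have S: "S\<^sub>0 t (a *\<^sub>R x' + b *\<^sub>R y') (q j) = a * S\<^sub>0 t x' (q j) + b * S\<^sub>0 t y' (q j)" if "0 < t" for t
  proof -
    interpret S: bounded_bilinear "S\<^sub>0 t"
      using that by (intro S0_bilinear) auto
    show ?thesis
      by (simp add: S.add_left S.scaleR_left)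
  qed
  consider "s < 0" | "s = 0" | "0 < s" by linarith
  then show ?thesis
  proof cases
    case 2
    have "((\<lambda>t. a * S\<^sub>0 t x' (q j) + b * S\<^sub>0 t y' (q j)) \<longlongrightarrow> a * w\<^sub>0 x' j 0 + b * w\<^sub>0 y' j 0) (at_right 0)"
      by (intro tendsto_intros w0_lim_0)
    moreover have "\<forall>\<^sub>F t in at_right 0. a * S\<^sub>0 t x' (q j) + b * S\<^sub>0 t y' (q j) = S\<^sub>0 t (a *\<^sub>R x' + b *\<^sub>R y') (q j)"
      using eventually_at_right_less[of 0] by eventually_elim (simp add: S)
    ultimately have "((\<lambda>t. S\<^sub>0 t (a *\<^sub>R x' + b *\<^sub>R y') (q j)) \<longlongrightarrow> a * w\<^sub>0 x' j 0 + b * w\<^sub>0 y' j 0) (at_right 0)"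
      by (rule Lim_transform_eventually)
    then show ?thesis
      using 2 w0_0_eqI by auto
  qed (auto simp: w0_neg w0_pos S)
qed

lemma w_causal: "causal (w y' j)"
  unfolding w_def by (intro causal_add causal_sum causal_conv causal_w0 Rc_NBV)

lemma w_right_cont: "continuous (at_right t) (w y' j)"
  unfolding w_def[abs_def]
  by (intro continuous_intros conv_right_continuous Rc_NBV causal_w0 w0_right_cont)

lemma W_eq: "0 \<le> t \<Longrightarrow> W y' j t = normalise_at_0 (w y' j) t"
proof (cases "t = 0")
  case True
  then show ?thesis by (simp add: W_def pert_W_def normalise_at_0_def)
next
  case False
  assume "0 \<le> t"
  with False have t: "0 < t" by simp
  have "NBV_integral (\<lambda>s. R s $ i $ j) {0..t}
          (\<lambda>\<tau>. if \<tau> = t then Lim (at_right 0) (\<lambda>s. pert_W\<^sub>0 S\<^sub>0 q y' s $ i)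
                       else pert_W\<^sub>0 S\<^sub>0 q y' (t - \<tau>) $ i) = conv (Rc i j) (w\<^sub>0 y' i) t" for i
  proof -
    have [measurable]: "w\<^sub>0 y' i \<in> borel_measurable borel"
      by (rule causalD[OF causal_w0])
    have Rc: "(\<lambda>s. R s $ i $ j) = Rc i j"
      by (simp add: Rc_def fun_eq_iff)
    have "NBV_integral (\<lambda>s. R s $ i $ j) {0..t}
          (\<lambda>\<tau>. if \<tau> = t then Lim (at_right 0) (\<lambda>s. pert_W\<^sub>0 S\<^sub>0 q y' s $ i)
                       else pert_W\<^sub>0 S\<^sub>0 q y' (t - \<tau>) $ i) =
        NBV_integral (Rc i j) {0..t} (\<lambda>\<tau>. w\<^sub>0 y' i (t - \<tau>))"
      unfolding Rc by (rule NBV_integral_cong) (auto simp: w\<^sub>0_def distribution_ext_def W\<^sub>0_def[abs_def])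
    also have "\<dots> = nbv_int (Rc i j) (\<lambda>\<tau>. indicator {..t} \<tau> * w\<^sub>0 y' i (t - \<tau>))"
      by (intro NBV_integral_eq_nbv_int Rc_NBV) measurable
    also have "(\<lambda>\<tau>. indicator {..t} \<tau> * w\<^sub>0 y' i (t - \<tau>)) = (\<lambda>\<tau>. w\<^sub>0 y' i (t - \<tau>))"
      by (auto simp: indicator_def fun_eq_iff w0_neg)
    finally show ?thesis
      by (simp add: conv_def)
  qed
  then show ?thesis
    using t by (simp add: W_def pert_W_def normalise_at_0_def w_def w0_pos pert_W\<^sub>0_def)
qed

lemma W_NBV: "NBV_loc (W y' j)"
proof (rule NBV_loc_cong)
  have "NBV_loc (\<lambda>t. normalise_at_0 (w\<^sub>0 y' j) t + (\<Sum>i\<in>UNIV. normalise_at_0 (conv (Rc i j) (w\<^sub>0 y' i)) t))"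
  proof (intro NBV_loc_add NBV_loc_sum)
    show "NBV_loc (normalise_at_0 (w\<^sub>0 y' j))"
      by (rule NBV_loc_cong[OF W0_NBV[of y' j]])
        (auto simp: normalise_at_0_def w0_pos W\<^sub>0_def pert_W\<^sub>0_def)
    show "NBV_loc (normalise_at_0 (conv (Rc i j) (w\<^sub>0 y' i)))" for i
      unfolding w\<^sub>0_def by (intro NBV_loc_conv Rc_NBV W0_NBV)
  qed
  then show "NBV_loc (normalise_at_0 (w y' j))"
    by (rule NBV_loc_cong) (auto simp: normalise_at_0_def w_def)
qed (simp add: W_eq)

lemma ext_W: "distribution_ext (W y' j) = w y' j"
proof -
  have "distribution_ext (W y' j) = distribution_ext (normalise_at_0 (w y' j))"
    by (intro distribution_ext_cong W_eq) auto
  also have "\<dots> = w y' j"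
    by (rule distribution_ext_normalise[OF causalD(2)[OF w_causal] w_right_cont])
  finally show ?thesis .
qed

lemma nbv_int_W:
  assumes "bdd_borel T g" "0 < T"
  shows "nbv_int (W y' j) g = nbv_int (W\<^sub>0 y' j) g +
    (\<Sum>i\<in>UNIV. nbv_int (Rc i j) (\<lambda>\<rho>. nbv_int (W\<^sub>0 y' i) (\<lambda>\<tau>. g (\<tau> + \<rho>))))"
  by (rule nbv_int_composite[OF W0_NBV W0_NBV Rc_NBV W_NBV _ assms])
    (simp add: ext_W w_def w\<^sub>0_def)

lemma conv_W:
  assumes "causal a"
  shows "conv (W y' j) a s = conv (W\<^sub>0 y' j) a s + (\<Sum>i\<in>UNIV. conv (Rc i j) (conv (W\<^sub>0 y' i) a) s)"
proof -
  have "bdd_borel (max s 1) (\<lambda>x. a (s - x))"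
    using assms by (intro causal_bdd_borel) auto
  from nbv_int_W[OF this, of y' j] show ?thesis
    by (simp add: conv_def algebra_simps)
qed

text \<open>From \<open>w = w\<^sub>0 + R * w\<^sub>0\<close> one gets \<open>W * k = W\<^sub>0 * (k + R * k) = W\<^sub>0 * r = R * w\<^sub>0\<close>.\<close>

lemma w_fixed_point: "w y' j s = w\<^sub>0 y' j s + (\<Sum>i\<in>UNIV. conv (W y' i) (v (q j) i) s)"
proof -
  have "(\<Sum>i\<in>UNIV. conv (W y' i) (v (q j) i) s) =
      (\<Sum>i\<in>UNIV. conv (W\<^sub>0 y' i) (v (q j) i) s) +
      (\<Sum>i\<in>UNIV. \<Sum>l\<in>UNIV. conv (W\<^sub>0 y' l) (conv (Rc l i) (v (q j) i)) s)"
    by (simp add: conv_W causal_v sum.distrib conv_commute[OF Rc_NBV W0_NBV])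
  also have "\<dots> = (\<Sum>l\<in>UNIV. conv (W\<^sub>0 y' l) (v (q j) l) s +
      (\<Sum>i\<in>UNIV. conv (W\<^sub>0 y' l) (conv (Rc l i) (v (q j) i)) s))"
    by (subst sum.swap) (simp add: sum.distrib)
  also have "\<dots> = (\<Sum>l\<in>UNIV. conv (W\<^sub>0 y' l) (\<lambda>s. v (q j) l s + (\<Sum>i\<in>UNIV. conv (Rc l i) (v (q j) i) s)) s)"
    by (intro sum.cong refl)
      (simp add: conv_add conv_sum W0_NBV causal_v causal_sum causal_conv Rc_NBV)
  also have "\<dots> = (\<Sum>l\<in>UNIV. conv (W\<^sub>0 y' l) (r l j) s)"
  proof -
    have "(\<lambda>s. v (q j) l s + (\<Sum>i\<in>UNIV. conv (Rc l i) (v (q j) i) s)) = r l j" for l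
      by (intro ext) (rule resolvent_right[symmetric])
    then show ?thesis by simp
  qed
  also have "\<dots> = (\<Sum>l\<in>UNIV. conv (Rc l j) (w\<^sub>0 y' l) s)"
  proof (intro sum.cong refl)
    fix l
    have "conv (W\<^sub>0 y' l) (r l j) = conv (W\<^sub>0 y' l) (conv (Rc l j) heaviside)"
      by (simp add: r_def conv_heaviside Rc_NBV)
    also have "\<dots> = conv (Rc l j) (conv (W\<^sub>0 y' l) heaviside)"
      by (intro conv_commute W0_NBV Rc_NBV causal_heaviside)
    finally show "conv (W\<^sub>0 y' l) (r l j) s = conv (Rc l j) (w\<^sub>0 y' l) s"
      by (simp add: conv_heaviside W0_NBV w\<^sub>0_def)
  qed
  finally show ?thesis
    by (simp add: w_def)
qed

section \<open>The perturbed operators\<close>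

definition S :: "real \<Rightarrow> 'b \<Rightarrow> 'a \<Rightarrow> real" where
  "S t y' y = S\<^sub>0 t y' y + (\<Sum>j\<in>UNIV. conv (W y' j) (v y j) t)"

text \<open>The defining formula is thus valid at time 0 as well, which removes the case distinction of
  \<open>pert_semigroup\<close>.\<close>

lemma S_0: "S 0 y' y = p y' y"
proof -
  have "(\<lambda>\<tau>. v y j (0 - \<tau>)) x = 0" if "0 \<le> x" for j x
    using that by (cases "x = 0") (auto simp: v_0 v_neg)
  then have "conv (W y' j) (v y j) 0 = nbv_int (W y' j) (\<lambda>_. 0)" for j
    unfolding conv_def using bdd_borel_measurable[OF causal_bdd_borel[OF causal_v order_refl, of 0 y j]]
    by (intro nbv_int_cong[OF W_NBV]) auto
  then show ?thesis
    by (simp add: S_def S0_0)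
qed

lemma pert_semigroup_eq: "0 \<le> t \<Longrightarrow> pert_semigroup p S\<^sub>0 q Q R t = S t"
proof (intro ext)
  fix y' y assume "0 \<le> t"
  show "pert_semigroup p S\<^sub>0 q Q R t y' y = S t y' y"
  proof (cases "t = 0")
    case True
    then show ?thesis
      by (simp add: pert_semigroup_def S_0)
  next
    case False
    have "NBV_integral (\<lambda>s. pert_W S\<^sub>0 q R y' s $ j) {0..t} (\<lambda>\<tau>. pert_V\<^sub>0 p S\<^sub>0 Q (t - \<tau>) y $ j) =
      conv (W y' j) (v y j) t" for j
    proof -
      have W: "(\<lambda>s. pert_W S\<^sub>0 q R y' s $ j) = W y' j"
        by (simp add: W_def fun_eq_iff)
      have [measurable]: "v y j \<in> borel_measurable borel"
        by (rule causalD[OF causal_v])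
      have "NBV_integral (W y' j) {0..t} (\<lambda>\<tau>. pert_V\<^sub>0 p S\<^sub>0 Q (t - \<tau>) y $ j) =
        NBV_integral (W y' j) {0..t} (\<lambda>\<tau>. v y j (t - \<tau>))"
        by (rule NBV_integral_cong) (auto simp: pert_V\<^sub>0_def v_nonneg)
      also have "\<dots> = nbv_int (W y' j) (\<lambda>\<tau>. indicator {..t} \<tau> * v y j (t - \<tau>))"
        by (intro NBV_integral_eq_nbv_int W_NBV) measurable
      also have "(\<lambda>\<tau>. indicator {..t} \<tau> * v y j (t - \<tau>)) = (\<lambda>\<tau>. v y j (t - \<tau>))"
        by (auto simp: indicator_def fun_eq_iff v_neg)
      finally show ?thesis
        by (simp add: conv_def W)
    qed
    then show ?thesis
      using False by (simp add: pert_semigroup_def S_def)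
  qed
qed

text \<open>The bound for \<open>W\<^sub>0\<close> is uniform boundedness; it carries over to \<open>W\<close> because \<open>W\<close> arises from
  \<open>W\<^sub>0\<close> by convolution with a fixed measure.\<close>

lemma nbv_int_W_bound:
  assumes "0 < T"
  obtains C where "0 \<le> C" "\<And>y' j g B. bdd_borel T g \<Longrightarrow> \<forall>x\<ge>0. \<bar>g x\<bar> \<le> B \<Longrightarrow>
    \<bar>nbv_int (W y' j) g\<bar> \<le> C * B * norm y'"
proof -
  have "\<exists>C\<ge>0. \<forall>y'. total_variation (W\<^sub>0 y' j) T \<le> C * norm y'" for j
  proof -
    have lin: "bounded_linear (\<lambda>y'. W\<^sub>0 y' j t)" if "0 \<le> t" for t
    proof -
      interpret S: bounded_bilinear "S\<^sub>0 t"
        using that by (rule S0_bilinear)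
      show ?thesis
        by (cases "t = 0") (simp_all add: W\<^sub>0_def pert_W\<^sub>0_def bounded_linear_zero S.bounded_linear_left)
    qed
    obtain C where "0 \<le> C" "\<And>y'. total_variation (W\<^sub>0 y' j) T \<le> C * norm y'"
      by (rule total_variation_uniform_bound[of "\<lambda>y'. W\<^sub>0 y' j" T, OF W0_NBV lin])
        (use assms in \<open>auto intro: that\<close>)
    then show ?thesis by blast
  qed
  then obtain c where c: "\<And>j. 0 \<le> c j" "\<And>j y'. total_variation (W\<^sub>0 y' j) T \<le> c j * norm y'"
    by metis
  have TV_nonneg: "0 \<le> total_variation (Rc i j) T" for i j
    using total_variation_increment[OF Rc_NBV, of 0 T i j] assms by simp
  define C where "C = (\<Sum>j\<in>UNIV. c j + (\<Sum>i\<in>UNIV. c i * total_variation (Rc i j) T))"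
  have nn: "0 \<le> c j + (\<Sum>i\<in>UNIV. c i * total_variation (Rc i j) T)" for j
    by (intro add_nonneg_nonneg sum_nonneg mult_nonneg_nonneg c TV_nonneg)
  show ?thesis
  proof (rule that)
    show "0 \<le> C"
      unfolding C_def by (intro sum_nonneg nn)
    fix y' j g B
    assume g: "bdd_borel T g" and "\<forall>x\<ge>0. \<bar>g x\<bar> \<le> B"
    then have B: "\<And>x. 0 \<le> x \<Longrightarrow> \<bar>g x\<bar> \<le> B"
      by blast
    have "0 \<le> B"
      using B[of 0] by simp
    have W0: "\<bar>nbv_int (W\<^sub>0 y' i) h\<bar> \<le> B * (c i * norm y')"
      if "bdd_borel T h" "\<And>x. 0 \<le> x \<Longrightarrow> \<bar>h x\<bar> \<le> B" for i h
      by (rule order_trans[OF nbv_int_bound[OF W0_NBV assms that]])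
        (assumption, intro mult_left_mono c \<open>0 \<le> B\<close>)
    have sec: "bdd_borel T (\<lambda>\<tau>. g (\<tau> + \<rho>))" if "0 \<le> \<rho>" for \<rho>
      by (rule bdd_borel2_section[OF bdd_borel_bdd_borel2_add[OF g] that assms])
    have R: "\<bar>nbv_int (Rc i j) (\<lambda>\<rho>. nbv_int (W\<^sub>0 y' i) (\<lambda>\<tau>. g (\<tau> + \<rho>)))\<bar>
        \<le> B * (c i * norm y') * total_variation (Rc i j) T" for i
      by (intro nbv_int_bound[OF Rc_NBV assms] bdd_borel_nbv_int[OF W0_NBV] bdd_borel_bdd_borel2_add g assms W0 sec)
        (auto intro: B)
    have "\<bar>nbv_int (W y' j) g\<bar> \<le> \<bar>nbv_int (W\<^sub>0 y' j) g\<bar> +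
        (\<Sum>i\<in>UNIV. \<bar>nbv_int (Rc i j) (\<lambda>\<rho>. nbv_int (W\<^sub>0 y' i) (\<lambda>\<tau>. g (\<tau> + \<rho>)))\<bar>)"
      unfolding nbv_int_W[OF g assms] by (rule order_trans[OF abs_triangle_ineq]) (simp add: sum_abs)
    also have "\<dots> \<le> B * (c j * norm y') + (\<Sum>i\<in>UNIV. B * (c i * norm y') * total_variation (Rc i j) T)"
      by (intro add_mono sum_mono R W0 g B)
    also have "\<dots> = (c j + (\<Sum>i\<in>UNIV. c i * total_variation (Rc i j) T)) * (B * norm y')"
      by (simp add: algebra_simps sum_distrib_left sum_distrib_right)
    also have "\<dots> \<le> C * (B * norm y')"
    proof (rule mult_right_mono)
      show "c j + (\<Sum>i\<in>UNIV. c i * total_variation (Rc i j) T) \<le> C"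
        unfolding C_def by (rule member_le_sum) (auto intro: nn)
    qed (use \<open>0 \<le> B\<close> in simp)
    finally show "\<bar>nbv_int (W y' j) g\<bar> \<le> C * B * norm y'"
      by (simp add: mult.assoc)
  qed
qed

lemma w_lin: "w (a *\<^sub>R x' + b *\<^sub>R y') j s = a * w x' j s + b * w y' j s"
proof -
  have "w\<^sub>0 (a *\<^sub>R x' + b *\<^sub>R y') i = (\<lambda>s. a * w\<^sub>0 x' i s + b * w\<^sub>0 y' i s)" for i
    by (intro ext) (rule w0_lin)
  then show ?thesis
    by (simp add: w_def conv_lin Rc_NBV causal_w0 sum.distrib sum_distrib_left algebra_simps)
qed

lemma nbv_int_W_lin:
  assumes "bdd_borel T g"
  shows "nbv_int (W (a *\<^sub>R x' + b *\<^sub>R y') j) g = a * nbv_int (W x' j) g + b * nbv_int (W y' j) g"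
  by (rule nbv_int_linear_distribution[OF W_NBV W_NBV W_NBV _ assms]) (simp add: ext_W w_lin)

lemma right_rep_S0: "0 \<le> t \<Longrightarrow> right_rep (\<lambda>y'. S\<^sub>0 t y' y)"
  unfolding right_rep_def using S0_right by blast

lemma right_rep_w0: "right_rep (\<lambda>y'. w\<^sub>0 y' j s)"
proof -
  consider "s < 0" | "s = 0" | "0 < s" by linarith
  then show ?thesis
  proof cases
    case 2
    have "(\<lambda>n. 1 / real (Suc n)) \<longlonglongrightarrow> 0"
      by (rule LIMSEQ_Suc[OF lim_1_over_n])
    then have "filterlim (\<lambda>n. 1 / real (Suc n)) (at_right 0) sequentially"
      by (simp add: filterlim_at del: of_nat_Suc)
    from filterlim_compose[OF w0_lim_0 this]
    have "(\<lambda>n. S\<^sub>0 (1 / real (Suc n)) y' (q j)) \<longlonglongrightarrow> w\<^sub>0 y' j 0" for y' .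
    then have "right_rep (\<lambda>y'. w\<^sub>0 y' j 0)"
      by (rule right_rep_limit[rotated]) (rule right_rep_S0, simp)
    then show ?thesis using 2 by simp
  qed (auto simp: w0_neg w0_pos right_rep_zero right_rep_S0)
qed

text \<open>Commuting the two convolutions writes \<open>R * w\<^sub>0\<close> as an integral of the fixed function \<open>r\<close> against
  \<open>y'W\<^sub>0\<close>, to which \<open>right_rep_nbv_int\<close> applies.\<close>

lemma right_rep_w: "right_rep (\<lambda>y'. w y' j s)"
proof -
  have "conv (Rc i j) (w\<^sub>0 y' i) s = nbv_int (W\<^sub>0 y' i) (\<lambda>\<tau>. r i j (s - \<tau>))" for i y'
  proof -
    have "conv (Rc i j) (conv (W\<^sub>0 y' i) heaviside) = conv (W\<^sub>0 y' i) (conv (Rc i j) heaviside)"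
      by (intro conv_commute Rc_NBV W0_NBV causal_heaviside)
    then show ?thesis
      by (simp add: conv_heaviside Rc_NBV W0_NBV w\<^sub>0_def r_def) (simp add: conv_def)
  qed
  moreover have "right_rep (\<lambda>y'. nbv_int (W\<^sub>0 y' i) (\<lambda>\<tau>. r i j (s - \<tau>)))" for i
    unfolding r_def
    by (rule right_rep_nbv_int[OF W0_NBV _ causal_bdd_borel[OF causal_ext[OF Rc_NBV] order_refl]])
      (use right_rep_w0 in \<open>simp add: w\<^sub>0_def\<close>)
  ultimately show ?thesis
    unfolding w_def by (simp add: right_rep_add right_rep_w0 right_rep_sum)
qed

lemma right_rep_nbv_int_W: "bdd_borel T g \<Longrightarrow> right_rep (\<lambda>y'. nbv_int (W y' j) g)"
  by (rule right_rep_nbv_int[OF W_NBV]) (auto simp: ext_W right_rep_w)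

lemma S_bound_upto:
  assumes "0 < T"
  obtains C where "1 \<le> C" "\<And>t y' y. 0 \<le> t \<Longrightarrow> t \<le> T \<Longrightarrow> \<bar>S t y' y\<bar> \<le> C * norm y' * norm y"
proof -
  obtain C where C: "0 \<le> C" "\<And>y' j g B. bdd_borel T g \<Longrightarrow> \<forall>x\<ge>0. \<bar>g x\<bar> \<le> B \<Longrightarrow>
    \<bar>nbv_int (W y' j) g\<bar> \<le> C * B * norm y'"
    by (rule nbv_int_W_bound[OF assms]) (rule that; assumption)
  obtain D where D: "0 \<le> D" "\<And>y i s. s \<le> T \<Longrightarrow> \<bar>v y i s\<bar> \<le> D * norm y"
    by (rule v_bound[of T]) (rule that; assumption)
  \<comment> \<open>The first summand bounds \<open>S\<^sub>0\<close>, the second the \<open>n\<close> convolutions.\<close>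
  define E where "E = M\<^sub>0 * exp (\<bar>\<omega>\<^sub>0\<bar> * T) + (\<Sum>j\<in>(UNIV::'n set). C * D)"
  show ?thesis
  proof (rule that[of E])
    have "1 * 1 \<le> M\<^sub>0 * exp (\<bar>\<omega>\<^sub>0\<bar> * T)"
      using M0_ge_1 assms by (intro mult_mono) auto
    then show "1 \<le> E"
      using C(1) D(1) by (simp add: E_def add_increasing2)
    fix t y' y assume t: "0 \<le> t" "t \<le> T"
    have "\<bar>conv (W y' j) (v y j) t\<bar> \<le> C * (D * norm y) * norm y'" for j
      unfolding conv_def using t by (intro C(2) causal_bdd_borel causal_v allI impI D(2)) auto
    then have "\<bar>\<Sum>j\<in>UNIV. conv (W y' j) (v y j) t\<bar> \<le> (\<Sum>j\<in>(UNIV::'n set). C * (D * norm y) * norm y')"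
      by (intro order_trans[OF sum_abs] sum_mono)
    moreover have "\<bar>S\<^sub>0 t y' y\<bar> \<le> M\<^sub>0 * exp (\<bar>\<omega>\<^sub>0\<bar> * T) * norm y * norm y'"
      by (rule S0_bound_upto[OF t])
    ultimately have "\<bar>S t y' y\<bar> \<le> M\<^sub>0 * exp (\<bar>\<omega>\<^sub>0\<bar> * T) * norm y * norm y' +
        (\<Sum>j\<in>(UNIV::'n set). C * (D * norm y) * norm y')"
      unfolding S_def by linarith
    also have "\<dots> = E * norm y' * norm y"
      by (simp add: E_def algebra_simps)
    finally show "\<bar>S t y' y\<bar> \<le> E * norm y' * norm y" .
  qed
qed

text \<open>Dominated convergence: the functions \<open>v (x n) j\<close> converge pointwise and are uniformly bounded.\<close>

lemma conv_W_weakly_continuous: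
  assumes x: "\<And>y'. (\<lambda>n::nat. p y' (x n)) \<longlonglongrightarrow> p y' l"
  shows "(\<lambda>n. conv (W y' j) (v (x n) j) t) \<longlonglongrightarrow> conv (W y' j) (v l j) t"
proof -
  obtain B where B: "\<And>n. norm (x n) \<le> B" "norm l \<le> B" "0 \<le> B"
    by (rule weakly_convergent_bounded[OF x]) (rule that; assumption)
  obtain D where D: "0 \<le> D" "\<And>y i s. s \<le> t \<Longrightarrow> \<bar>v y i s\<bar> \<le> D * norm y"
    by (rule v_bound[of t]) (rule that; assumption)
  show ?thesis
    unfolding conv_def
  proof (rule nbv_int_convergence[OF W_NBV causal_bdd_borel[OF causal_v order_refl] _ causal_bdd_borel[OF causal_v order_refl]])
    show "\<bar>v (x n) j (t - \<tau>)\<bar> \<le> D * B" if "0 \<le> \<tau>" for n \<tau>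
      using that B(1) by (intro order_trans[OF D(2)] mult_left_mono D(1)) auto
    show "(\<lambda>n. v (x n) j (t - \<tau>)) \<longlonglongrightarrow> v l j (t - \<tau>)" for \<tau>
      by (rule v_weakly_continuous[OF x])
  qed
qed

lemma S_weakly_continuous:
  assumes t: "0 \<le> t" and x: "\<And>y'. (\<lambda>n::nat. p y' (x n)) \<longlonglongrightarrow> p y' l"
  shows "(\<lambda>n. S t y' (x n)) \<longlonglongrightarrow> S t y' l"
  unfolding S_def
  by (intro tendsto_add tendsto_sum conv_W_weakly_continuous[OF x] twin_operator_weak_continuity[OF S0_twin[OF t] x])

lemma S_lin_right: "0 \<le> t \<Longrightarrow> S t y' (a *\<^sub>R x + b *\<^sub>R y) = a * S t y' x + b * S t y' y"
proof -
  assume "0 \<le> t"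
  then interpret S: bounded_bilinear "S\<^sub>0 t"
    by (rule S0_bilinear)
  have "v (a *\<^sub>R x + b *\<^sub>R y) j = (\<lambda>s. a * v x j s + b * v y j s)" for j
    by (intro ext) (rule v_lin)
  then show ?thesis
    by (simp add: S_def S.add_right S.scaleR_right conv_lin W_NBV causal_v sum.distrib
        sum_distrib_left algebra_simps)
qed

lemma S_lin_left: "0 \<le> t \<Longrightarrow> S t (a *\<^sub>R x' + b *\<^sub>R y') y = a * S t x' y + b * S t y' y"
proof -
  assume "0 \<le> t"
  then interpret S: bounded_bilinear "S\<^sub>0 t"
    by (rule S0_bilinear)
  show ?thesis
    by (simp add: S_def S.add_left S.scaleR_left conv_def nbv_int_W_lin[OF causal_bdd_borel[OF causal_v order_refl]]
        sum.distrib sum_distrib_left algebra_simps)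
qed

lemma S_linear:
  assumes "0 \<le> t"
  shows "linear (S t y')" "linear (\<lambda>y'. S t y' y)"
proof -
  show "linear (S t y')"
    using S_lin_right[OF assms, of y' 1 _ 1] S_lin_right[OF assms, of y' _ _ 0 0]
    by (intro linearI) auto
  show "linear (\<lambda>y'. S t y' y)"
    using S_lin_left[OF assms, of 1 _ 1] S_lin_left[OF assms, of _ _ 0 0]
    by (intro linearI) auto
qed

lemma S_twin:
  assumes "0 \<le> t"
  shows "twin_operator p (S t)"
proof -
  obtain C where C: "1 \<le> C" "\<And>s y' y. 0 \<le> s \<Longrightarrow> s \<le> t + 1 \<Longrightarrow> \<bar>S s y' y\<bar> \<le> C * norm y' * norm y"
    by (rule S_bound_upto[of "t + 1"]) (use assms in \<open>auto intro: that\<close>)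
  show ?thesis
  proof (rule twin_operatorI)
    show "\<bar>S t y' y\<bar> \<le> C * norm y' * norm y" for y' y
      using assms by (intro C(2)) auto
    show "right_rep (\<lambda>y'. S t y' y)" for y
      unfolding S_def conv_def using assms
      by (intro right_rep_add right_rep_sum right_rep_S0 right_rep_nbv_int_W[OF causal_bdd_borel[OF causal_v order_refl]])
  qed (use assms S_linear S_weakly_continuous in auto)
qed

section \<open>The semigroup law\<close>

lemma SL_0: "SL 0 y' = y'"
  by (rule twin_left_eqI) (simp add: S0_0)

text \<open>Let \<open>z = W(\<sigma>)q\<^sub>i\<close>. Then \<open>V\<^sub>0(s)z\<close> is the difference of \<open>y'W(\<sigma>)\<close> at \<open>y' = Q S\<^sub>0(s)\<close> and
  \<open>y' = Q\<close>. Both are expressed through \<open>k\<close> by \<open>w0_shift_Q\<close>; subtracting the resolvent equations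
  at times \<open>s + \<sigma>\<close> and \<open>\<sigma>\<close> leaves only integrals over \<open>(\<sigma>, \<infinity>)\<close>.\<close>

lemma v_of_W:
  assumes \<sigma>: "0 < \<sigma>" and z: "\<And>y'. p y' z = w y' i \<sigma>"
  shows "v z j s = tail_conv \<sigma> (Rc j i) heaviside s - (\<Sum>k\<in>UNIV. tail_conv \<sigma> (Rc k i) (v (q k) j) s)"
proof (cases "s < 0")
  case True
  then show ?thesis
    by (simp add: v_neg tail_conv_neg causal_heaviside causal_v)
next
  case False
  then have s: "0 \<le> s" by simp
  let ?I = "\<lambda>k x. nbv_int (Rc k i) (\<lambda>\<rho>. indicator {..\<sigma>} \<rho> * v (q k) j (x + \<sigma> - \<rho>))"
  let ?c = "\<lambda>k. nbv_int (Rc k i) (\<lambda>\<rho>. indicator {..\<sigma>} \<rho> * p (Q j) (q k))"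
  have bdd_borel_const: "bdd_borel \<sigma> (\<lambda>\<rho>. indicator {..\<sigma>} \<rho> * c)" for c :: real
    using bdd_borel_cmult[OF bdd_borel_indicator[of "{..\<sigma>}" \<sigma>], of c] by (simp add: mult.commute)
  have W: "w (SL x (Q j)) i \<sigma> = v (q i) j (x + \<sigma>) + p (Q j) (q i) + (\<Sum>k\<in>UNIV. ?I k x + ?c k)"
    if x: "0 \<le> x" for x
  proof -
    have "conv (Rc k i) (w\<^sub>0 (SL x (Q j)) k) \<sigma> = ?I k x + ?c k" for k
    proof -
      have "conv (Rc k i) (w\<^sub>0 (SL x (Q j)) k) \<sigma> =
          nbv_int (Rc k i) (\<lambda>\<rho>. indicator {..\<sigma>} \<rho> * v (q k) j (x + \<sigma> - \<rho>) + indicator {..\<sigma>} \<rho> * p (Q j) (q k))"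
        unfolding conv_def
        by (rule arg_cong[where f = "nbv_int (Rc k i)"])
          (auto simp: w0_shift_Q[OF x] indicator_def fun_eq_iff algebra_simps)
      also have "\<dots> = ?I k x + ?c k"
        using x by (intro nbv_int_add[OF Rc_NBV, where T = "x + \<sigma>"] causal_tail_bdd_borel causal_v
            bdd_borel_mono[OF bdd_borel_const]) auto
      finally show ?thesis .
    qed
    then show ?thesis
      using \<sigma> by (simp add: w_def w0_shift_Q[OF x])
  qed
  have split: "?I k x + tail_conv \<sigma> (Rc k i) (v (q k) j) x = conv (Rc k i) (v (q k) j) (x + \<sigma>)" for k x
    by (rule tail_conv_split[OF Rc_NBV causal_v])
  have tail_0: "tail_conv \<sigma> (Rc k i) (v (q k) j) 0 = 0" for k
  proof -
    have "(\<lambda>\<rho>. indicator {\<sigma><..} \<rho> * v (q k) j (0 + \<sigma> - \<rho>)) = (\<lambda>_. 0)"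
      by (auto simp: indicator_def fun_eq_iff v_neg)
    then show ?thesis
      by (simp add: tail_conv_def)
  qed
  have "v z j s = w (SL s (Q j)) i \<sigma> - w (SL 0 (Q j)) i \<sigma>"
  proof -
    have "v z j s = p (SL s (Q j)) z - p (Q j) z"
      using s by (simp add: v_nonneg S0_left)
    then show ?thesis
      by (simp add: z SL_0)
  qed
  also have "\<dots> = (v (q i) j (s + \<sigma>) + (\<Sum>k\<in>UNIV. ?I k s)) - (v (q i) j (0 + \<sigma>) + (\<Sum>k\<in>UNIV. ?I k 0))"
    by (simp add: W s sum.distrib)
  also have "(\<Sum>k\<in>UNIV. ?I k s) = (\<Sum>k\<in>UNIV. conv (Rc k i) (v (q k) j) (s + \<sigma>)) -
      (\<Sum>k\<in>UNIV. tail_conv \<sigma> (Rc k i) (v (q k) j) s)"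
    unfolding sum_subtractf[symmetric]
    by (intro sum.cong refl) (simp add: split[symmetric])
  also have "(\<Sum>k\<in>UNIV. ?I k 0) = (\<Sum>k\<in>UNIV. conv (Rc k i) (v (q k) j) (0 + \<sigma>))"
    by (intro sum.cong refl) (simp only: split[symmetric] tail_0 add_0_right)
  also have "v (q i) j (s + \<sigma>) + ((\<Sum>k\<in>UNIV. conv (Rc k i) (v (q k) j) (s + \<sigma>)) -
      (\<Sum>k\<in>UNIV. tail_conv \<sigma> (Rc k i) (v (q k) j) s)) -
      (v (q i) j (0 + \<sigma>) + (\<Sum>k\<in>UNIV. conv (Rc k i) (v (q k) j) (0 + \<sigma>))) =
      r j i (s + \<sigma>) - r j i \<sigma> - (\<Sum>k\<in>UNIV. tail_conv \<sigma> (Rc k i) (v (q k) j) s)"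
    using resolvent_left[of j i "s + \<sigma>"] resolvent_left[of j i \<sigma>] by simp
  finally show ?thesis
    using tail_conv_heaviside[OF Rc_NBV s, of \<sigma> j i] by (simp add: r_def)
qed

text \<open>By \<open>v_of_W\<close> and the renewal equation the perturbation term is the tail of the convolution
  \<open>R * w\<^sub>0\<close> at time \<open>t + \<sigma>\<close>, while \<open>S\<^sub>0(t)\<close> contributes \<open>w\<^sub>0(t + \<sigma>)\<close> and the integral over
  \<open>[0, \<sigma>]\<close>. For \<open>t > 0\<close> these add up to \<open>w(t + \<sigma>)\<close>.\<close>

lemma S_of_W:
  assumes t: "0 \<le> t" and \<sigma>: "0 < \<sigma>" and z: "\<And>y'. p y' z = w y' i \<sigma>"
  shows "S t y' z = w y' i (t + \<sigma>)"
proof (cases "t = 0")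
  case True
  then show ?thesis by (simp add: S_0 z)
next
  case False
  then have t: "0 < t" using t by simp
  let ?I = "\<lambda>k. nbv_int (Rc k i) (\<lambda>\<rho>. indicator {..\<sigma>} \<rho> * w\<^sub>0 y' k (t + \<sigma> - \<rho>))"
  have S0: "S\<^sub>0 t y' z = w\<^sub>0 y' i (t + \<sigma>) + (\<Sum>k\<in>UNIV. ?I k)"
  proof -
    have "S\<^sub>0 t y' z = w (SL t y') i \<sigma>"
      using t S0_left[of t y' z] by (simp add: z)
    moreover have "conv (Rc k i) (w\<^sub>0 (SL t y') k) \<sigma> = ?I k" for k
      unfolding conv_def
      by (rule arg_cong[where f = "nbv_int (Rc k i)"])
        (auto simp: w0_shift[OF t] indicator_def fun_eq_iff algebra_simps)
    ultimately show ?thesis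
      using \<sigma> by (simp add: w_def w0_shift[OF t])
  qed
  have \<sigma>': "0 \<le> \<sigma>" using \<sigma> by simp
  note caus = causal_tail_conv[OF Rc_NBV causal_heaviside \<sigma>'] causal_tail_conv[OF Rc_NBV causal_v \<sigma>']
  have "(\<Sum>j\<in>UNIV. conv (W y' j) (v z j) t) =
      (\<Sum>j\<in>UNIV. conv (W y' j) (tail_conv \<sigma> (Rc j i) heaviside) t -
        (\<Sum>k\<in>UNIV. conv (W y' j) (tail_conv \<sigma> (Rc k i) (v (q k) j)) t))"
  proof (intro sum.cong refl)
    fix j
    have "v z j = (\<lambda>s. tail_conv \<sigma> (Rc j i) heaviside s - (\<Sum>k\<in>UNIV. tail_conv \<sigma> (Rc k i) (v (q k) j) s))"
      by (intro ext v_of_W[OF \<sigma> z])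
    then show "conv (W y' j) (v z j) t = conv (W y' j) (tail_conv \<sigma> (Rc j i) heaviside) t -
        (\<Sum>k\<in>UNIV. conv (W y' j) (tail_conv \<sigma> (Rc k i) (v (q k) j)) t)"
      by (simp add: conv_diff conv_sum W_NBV caus causal_sum)
  qed
  also have "\<dots> = (\<Sum>j\<in>UNIV. tail_conv \<sigma> (Rc j i) (w y' j) t) -
      (\<Sum>j\<in>UNIV. \<Sum>k\<in>UNIV. tail_conv \<sigma> (Rc k i) (conv (W y' j) (v (q k) j)) t)"
    by (simp add: conv_tail_conv W_NBV Rc_NBV causal_heaviside causal_v \<sigma>' conv_heaviside ext_W sum_subtractf)
  also have "\<dots> = (\<Sum>k\<in>UNIV. tail_conv \<sigma> (Rc k i) (w y' k) t -
      (\<Sum>j\<in>UNIV. tail_conv \<sigma> (Rc k i) (conv (W y' j) (v (q k) j)) t))"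
    by (subst sum.swap) (simp add: sum_subtractf)
  also have "\<dots> = (\<Sum>k\<in>UNIV. tail_conv \<sigma> (Rc k i) (w\<^sub>0 y' k) t)"
  proof (intro sum.cong refl)
    fix k
    have "tail_conv \<sigma> (Rc k i) (w y' k) t - (\<Sum>j\<in>UNIV. tail_conv \<sigma> (Rc k i) (conv (W y' j) (v (q k) j)) t) =
        tail_conv \<sigma> (Rc k i) (\<lambda>s. w y' k s - (\<Sum>j\<in>UNIV. conv (W y' j) (v (q k) j) s)) t"
      by (simp add: tail_conv_diff tail_conv_sum Rc_NBV w_causal causal_conv W_NBV causal_v causal_sum)
    also have "(\<lambda>s. w y' k s - (\<Sum>j\<in>UNIV. conv (W y' j) (v (q k) j) s)) = w\<^sub>0 y' k"
      using w_fixed_point[of y' k] by (intro ext) simp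
    finally show "tail_conv \<sigma> (Rc k i) (w y' k) t -
        (\<Sum>j\<in>UNIV. tail_conv \<sigma> (Rc k i) (conv (W y' j) (v (q k) j)) t) = tail_conv \<sigma> (Rc k i) (w\<^sub>0 y' k) t" .
  qed
  finally have "S t y' z = w\<^sub>0 y' i (t + \<sigma>) + (\<Sum>k\<in>UNIV. ?I k + tail_conv \<sigma> (Rc k i) (w\<^sub>0 y' k) t)"
    by (simp add: S_def S0 sum.distrib)
  then show ?thesis
    by (simp add: tail_conv_split Rc_NBV causal_w0 w_def)
qed

text \<open>The measure \<open>y'S(t)W(d\<sigma>)\<close> is \<open>y'W\<close> moved to the left by \<open>t\<close>, with the mass of \<open>[0, t]\<close>
  collected at 0. For indicators of half-lines this is \<open>S_of_W\<close>.\<close>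

lemma S_of_nbv_int_W:
  assumes t: "0 \<le> t" and g: "bdd_borel T g" and z: "\<And>y'. p y' z = nbv_int (W y' i) g"
  shows "S t y' z = nbv_int (W y' i) (\<lambda>\<tau>. indicator {t<..} \<tau> * g (\<tau> - t)) + w y' i t * g 0"
proof -
  let ?T = "max T 1"
  let ?E = "\<lambda>g. nbv_int (W y' i) (\<lambda>\<tau>. indicator {t<..} \<tau> * g (\<tau> - t)) + w y' i t * g 0"
  have "bdd_borel ?T g" "?T > 0"
    using g by (auto intro: bdd_borel_mono)
  then have "\<forall>z. (\<forall>y'. p y' z = nbv_int (W y' i) g) \<longrightarrow> S t y' z = ?E g"
  proof (induction g rule: bdd_borel_induct)
    case (eq f h)
    note meas = bdd_borel_measurable[OF eq(1)] bdd_borel_measurable[OF eq(2)]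
    have "nbv_int (W y' i) h = nbv_int (W y' i) f" for y'
      by (rule nbv_int_cong[OF W_NBV meas eq(3), symmetric])
    moreover have "(\<lambda>\<tau>. indicator {t<..} \<tau> * h (\<tau> - t)) = (\<lambda>\<tau>. indicator {t<..} \<tau> * f (\<tau> - t))"
      using eq(3) by (auto simp: indicator_def fun_eq_iff)
    ultimately show ?case
      using eq(4) eq(3)[of 0] by simp
  next
    case (ind s)
    show ?case
    proof (intro allI impI)
      fix z assume z: "\<forall>y'. p y' z = nbv_int (W y' i) (indicator {..s})"
      have "(\<lambda>\<tau>. indicator {t<..} \<tau> * indicator {..s} (\<tau> - t)) = (\<lambda>\<tau>. indicator {..t + s} \<tau> - indicator {..t} \<tau> :: real)"
        using ind by (auto simp: indicator_def fun_eq_iff)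
      moreover have "nbv_int (W y' i) (\<lambda>\<tau>. indicator {..t + s} \<tau> - indicator {..t} \<tau>) =
          w y' i (t + s) - w y' i t"
      proof -
        have "nbv_int (W y' i) (\<lambda>\<tau>. indicator {..t + s} \<tau> - indicator {..t} \<tau>) =
            nbv_int (W y' i) (indicator {..t + s}) - nbv_int (W y' i) (indicator {..t})"
          using ind by (intro nbv_int_diff[OF W_NBV, where T = "t + s"] bdd_borel_indicator) auto
        then show ?thesis
          by (simp add: nbv_int_indicator W_NBV ext_W)
      qed
      moreover have "S t y' z = w y' i (t + s)"
        using z by (intro S_of_W[OF t ind(1)]) (simp add: nbv_int_indicator W_NBV ext_W)
      ultimately show "S t y' z = ?E (indicator {..s})"
        using ind by simp
    qed
  next
    case (lin f h a b)
    show ?case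
    proof (intro allI impI)
      fix z assume z: "\<forall>y'. p y' z = nbv_int (W y' i) (\<lambda>x. a * f x + b * h x)"
      obtain zf where zf: "\<forall>y'. p y' zf = nbv_int (W y' i) f"
        using right_rep_nbv_int_W[OF lin(1)] unfolding right_rep_def by blast
      obtain zh where zh: "\<forall>y'. p y' zh = nbv_int (W y' i) h"
        using right_rep_nbv_int_W[OF lin(2)] unfolding right_rep_def by blast
      have "z = a *\<^sub>R zf + b *\<^sub>R zh"
        by (rule right_eqI) (simp add: z zf zh p.add_right p.scaleR_right nbv_int_lin[OF W_NBV lin(1,2)])
      then have "S t y' z = a * ?E f + b * ?E h"
        using lin(3,4) zf zh by (simp add: S_lin_right[OF t])
      also have "\<dots> = ?E (\<lambda>x. a * f x + b * h x)"
        using nbv_int_lin[OF W_NBV bdd_borel_shift[OF lin(1) t] bdd_borel_shift[OF lin(2) t], of y' i a b]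
        by (simp add: algebra_simps)
      finally show "S t y' z = ?E (\<lambda>x. a * f x + b * h x)" .
    qed
  next
    case (lim f h B)
    show ?case
    proof (intro allI impI)
      fix z assume z: "\<forall>y'. p y' z = nbv_int (W y' i) h"
      have "\<forall>n. \<exists>zn. \<forall>y'. p y' zn = nbv_int (W y' i) (f n)"
        using right_rep_nbv_int_W[OF lim.hyps(1)] unfolding right_rep_def by blast
      then obtain zn where zn: "\<And>n y'. p y' (zn n) = nbv_int (W y' i) (f n)"
        by metis
      have "(\<lambda>n. p y' (zn n)) \<longlonglongrightarrow> p y' z" for y'
        using nbv_int_convergence[OF W_NBV lim.hyps] by (simp add: z zn)
      then have "(\<lambda>n. S t y' (zn n)) \<longlonglongrightarrow> S t y' z"
        by (rule S_weakly_continuous[OF t])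
      moreover have "S t y' (zn n) = ?E (f n)" for n
        using lim.IH zn by blast
      moreover have "(\<lambda>n. ?E (f n)) \<longlonglongrightarrow> ?E h"
      proof (intro tendsto_add tendsto_mult tendsto_const lim.hyps(4) order_refl)
        show "(\<lambda>n. nbv_int (W y' i) (\<lambda>\<tau>. indicator {t<..} \<tau> * f n (\<tau> - t)))
            \<longlonglongrightarrow> nbv_int (W y' i) (\<lambda>\<tau>. indicator {t<..} \<tau> * h (\<tau> - t))"
        proof (rule nbv_int_convergence[OF W_NBV bdd_borel_shift[OF lim.hyps(1) t] _ bdd_borel_shift[OF lim.hyps(3) t]])
          have "0 \<le> B"
            using lim.hyps(2)[of 0 0] by simp
          then show "\<bar>indicator {t<..} \<tau> * f n (\<tau> - t)\<bar> \<le> B" for n \<tau>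
            using lim.hyps(2) by (auto simp: indicator_def)
          show "(\<lambda>n. indicator {t<..} \<tau> * f n (\<tau> - t)) \<longlonglongrightarrow> indicator {t<..} \<tau> * h (\<tau> - t)" for \<tau>
            using lim.hyps(4)[of "\<tau> - t"] by (cases "t < \<tau>") auto
        qed
      qed
      ultimately show "S t y' z = ?E h"
        by (simp add: LIMSEQ_unique)
    qed
  qed
  then show ?thesis
    using z by blast
qed

text \<open>Write \<open>S(s)y = S\<^sub>0(s)y + \<Sum>\<^sub>i z\<^sub>i\<close> with \<open>z\<^sub>i\<close> an integral against \<open>W\<^sub>i\<close>. By \<open>S_of_nbv_int_W\<close> the
  \<open>z\<^sub>i\<close> contribute the part over \<open>(t, t + s]\<close> of the convolution at time \<open>t + s\<close> and \<open>S\<^sub>0(s)y\<close> the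
  part over \<open>[0, t]\<close>; the boundary terms \<open>y'W\<^sub>i(t) V\<^sub>0(s)y\<close> cancel.\<close>

lemma S_add:
  assumes t: "0 \<le> t" and s: "0 \<le> s" and z: "\<And>y'. p y' z = S s y' y"
  shows "S t y' z = S (t + s) y' y"
proof -
  have bdd_borel: "bdd_borel s (\<lambda>\<tau>. v y i (s - \<tau>))" for i
    by (intro causal_bdd_borel causal_v) auto
  have "\<forall>i. \<exists>zi. \<forall>y'. p y' zi = conv (W y' i) (v y i) s"
    using right_rep_nbv_int_W[OF bdd_borel] unfolding right_rep_def conv_def by blast
  then obtain zi where zi: "\<And>i y'. p y' (zi i) = conv (W y' i) (v y i) s"
    by metis
  have z_eq: "z = SR s y + (\<Sum>i\<in>UNIV. zi i)"
    by (rule right_eqI) (simp add: z S_def p.add_right p.sum_right S0_right s zi)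
  interpret St: bounded_bilinear "S t"
    using S_twin[OF t] by (rule twin_operator_bilinear)
  let ?a = "\<lambda>i. nbv_int (W y' i) (\<lambda>\<tau>. indicator {..t} \<tau> * v y i (t + s - \<tau>))"
  let ?b = "\<lambda>i. nbv_int (W y' i) (\<lambda>\<tau>. indicator {t<..} \<tau> * v y i (t + s - \<tau>))"
  have Szi: "S t y' (zi i) = ?b i + w y' i t * v y i s" for i
  proof -
    have "p x' (zi i) = nbv_int (W x' i) (\<lambda>\<tau>. v y i (s - \<tau>))" for x'
      by (simp add: zi conv_def)
    from S_of_nbv_int_W[OF t bdd_borel this, of y'] show ?thesis
      by (simp add: algebra_simps)
  qed
  have convSR: "conv (W y' i) (v (SR s y) i) t = ?a i - w y' i t * v y i s" for i
  proof -
    have v: "v (SR s y) i x = (if x < 0 then 0 else v y i (x + s) - v y i s)" for x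
      using s by (simp add: v_def S0_add_right S0_right)
    have "conv (W y' i) (v (SR s y) i) t =
        nbv_int (W y' i) (\<lambda>\<tau>. indicator {..t} \<tau> * v y i (t + s - \<tau>) - v y i s * indicator {..t} \<tau>)"
      unfolding conv_def
      by (rule arg_cong[where f = "nbv_int (W y' i)"]) (auto simp: v indicator_def fun_eq_iff algebra_simps)
    also have "\<dots> = ?a i - nbv_int (W y' i) (\<lambda>\<tau>. v y i s * indicator {..t} \<tau>)"
      using t s by (intro nbv_int_diff[OF W_NBV, where T = "t + s"] causal_tail_bdd_borel causal_v bdd_borel_cmult bdd_borel_indicator) auto
    finally show ?thesis
      by (simp add: nbv_int_cmult nbv_int_indicator W_NBV ext_W)
  qed
  have split: "?a i + ?b i = conv (W y' i) (v y i) (t + s)" for i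
    using tail_conv_split[OF W_NBV causal_v, of y' i t y i s] by (simp add: tail_conv_def add.commute)
  have "S t y' z = S t y' (SR s y) + (\<Sum>i\<in>UNIV. S t y' (zi i))"
    by (simp add: z_eq St.add_right St.sum_right)
  also have "\<dots> = S\<^sub>0 (t + s) y' y + (\<Sum>i\<in>UNIV. ?a i + ?b i)"
    unfolding S_def[of t y' "SR s y"]
    by (simp add: Szi convSR S0_add_right t s sum.distrib sum_subtractf)
  also have "\<dots> = S (t + s) y' y"
    by (simp add: S_def split)
  finally show ?thesis .
qed

lemma S_twin_comp:
  assumes "0 \<le> t" "0 \<le> s"
  shows "S (t + s) = twin_comp p (S t) (S s)"
proof (intro ext)
  fix y' y
  show "S (t + s) y' y = twin_comp p (S t) (S s) y' y"
    unfolding twin_comp_eq(1)[OF S_twin[OF assms(1)] S_twin[OF assms(2)]]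
    by (rule S_add[OF assms, symmetric]) (rule pairing_twin_right[OF S_twin[OF assms(2)]])
qed

lemma S_exponential_bound:
  obtains M \<omega> where "1 \<le> M" "0 \<le> \<omega>" "\<And>t y' y. 0 \<le> t \<Longrightarrow> \<bar>S t y' y\<bar> \<le> M * exp (\<omega> * t) * norm y * norm y'"
proof -
  obtain C where C: "1 \<le> C" "\<And>t y' y. 0 \<le> t \<Longrightarrow> t \<le> 1 \<Longrightarrow> \<bar>S t y' y\<bar> \<le> C * norm y' * norm y"
    by (rule S_bound_upto[of 1]) (simp, (rule that; assumption))
  let ?SR = "twin_right p (S 1)"
  have SR: "norm (?SR y) \<le> C * norm y" for y
  proof (rule norm_right_le)
    show "\<bar>p y' (?SR y)\<bar> \<le> C * norm y * norm y'" for y'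
      using C(2)[of 1 y' y] by (simp add: pairing_twin_right[OF S_twin] ac_simps)
  qed (use C(1) in simp)
  have power: "\<bar>S (real n + x) y' y\<bar> \<le> C ^ Suc n * norm y' * norm y" if "0 \<le> x" "x \<le> 1" for n x y' y
  proof (induction n arbitrary: y)
    case 0
    then show ?case using C(2)[OF that] by simp
  next
    case (Suc n)
    have "S (real (Suc n) + x) y' y = S (real n + x) y' (?SR y)"
      using S_add[of "real n + x" 1 "?SR y" y y'] that by (simp add: pairing_twin_right[OF S_twin] algebra_simps)
    also have "\<bar>\<dots>\<bar> \<le> C ^ Suc n * norm y' * norm (?SR y)"
      by (rule Suc)
    also have "\<dots> \<le> C ^ Suc n * norm y' * (C * norm y)"
      using C(1) by (intro mult_left_mono SR) auto
    finally show ?case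
      by (simp add: algebra_simps)
  qed
  show ?thesis
  \<comment> \<open>\<open>C\<close> raised to the integer part of \<open>t\<close>, plus one factor for the remainder in \<open>[0, 1]\<close>.\<close>
  proof (rule that[of C "ln C"])
    fix t :: real and y' y assume t: "0 \<le> t"
    define n where "n = nat \<lfloor>t\<rfloor>"
    have n: "real n \<le> t" "t - real n \<le> 1" "0 \<le> t - real n"
      using t by (auto simp: n_def) linarith+
    have "\<bar>S t y' y\<bar> \<le> C ^ Suc n * norm y' * norm y"
      using power[OF n(3) n(2), of n y' y] by simp
    also have "C ^ n = exp (ln C * real n)"
      using C(1) by (subst mult.commute) (simp add: exp_of_nat_mult)
    then have "C ^ Suc n \<le> C * exp (ln C * t)"
      using C(1) n(1) by (auto intro!: mult_left_mono)
    then have "C ^ Suc n * norm y' * norm y \<le> C * exp (ln C * t) * norm y' * norm y"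
      by (intro mult_right_mono) auto
    finally show "\<bar>S t y' y\<bar> \<le> C * exp (ln C * t) * norm y * norm y'"
      by (simp add: ac_simps)
  qed (use C(1) in auto)
qed

lemma S_measurable: "(\<lambda>t. indicator {0..} t * S t y' y) \<in> borel_measurable borel"
proof -
  have "(\<lambda>t. indicator {0..} t * S\<^sub>0 t y' y + (\<Sum>j\<in>UNIV. conv (W y' j) (v y j) t)) \<in> borel_measurable borel"
    using S0_measurable causalD(1)[OF causal_conv[OF W_NBV causal_v]] by (intro borel_measurable_add borel_measurable_sum)
  moreover have "indicator {0..} t * S t y' y = indicator {0..} t * S\<^sub>0 t y' y + (\<Sum>j\<in>UNIV. conv (W y' j) (v y j) t)" for t
    by (cases "0 \<le> t") (simp_all add: S_def causalD(2)[OF causal_conv[OF W_NBV causal_v]])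
  ultimately show ?thesis
    by simp
qed

end

section \<open>Laplace transforms of exponentially bounded families\<close>

lemma exp_half_line:
  assumes "0 < c"
  shows "integrable lborel (\<lambda>t::real. indicator {0..} t * exp (- (c * t)))"
    and "(\<integral>t. indicator {0..} t * exp (- (c * t)) \<partial>lborel) = 1 / c"
proof -
  have lim: "((\<lambda>t. - exp (- (c * t)) / c) \<longlongrightarrow> 0) at_top"
  proof -
    have "filterlim (\<lambda>t. c * t) at_top at_top"
      using assms by (intro filterlim_tendsto_pos_mult_at_top[OF tendsto_const _ filterlim_ident])
    then have "((\<lambda>t. exp (- (c * t))) \<longlongrightarrow> 0) at_top"
      by (intro filterlim_compose[OF exp_at_bot] filterlim_compose[OF filterlim_uminus_at_bot_at_top])
    from tendsto_divide[OF tendsto_minus[OF this] tendsto_const[of c]] assms show ?thesis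
      by simp
  qed
  have "(\<integral>\<^sup>+t. ennreal (exp (- (c * t))) * indicator {0..} t \<partial>lborel) = ennreal (0 - (- exp (- (c * 0)) / c))"
    using assms by (intro nn_integral_FTC_atLeast[OF _ _ _ lim]) (auto intro!: derivative_eq_intros)
  moreover have "ennreal (exp (- (c * t))) * indicator {0..} t = ennreal (indicator {0..} t * exp (- (c * t)))" for t
    by (auto simp: indicator_def)
  ultimately have "(\<integral>\<^sup>+t. ennreal (indicator {0..} t * exp (- (c * t))) \<partial>lborel) = ennreal (1 / c)"
    by simp
  then have "has_bochner_integral lborel (\<lambda>t::real. indicator {0..} t * exp (- (c * t))) (1 / c)"
    using assms by (intro has_bochner_integral_nn_integral) auto
  then show "integrable lborel (\<lambda>t::real. indicator {0..} t * exp (- (c * t)))"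
    "(\<integral>t. indicator {0..} t * exp (- (c * t)) \<partial>lborel) = 1 / c"
    by (auto simp: has_bochner_integral_iff)
qed

text \<open>Integrability on the product is recorded separately because it also justifies the exchange of
  integrals in \<open>resolvent_identity\<close>.\<close>

lemma L1_convolution:
  fixes f g :: "real \<Rightarrow> real"
  assumes f: "integrable lborel f" and g: "integrable lborel g"
  shows "integrable (lborel \<Otimes>\<^sub>M lborel) (\<lambda>(u, t). f (t - u) * g u)"
    and "(\<integral>t. (\<integral>u. f (t - u) * g u \<partial>lborel) \<partial>lborel) = (\<integral>t. f t \<partial>lborel) * (\<integral>t. g t \<partial>lborel)"
proof -
  have [measurable]: "f \<in> borel_measurable borel" "g \<in> borel_measurable borel"
    using f g by auto
  have shift: "integrable lborel (\<lambda>t. h (t - u))" "(\<integral>t. h (t - u) \<partial>lborel) = (\<integral>t. h t \<partial>lborel)"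
    if "integrable lborel h" for h :: "real \<Rightarrow> real" and u
    using lborel_integrable_real_affine[OF that, of 1 "- u"] lborel_integral_real_affine[of 1 h "- u"]
    by (simp_all add: algebra_simps)
  show int: "integrable (lborel \<Otimes>\<^sub>M lborel) (\<lambda>(u, t). f (t - u) * g u)"
  proof (rule lborel_pair.Fubini_integrable)
    have "(\<integral>t. norm (case (u, t) of (u, t) \<Rightarrow> f (t - u) * g u) \<partial>lborel) = \<bar>g u\<bar> * (\<integral>t. \<bar>f t\<bar> \<partial>lborel)" for u
      using shift(2)[OF integrable_abs[OF f], of u] by (simp add: abs_mult mult.commute)
    then show "integrable lborel (\<lambda>u. \<integral>t. norm (case (u, t) of (u, t) \<Rightarrow> f (t - u) * g u) \<partial>lborel)"
      using g by simp
    show "AE u in lborel. integrable lborel (\<lambda>t. case (u, t) of (u, t) \<Rightarrow> f (t - u) * g u)"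
      using shift(1)[OF f] by simp
  qed measurable
  have "(\<integral>t. (\<integral>u. f (t - u) * g u \<partial>lborel) \<partial>lborel) = (\<integral>u. (\<integral>t. f (t - u) * g u \<partial>lborel) \<partial>lborel)"
    using lborel_pair.Fubini_integral[of "\<lambda>u t. f (t - u) * g u"] int by simp
  also have "\<dots> = (\<integral>u. (\<integral>t. f t \<partial>lborel) * g u \<partial>lborel)"
    using shift[OF f] by simp
  finally show "(\<integral>t. (\<integral>u. f (t - u) * g u \<partial>lborel) \<partial>lborel) = (\<integral>t. f t \<partial>lborel) * (\<integral>t. g t \<partial>lborel)"
    by simp
qed

definition weighted_int :: "(real \<Rightarrow> 'b \<Rightarrow> 'a \<Rightarrow> real) \<Rightarrow> (real \<Rightarrow> real) \<Rightarrow> 'b \<Rightarrow> 'a \<Rightarrow> real" where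
  "weighted_int U f y' y = (\<integral>t. indicator {0..} t * (f t * U t y' y) \<partial>lborel)"

lemma twin_laplace_eq_weighted_int: "twin_laplace U \<zeta> = weighted_int U (\<lambda>t. exp (- (\<zeta> * t)))"
  by (simp add: twin_laplace_def weighted_int_def set_lebesgue_integral_def fun_eq_iff)

text \<open>Besides \<open>exp (- a t)\<close> this admits its products with \<open>cos (b t)\<close> and \<open>sin (b t)\<close>, so complex
  Laplace transforms are covered by real ones.\<close>

definition weight :: "real \<Rightarrow> (real \<Rightarrow> real) \<Rightarrow> bool" where
  "weight a f \<longleftrightarrow> f \<in> borel_measurable borel \<and> (\<forall>t\<ge>0. \<bar>f t\<bar> \<le> exp (- (a * t)))"

lemma weight_exp: "weight a (\<lambda>t. exp (- (a * t)))"
  by (simp add: weight_def)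

lemma weight_cos: "weight a (\<lambda>t. exp (- (a * t)) * cos (b * t))"
  and weight_sin: "weight a (\<lambda>t. exp (- (a * t)) * sin (b * t))"
  by (auto simp: weight_def abs_mult intro!: mult_left_le)

context norming_pair
begin

text \<open>What \<open>S\<close> and \<open>S\<^sub>0\<close> have in common before the semigroup law is used.\<close>

definition exp_family :: "(real \<Rightarrow> 'b \<Rightarrow> 'a \<Rightarrow> real) \<Rightarrow> real \<Rightarrow> real \<Rightarrow> bool" where
  "exp_family U M \<omega> \<longleftrightarrow> (\<forall>t\<ge>0. twin_operator p (U t)) \<and>
     (\<forall>y' y. (\<lambda>t. indicator {0..} t * U t y' y) \<in> borel_measurable borel) \<and>
     (\<forall>t\<ge>0. \<forall>y' y. \<bar>U t y' y\<bar> \<le> M * exp (\<omega> * t) * norm y * norm y') \<and> 0 \<le> M"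

lemma exp_family_semigroup:
  assumes "twin_semigroup_bound p U M \<omega>"
  shows "exp_family U M \<omega>"
proof -
  have "(\<lambda>t. indicator {0..} t * U t y' y) \<in> borel_measurable borel" for y' y
  proof -
    have "(\<lambda>t. U t y' y) \<in> borel_measurable (restrict_space borel {0..})"
      using assms by (auto simp: twin_semigroup_bound_def)
    then show ?thesis
      by (subst (asm) borel_measurable_restrict_space_iff) (auto simp: mult.commute)
  qed
  then show ?thesis
    using assms by (auto simp: exp_family_def twin_semigroup_bound_def)
qed

context
  fixes U M \<omega>
  assumes U: "exp_family U M \<omega>"
begin

lemma U_twin: "0 \<le> t \<Longrightarrow> twin_operator p (U t)"
  and U_measurable: "(\<lambda>t. indicator {0..} t * U t y' y) \<in> borel_measurable borel"
  and U_bound: "0 \<le> t \<Longrightarrow> \<bar>U t y' y\<bar> \<le> M * exp (\<omega> * t) * norm y * norm y'"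
  and M_nonneg: "0 \<le> M"
  using U unfolding exp_family_def by blast+

lemma weighted_int_measurable:
  assumes "weight a f"
  shows "(\<lambda>t. indicator {0..} t * (f t * U t y' y)) \<in> borel_measurable borel"
proof -
  have [measurable]: "f \<in> borel_measurable borel"
    using assms by (simp add: weight_def)
  have "(\<lambda>t. f t * (indicator {0..} t * U t y' y)) \<in> borel_measurable borel"
    using U_measurable[of y' y] by measurable
  then show ?thesis
    by (simp add: mult.left_commute)
qed

lemma weighted_int_dominated:
  assumes "weight a f" "norm y \<le> C"
  shows "norm (indicator {0..} t * (f t * U t y' y)) \<le>
    M * C * norm y' * (indicator {0..} t * exp (- ((a - \<omega>) * t)))"
proof (cases "0 \<le> t")
  case True
  have "0 \<le> C"
    using norm_ge_zero assms(2) by (rule order_trans)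
  have "\<bar>f t * U t y' y\<bar> \<le> exp (- (a * t)) * (M * exp (\<omega> * t) * norm y * norm y')"
    unfolding abs_mult using assms True by (intro mult_mono U_bound) (auto simp: weight_def)
  also have "\<dots> \<le> exp (- (a * t)) * (M * exp (\<omega> * t) * C * norm y')"
    using assms(2) M_nonneg by (intro mult_left_mono mult_right_mono) auto
  also have "\<dots> = M * C * norm y' * exp (- ((a - \<omega>) * t))"
    by (simp add: algebra_simps flip: exp_add)
  finally show ?thesis
    using True by simp
qed simp

lemma integrable_dom: "\<omega> < a \<Longrightarrow> integrable lborel (\<lambda>t. K * (indicator {0..} t * exp (- ((a - \<omega>) * t))))"
  by (intro integrable_mult_right exp_half_line) simp

lemma weighted_int_integrable:
  assumes "weight a f" "\<omega> < a"
  shows "integrable lborel (\<lambda>t. indicator {0..} t * (f t * U t y' y))"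
proof (rule Bochner_Integration.integrable_bound[OF integrable_dom[OF assms(2)]])
  show "AE t in lborel. norm (indicator {0..} t * (f t * U t y' y)) \<le>
    norm (M * norm y * norm y' * (indicator {0..} t * exp (- ((a - \<omega>) * t))))"
    by (intro AE_I2 order_trans[OF weighted_int_dominated[OF assms(1) order_refl]]) simp
qed (use weighted_int_measurable[OF assms(1)] in simp)

lemma weighted_int_bound:
  assumes "weight a f" "\<omega> < a"
  shows "\<bar>weighted_int U f y' y\<bar> \<le> M / (a - \<omega>) * norm y' * norm y"
proof -
  have "norm (weighted_int U f y' y) \<le> (\<integral>t. norm (indicator {0..} t * (f t * U t y' y)) \<partial>lborel)"
    unfolding weighted_int_def by (rule integral_norm_bound)
  also have "\<dots> \<le> (\<integral>t. M * norm y * norm y' * (indicator {0..} t * exp (- ((a - \<omega>) * t))) \<partial>lborel)"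
    by (intro integral_mono integrable_norm weighted_int_integrable[OF assms] integrable_dom[OF assms(2)]
        weighted_int_dominated[OF assms(1) order_refl])
  also have "\<dots> = M * norm y * norm y' * (1 / (a - \<omega>))"
    using assms(2) by (simp add: exp_half_line)
  finally show ?thesis
    by (simp add: ac_simps)
qed

lemma weighted_int_lin_right:
  assumes "weight a f" "\<omega> < a"
  shows "weighted_int U f y' (b *\<^sub>R x + c *\<^sub>R y) = b * weighted_int U f y' x + c * weighted_int U f y' y"
proof -
  have "indicator {0..} t * (f t * U t y' (b *\<^sub>R x + c *\<^sub>R y)) =
      b * (indicator {0..} t * (f t * U t y' x)) + c * (indicator {0..} t * (f t * U t y' y))" for t
  proof (cases "0 \<le> t")
    case True
    then interpret Ut: bounded_bilinear "U t"
      by (intro twin_operator_bilinear U_twin)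
    show ?thesis
      using True by (simp add: Ut.add_right Ut.scaleR_right algebra_simps)
  qed simp
  then show ?thesis
    unfolding weighted_int_def using weighted_int_integrable[OF assms] by simp
qed

lemma weighted_int_lin_left:
  assumes "weight a f" "\<omega> < a"
  shows "weighted_int U f (b *\<^sub>R x' + c *\<^sub>R y') y = b * weighted_int U f x' y + c * weighted_int U f y' y"
proof -
  have "indicator {0..} t * (f t * U t (b *\<^sub>R x' + c *\<^sub>R y') y) =
      b * (indicator {0..} t * (f t * U t x' y)) + c * (indicator {0..} t * (f t * U t y' y))" for t
  proof (cases "0 \<le> t")
    case True
    then interpret Ut: bounded_bilinear "U t"
      by (intro twin_operator_bilinear U_twin)
    show ?thesis
      using True by (simp add: Ut.add_left Ut.scaleR_left algebra_simps)
  qed simp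
  then show ?thesis
    unfolding weighted_int_def using weighted_int_integrable[OF assms] by simp
qed

lemma weighted_int_weakly_continuous:
  assumes f: "weight a f" "\<omega> < a" and x: "\<And>y'. (\<lambda>n::nat. p y' (x n)) \<longlonglongrightarrow> p y' l"
  shows "(\<lambda>n. weighted_int U f y' (x n)) \<longlonglongrightarrow> weighted_int U f y' l"
proof -
  obtain B where B: "\<And>n. norm (x n) \<le> B" "norm l \<le> B" "0 \<le> B"
    by (rule weakly_convergent_bounded[OF x]) (rule that; assumption)
  show ?thesis
    unfolding weighted_int_def
  proof (rule integral_dominated_convergence[OF _ _ integrable_dom[OF f(2)]])
    show "AE t in lborel. (\<lambda>n. indicator {0..} t * (f t * U t y' (x n))) \<longlonglongrightarrow> indicator {0..} t * (f t * U t y' l)"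
    proof (intro AE_I2)
      fix t :: real
      show "(\<lambda>n. indicator {0..} t * (f t * U t y' (x n))) \<longlonglongrightarrow> indicator {0..} t * (f t * U t y' l)"
      proof (cases "0 \<le> t")
        case True
        then show ?thesis
          by (intro tendsto_intros twin_operator_weak_continuity[OF U_twin x])
      qed simp
    qed
    show "AE t in lborel. norm (indicator {0..} t * (f t * U t y' (x n))) \<le>
        M * B * norm y' * (indicator {0..} t * exp (- ((a - \<omega>) * t)))" for n
      using weighted_int_dominated[OF f(1) B(1)] by (intro AE_I2)
  qed (use weighted_int_measurable[OF f(1)] in simp_all)
qed

lemma weighted_int_twin:
  assumes f: "weight a f" "\<omega> < a" and rep: "\<And>y. right_rep (\<lambda>y'. weighted_int U f y' y)"
  shows "twin_operator p (weighted_int U f)"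
proof (rule twin_operatorI)
  show "linear (weighted_int U f y')" for y'
    using weighted_int_lin_right[OF f, of y' 1 _ 1] weighted_int_lin_right[OF f, of y' _ _ 0 0]
    by (intro linearI) auto
  show "linear (\<lambda>y'. weighted_int U f y' y)" for y
    using weighted_int_lin_left[OF f, of 1 _ 1] weighted_int_lin_left[OF f, of _ _ 0 0]
    by (intro linearI) auto
  show "\<bar>weighted_int U f y' y\<bar> \<le> M / (a - \<omega>) * norm y' * norm y" for y' y
    by (rule weighted_int_bound[OF f])
qed (rule rep, rule weighted_int_weakly_continuous[OF f])

lemma complex_twin_laplace_eq:
  assumes "\<omega> < Re \<zeta>"
  shows "complex_twin_laplace U \<zeta> u' u =
    complexify (weighted_int U (\<lambda>t. exp (- (Re \<zeta> * t)) * cos (Im \<zeta> * t))) u' u -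
    \<i> * complexify (weighted_int U (\<lambda>t. exp (- (Re \<zeta> * t)) * sin (Im \<zeta> * t))) u' u"
proof -
  define c where "c t = exp (- (Re \<zeta> * t)) * cos (Im \<zeta> * t)" for t
  define s where "s t = exp (- (Re \<zeta> * t)) * sin (Im \<zeta> * t)" for t
  define F where "F f y' y t = indicator {0..} t * (f t * U t y' y)" for f y' y and t :: real
  have exp_eq: "exp (- (\<zeta> * complex_of_real t)) = Complex (c t) (- s t)" for t
    by (simp add: complex_eq_iff c_def s_def Re_exp Im_exp)
  have wc: "weight (Re \<zeta>) c" and ws: "weight (Re \<zeta>) s"
    unfolding c_def[abs_def] s_def[abs_def] by (rule weight_cos weight_sin)+
  have int: "integrable lborel (F c y' y)" "integrable lborel (F s y' y)" for y' y
    unfolding F_def using weighted_int_integrable[OF wc assms] weighted_int_integrable[OF ws assms] by auto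
  let ?x' = "fst u'" and ?y' = "snd u'" and ?x = "fst u" and ?y = "snd u"
  define G where "G t = F c ?x' ?x t - F c ?y' ?y t + F s ?x' ?y t + F s ?y' ?x t" for t
  define H where "H t = F c ?x' ?y t + F c ?y' ?x t - F s ?x' ?x t + F s ?y' ?y t" for t
  have weighted_int_F: "weighted_int U f y' y = (\<integral>t. F f y' y t \<partial>lborel)" for f y' y
    by (simp add: weighted_int_def F_def)
  have intGH: "integrable lborel G" "integrable lborel H"
    unfolding G_def[abs_def] H_def[abs_def] using int by auto
  have "indicator {0..} t *\<^sub>R (exp (- (\<zeta> * complex_of_real t)) * complexify (U t) u' u) =
      complex_of_real (G t) + \<i> * complex_of_real (H t)" for t
    unfolding exp_eq by (simp add: complex_eq_iff complexify_def G_def H_def F_def algebra_simps)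
  then have "complex_twin_laplace U \<zeta> u' u = (\<integral>t. complex_of_real (G t) + \<i> * complex_of_real (H t) \<partial>lborel)"
    by (simp add: complex_twin_laplace_def set_lebesgue_integral_def)
  also have "\<dots> = complex_of_real (\<integral>t. G t \<partial>lborel) + \<i> * complex_of_real (\<integral>t. H t \<partial>lborel)"
    using intGH by simp
  also have "(\<integral>t. G t \<partial>lborel) = weighted_int U c ?x' ?x - weighted_int U c ?y' ?y + weighted_int U s ?x' ?y + weighted_int U s ?y' ?x"
    unfolding G_def weighted_int_F using int by simp
  also have "(\<integral>t. H t \<partial>lborel) = weighted_int U c ?x' ?y + weighted_int U c ?y' ?x - weighted_int U s ?x' ?x + weighted_int U s ?y' ?y"
    unfolding H_def weighted_int_F using int by simp
  finally show ?thesis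
    by (simp add: complex_eq_iff complexify_def flip: c_def s_def)
qed

end

lemma bounded_bilinear_complexify:
  fixes L :: "'b \<Rightarrow> 'a \<Rightarrow> real"
  assumes "bounded_bilinear L"
  shows "bounded_bilinear (complexify L)"
proof -
  interpret L: bounded_bilinear L by fact
  obtain K where K: "\<And>a b. norm (L a b) \<le> norm a * norm b * K" and "K > 0"
    using L.pos_bounded by blast
  show ?thesis
  proof
    show "\<exists>K. \<forall>a b. norm (complexify L a b) \<le> norm a * norm b * K"
    proof (intro exI[of _ "4 * K"] allI)
      fix a :: "'b \<times> 'b" and b :: "'a \<times> 'a"
      have le: "\<bar>L x y\<bar> \<le> norm a * norm b * K" if "norm x \<le> norm a" "norm y \<le> norm b" for x y
        using K[of x y] that \<open>K > 0\<close>
        by (auto intro!: order_trans[OF K[of x y, unfolded real_norm_def]] mult_right_mono mult_mono)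
      have "norm (fst a) \<le> norm a" "norm (snd a) \<le> norm a" "norm (fst b) \<le> norm b" "norm (snd b) \<le> norm b"
        using norm_fst_le[of "fst a" "snd a"] norm_snd_le[of "snd a" "fst a"]
          norm_fst_le[of "fst b" "snd b"] norm_snd_le[of "snd b" "fst b"] by simp_all
      note * = le[OF this(1,3)] le[OF this(2,4)] le[OF this(1,4)] le[OF this(2,3)]
      have "norm (complexify L a b) \<le> \<bar>L (fst a) (fst b) - L (snd a) (snd b)\<bar> + \<bar>L (fst a) (snd b) + L (snd a) (fst b)\<bar>"
        using cmod_le[of "complexify L a b"] by (simp add: complexify_def)
      also have "\<dots> \<le> norm a * norm b * (4 * K)"
        using * by linarith
      finally show "norm (complexify L a b) \<le> norm a * norm b * (4 * K)" .
    qed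
  qed (auto simp: complexify_def complex_eq_iff L.add_left L.add_right L.scaleR_left L.scaleR_right algebra_simps)
qed

lemma complexify_scale:
  fixes L :: "'b \<Rightarrow> 'a \<Rightarrow> real"
  assumes "bounded_bilinear L"
  shows "complexify L (complex_scale c u') u = c * complexify L u' u"
    "complexify L u' (complex_scale c u) = c * complexify L u' u"
proof -
  interpret L: bounded_bilinear L by fact
  show "complexify L (complex_scale c u') u = c * complexify L u' u"
    "complexify L u' (complex_scale c u) = c * complexify L u' u"
    by (simp_all add: complexify_def complex_scale_def complex_eq_iff L.add_left L.add_right
        L.diff_left L.diff_right L.scaleR_left L.scaleR_right algebra_simps)
qed

lemma complex_twin_operatorI:
  assumes c: "twin_operator p Lc" and s: "twin_operator p Ls"
  shows "complex_twin_operator p (\<lambda>u' u. complexify Lc u' u - \<i> * complexify Ls u' u)"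
  unfolding complex_twin_operator_def
proof (intro conjI allI)
  note bc = twin_operator_bilinear[OF c] and bs = twin_operator_bilinear[OF s]
  interpret C: bounded_bilinear "complexify Lc"
    using bc by (rule bounded_bilinear_complexify)
  interpret Sn: bounded_bilinear "complexify Ls"
    using bs by (rule bounded_bilinear_complexify)
  interpret P: bounded_bilinear "complexify p"
    by (rule bounded_bilinear_complexify[OF p.bounded_bilinear_axioms])
  show "bounded_bilinear (\<lambda>u' u. complexify Lc u' u - \<i> * complexify Ls u' u)"
  proof
    obtain K where K: "\<And>a b. norm (complexify Lc a b) \<le> norm a * norm b * K"
      using C.bounded by blast
    obtain K' where K': "\<And>a b. norm (complexify Ls a b) \<le> norm a * norm b * K'"
      using Sn.bounded by blast
    have "norm (complexify Lc a b - \<i> * complexify Ls a b) \<le> norm a * norm b * (K + K')" for a b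
      using norm_triangle_ineq4[of "complexify Lc a b" "\<i> * complexify Ls a b"] K[of a b] K'[of a b]
      by (simp add: norm_mult distrib_left)
    then show "\<exists>K. \<forall>a b. norm (complexify Lc a b - \<i> * complexify Ls a b) \<le> norm a * norm b * K"
      by blast
  qed (simp_all add: C.add_left C.add_right C.scaleR_left C.scaleR_right
      Sn.add_left Sn.add_right Sn.scaleR_left Sn.scaleR_right algebra_simps)
  show "complexify Lc (complex_scale k u') u - \<i> * complexify Ls (complex_scale k u') u =
      k * (complexify Lc u' u - \<i> * complexify Ls u' u)"
    "complexify Lc u' (complex_scale k u) - \<i> * complexify Ls u' (complex_scale k u) =
      k * (complexify Lc u' u - \<i> * complexify Ls u' u)" for k u' u
    by (simp_all add: complexify_scale[OF bc] complexify_scale[OF bs] algebra_simps)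
  show "\<exists>z. \<forall>u'. complexify p u' z = complexify Lc u' u - \<i> * complexify Ls u' u" for u
  proof (intro exI allI)
    fix u'
    let ?R = "\<lambda>L. (twin_right p L (fst u), twin_right p L (snd u))"
    have "complexify p u' (?R L) = complexify L u' u" if "twin_operator p L" for L
      by (simp add: complexify_def pairing_twin_right[OF that])
    then show "complexify p u' (?R Lc - complex_scale \<i> (?R Ls)) = complexify Lc u' u - \<i> * complexify Ls u' u"
      using c s by (simp only: P.diff_right complexify_scale[OF p.bounded_bilinear_axioms])
  qed
  show "\<exists>z'. \<forall>u. complexify p z' u = complexify Lc u' u - \<i> * complexify Ls u' u" for u'
  proof (intro exI allI)
    fix u
    let ?R = "\<lambda>L. (twin_left p L (fst u'), twin_left p L (snd u'))"
    have "complexify p (?R L) u = complexify L u' u" if "twin_operator p L" for L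
      by (simp add: complexify_def pairing_twin_left[OF that])
    then show "complexify p (?R Lc - complex_scale \<i> (?R Ls)) u = complexify Lc u' u - \<i> * complexify Ls u' u"
      using c s by (simp only: P.diff_left complexify_scale[OF p.bounded_bilinear_axioms])
  qed
qed

text \<open>Testing the complex transform on \<open>(y', 0)\<close> and \<open>(y, 0)\<close> separates it into its cosine and sine
  parts.\<close>

lemma right_rep_weighted_int_complex:
  assumes U: "exp_family U M \<omega>" and \<zeta>: "\<omega> < Re \<zeta>"
    and ct: "complex_twin_operator p (complex_twin_laplace U \<zeta>)"
  shows "right_rep (\<lambda>y'. weighted_int U (\<lambda>t. exp (- (Re \<zeta> * t)) * cos (Im \<zeta> * t)) y' y)"
    and "right_rep (\<lambda>y'. weighted_int U (\<lambda>t. exp (- (Re \<zeta> * t)) * sin (Im \<zeta> * t)) y' y)"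
proof -
  let ?c = "weighted_int U (\<lambda>t. exp (- (Re \<zeta> * t)) * cos (Im \<zeta> * t))"
  let ?s = "weighted_int U (\<lambda>t. exp (- (Re \<zeta> * t)) * sin (Im \<zeta> * t))"
  have zero: "?c 0 x = 0" "?s 0 x = 0" "?c y' 0 = 0" "?s y' 0 = 0" for x y'
    using weighted_int_lin_left[OF U weight_cos \<zeta>, of "Im \<zeta>" 0 0 0 0] weighted_int_lin_left[OF U weight_sin \<zeta>, of "Im \<zeta>" 0 0 0 0]
      weighted_int_lin_right[OF U weight_cos \<zeta>, of "Im \<zeta>" _ 0 0 0 0] weighted_int_lin_right[OF U weight_sin \<zeta>, of "Im \<zeta>" _ 0 0 0 0]
    by simp_all
  obtain z where z: "\<And>u'. complexify p u' z = complex_twin_laplace U \<zeta> u' (y, 0)"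
    using ct unfolding complex_twin_operator_def by blast
  have "Complex (p y' (fst z)) (p y' (snd z)) = Complex (?c y' y) (- ?s y' y)" for y'
  proof -
    have "Complex (p y' (fst z)) (p y' (snd z)) = complexify p (y', 0) z"
      by (simp add: complexify_def p.zero_left)
    also have "\<dots> = complexify ?c (y', 0) (y, 0) - \<i> * complexify ?s (y', 0) (y, 0)"
      unfolding z by (rule complex_twin_laplace_eq[OF U \<zeta>])
    also have "\<dots> = Complex (?c y' y) (- ?s y' y)"
      by (simp add: complexify_def complex_eq_iff zero)
    finally show ?thesis .
  qed
  then have "p y' (fst z) = ?c y' y" "p y' (- snd z) = ?s y' y" for y'
    by (simp_all add: p.minus_right)
  then show "right_rep (\<lambda>y'. ?c y' y)" "right_rep (\<lambda>y'. ?s y' y)"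
    unfolding right_rep_def by blast+
qed

end

section \<open>The resolvent identity and the perturbed semigroup\<close>

lemma integrable_lborel_bdd_borel:
  assumes "bdd_borel T g"
  shows "integrable lborel (\<lambda>u. indicator {0..} u * g u)"
proof -
  obtain B where B: "g \<in> borel_measurable borel" "\<And>x. 0 \<le> x \<Longrightarrow> \<bar>g x\<bar> \<le> B"
      "\<And>x. x > T \<Longrightarrow> g x = 0" "0 \<le> B"
    by (rule bdd_borelE[OF assms]) (rule that; assumption)
  note B(1)[measurable]
  show ?thesis
  proof (rule Bochner_Integration.integrable_bound)
    show "integrable lborel (\<lambda>u. B * indicator {0..T} u :: real)"
      by (intro integrable_mult_right integrable_real_indicator) (auto simp: emeasure_lborel_Icc_eq)
    show "AE u in lborel. norm (indicator {0..} u * g u) \<le> norm (B * indicator {0..T} u :: real)"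
      using B by (intro AE_I2) (auto simp: indicator_def)
  qed measurable
qed

context norming_pair
begin

lemma exp_family_mono:
  assumes "exp_family U M \<omega>" "M \<le> M'" "\<omega> \<le> \<omega>'"
  shows "exp_family U M' \<omega>'"
proof -
  have "M * exp (\<omega> * t) * norm y * norm y' \<le> M' * exp (\<omega>' * t) * norm y * norm y'"
    if "0 \<le> t" for t and y :: 'a and y' :: 'b
    using assms that M_nonneg[OF assms(1)]
    by (intro mult_right_mono mult_mono) (auto intro: mult_right_mono)
  moreover have "0 \<le> M'"
    using assms(2) M_nonneg[OF assms(1)] by simp
  ultimately show ?thesis
    using assms(1) unfolding exp_family_def by (meson order_trans)
qed

text \<open>With \<open>y'U(t)U(s)y = y'U(t + s)y\<close> the left side is a double integral over \<open>t\<close> and \<open>x = t + s\<close>;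
  integrating over \<open>t \<in> [0, x]\<close> first gives \<open>(exp (- \<mu> x) - exp (- \<kappa> x)) / (\<kappa> - \<mu>)\<close>. Factoring
  out \<open>exp (- \<omega> x)\<close> bounds the integrand by a convolution of integrable functions.\<close>

lemma resolvent_identity:
  assumes U: "twin_semigroup_bound p U M \<omega>" and \<kappa>: "\<omega> < \<kappa>" and \<mu>: "\<omega> < \<mu>" and "\<kappa> \<noteq> \<mu>"
    and z: "\<And>y'. p y' z = weighted_int U (\<lambda>t. exp (- (\<mu> * t))) y' y"
  shows "weighted_int U (\<lambda>t. exp (- (\<kappa> * t))) y' z =
    (weighted_int U (\<lambda>t. exp (- (\<mu> * t))) y' y - weighted_int U (\<lambda>t. exp (- (\<kappa> * t))) y' y) / (\<kappa> - \<mu>)"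
proof -
  note E = exp_family_semigroup[OF U]
  define a where "a t = indicator {0..} t * exp (- ((\<kappa> - \<omega>) * t))" for t :: real
  define b where "b t = indicator {0..} t * exp (- ((\<mu> - \<omega>) * t))" for t :: real
  define F where "F x = indicator {0..} x * U x y' y" for x
  define G where "G x = exp (- (\<omega> * x)) * F x" for x
  define C where "C = M * norm y * norm y'"
  have [measurable]: "F \<in> borel_measurable borel" "G \<in> borel_measurable borel"
    using U_measurable[OF E, of y' y] by (auto simp: F_def[abs_def] G_def[abs_def])
  have [measurable]: "a \<in> borel_measurable borel" "b \<in> borel_measurable borel"
    unfolding a_def[abs_def] b_def[abs_def] by measurable
  have intab: "integrable lborel a" "integrable lborel b"
    unfolding a_def[abs_def] b_def[abs_def] using \<kappa> \<mu> by (auto intro!: exp_half_line)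
  have "0 \<le> C"
    using M_nonneg[OF E] by (simp add: C_def)
  have G_bound: "\<bar>G x\<bar> \<le> C" for x
  proof (cases "0 \<le> x")
    case True
    have "\<bar>G x\<bar> \<le> exp (- (\<omega> * x)) * (M * exp (\<omega> * x) * norm y * norm y')"
      using U_bound[OF E True, of y' y] True by (simp add: G_def F_def abs_mult)
    also have "\<dots> = C"
      by (simp add: C_def mult.assoc[symmetric] flip: exp_add)
    finally show ?thesis .
  qed (use \<open>0 \<le> C\<close> in \<open>simp add: G_def F_def\<close>)
  have "integrable (lborel \<Otimes>\<^sub>M lborel) (\<lambda>z. C * (case z of (t, x) \<Rightarrow> b (x - t) * a t))"
    by (intro integrable_mult_right L1_convolution(1) intab)
  then have int: "integrable (lborel \<Otimes>\<^sub>M lborel) (\<lambda>(t, x). b (x - t) * a t * G x)"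
  proof (rule Bochner_Integration.integrable_bound)
    show "AE z in lborel \<Otimes>\<^sub>M lborel. norm (case z of (t, x) \<Rightarrow> b (x - t) * a t * G x) \<le>
        norm (C * (case z of (t, x) \<Rightarrow> b (x - t) * a t))"
    proof (intro AE_I2, clarify)
      fix t x :: real
      have "\<bar>b (x - t) * a t\<bar> * \<bar>G x\<bar> \<le> \<bar>b (x - t) * a t\<bar> * C"
        by (intro mult_left_mono G_bound) simp
      then show "norm (b (x - t) * a t * G x) \<le> norm (C * (b (x - t) * a t))"
        using \<open>0 \<le> C\<close> by (simp add: abs_mult ac_simps)
    qed
  qed measurable
  have inner: "indicator {0..} t * (exp (- (\<kappa> * t)) * U t y' z) = (\<integral>x. b (x - t) * a t * G x \<partial>lborel)" for t
  proof (cases "0 \<le> t")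
    case True
    have "U t y' z = p (twin_left p (U t) y') z"
      by (rule pairing_twin_left[OF U_twin[OF E True], symmetric])
    also have "\<dots> = (\<integral>s. indicator {0..} s * (exp (- (\<mu> * s)) * U s (twin_left p (U t) y') y) \<partial>lborel)"
      unfolding z weighted_int_def ..
    also have "\<dots> = (\<integral>s. indicator {0..} s * (exp (- (\<mu> * s)) * F (t + s)) \<partial>lborel)"
    proof (intro Bochner_Integration.integral_cong refl)
      fix s :: real
      have "U s (twin_left p (U t) y') y = F (t + s)" if "0 \<le> s"
      proof -
        have "U (t + s) = twin_comp p (U t) (U s)"
          using U True that by (simp add: twin_semigroup_bound_def)
        then show ?thesis
          using True that twin_comp_eq(2)[OF U_twin[OF E True] U_twin[OF E that]] by (simp add: F_def)
      qed
      then show "indicator {0..} s * (exp (- (\<mu> * s)) * U s (twin_left p (U t) y') y) =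
          indicator {0..} s * (exp (- (\<mu> * s)) * F (t + s))"
        by (auto simp: indicator_def)
    qed
    also have "\<dots> = (\<integral>x. indicator {0..} (x - t) * (exp (- (\<mu> * (x - t))) * F x) \<partial>lborel)"
      using lborel_integral_real_affine[of 1 "\<lambda>x. indicator {0..} (x - t) * (exp (- (\<mu> * (x - t))) * F x)" t]
      by simp
    finally have "indicator {0..} t * (exp (- (\<kappa> * t)) * U t y' z) =
        (\<integral>x. exp (- (\<kappa> * t)) * (indicator {0..} (x - t) * (exp (- (\<mu> * (x - t))) * F x)) \<partial>lborel)"
      using True by simp
    also have "\<dots> = (\<integral>x. b (x - t) * a t * G x \<partial>lborel)"
    proof (intro Bochner_Integration.integral_cong refl)
      fix x
      have "exp (- ((\<mu> - \<omega>) * (x - t))) * exp (- ((\<kappa> - \<omega>) * t)) * exp (- (\<omega> * x)) =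
          exp (- (\<kappa> * t)) * exp (- (\<mu> * (x - t)))"
        by (simp add: algebra_simps flip: exp_add)
      then show "exp (- (\<kappa> * t)) * (indicator {0..} (x - t) * (exp (- (\<mu> * (x - t))) * F x)) = b (x - t) * a t * G x"
        using True by (simp add: a_def b_def G_def ac_simps)
    qed
    finally show ?thesis .
  qed (simp add: a_def)
  have outer: "(\<integral>t. b (x - t) * a t * G x \<partial>lborel) =
      (indicator {0..} x * (exp (- (\<mu> * x)) * U x y' y) - indicator {0..} x * (exp (- (\<kappa> * x)) * U x y' y)) / (\<kappa> - \<mu>)" for x
  proof (cases "0 \<le> x")
    case True
    define H where "H t = - exp (- ((\<mu> - \<omega>) * x) - (\<kappa> - \<mu>) * t) / (\<kappa> - \<mu>)" for t
    have "b (x - t) * a t = indicator {0..x} t *\<^sub>R exp (- ((\<mu> - \<omega>) * x) - (\<kappa> - \<mu>) * t)" for t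
      by (auto simp: a_def b_def indicator_def algebra_simps simp flip: exp_add)
    then have "(\<integral>t. b (x - t) * a t \<partial>lborel) = (\<integral>t. indicator {0..x} t *\<^sub>R exp (- ((\<mu> - \<omega>) * x) - (\<kappa> - \<mu>) * t) \<partial>lborel)"
      by simp
    also have "\<dots> = H x - H 0"
    proof (rule integral_FTC_atLeastAtMost[OF True])
      fix t
      have "((\<lambda>t. - exp (c - d * t) / d) has_real_derivative exp (c - d * t)) (at t within {0..x})"
        if "d \<noteq> 0" for c d :: real
        using that by (auto intro!: derivative_eq_intros)
      then have "(H has_real_derivative exp (- ((\<mu> - \<omega>) * x) - (\<kappa> - \<mu>) * t)) (at t within {0..x})"
        unfolding H_def[abs_def] using \<open>\<kappa> \<noteq> \<mu>\<close> by simp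
      then show "(H has_vector_derivative exp (- ((\<mu> - \<omega>) * x) - (\<kappa> - \<mu>) * t)) (at t within {0..x})"
        by (simp add: has_real_derivative_iff_has_vector_derivative)
    qed (intro continuous_intros)
    also have "\<dots> = (exp (- ((\<mu> - \<omega>) * x)) - exp (- ((\<kappa> - \<omega>) * x))) / (\<kappa> - \<mu>)"
      by (simp add: H_def diff_divide_distrib algebra_simps)
    finally have "(\<integral>t. b (x - t) * a t * G x \<partial>lborel) =
        (exp (- ((\<mu> - \<omega>) * x)) - exp (- ((\<kappa> - \<omega>) * x))) / (\<kappa> - \<mu>) * G x"
      by simp
    moreover have "exp (- ((\<mu> - \<omega>) * x)) * G x = exp (- (\<mu> * x)) * F x"
      "exp (- ((\<kappa> - \<omega>) * x)) * G x = exp (- (\<kappa> * x)) * F x"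
      by (simp_all add: G_def mult.assoc[symmetric] algebra_simps flip: exp_add)
    ultimately show ?thesis
      using True by (simp add: left_diff_distrib F_def)
  qed (simp add: G_def F_def)
  have "weighted_int U (\<lambda>t. exp (- (\<kappa> * t))) y' z = (\<integral>t. (\<integral>x. b (x - t) * a t * G x \<partial>lborel) \<partial>lborel)"
    unfolding weighted_int_def inner ..
  also have "\<dots> = (\<integral>x. (\<integral>t. b (x - t) * a t * G x \<partial>lborel) \<partial>lborel)"
    using lborel_pair.Fubini_integral[of "\<lambda>t x. b (x - t) * a t * G x"] int by simp
  also have "\<dots> = (weighted_int U (\<lambda>t. exp (- (\<mu> * t))) y' y - weighted_int U (\<lambda>t. exp (- (\<kappa> * t))) y' y) / (\<kappa> - \<mu>)"
    unfolding outer weighted_int_def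
    using weighted_int_integrable[OF E weight_exp \<mu>, of y' y] weighted_int_integrable[OF E weight_exp \<kappa>, of y' y] by simp
  finally show ?thesis .
qed

end

context twin_perturbation
begin

lemma exp_family_S0: "exp_family S\<^sub>0 M\<^sub>0 \<omega>\<^sub>0"
  by (rule exp_family_semigroup[OF semigroup])

lemma common_growth:
  obtains M \<omega> where "1 \<le> M" "0 \<le> \<omega>" "\<omega>\<^sub>0 \<le> \<omega>" "exp_family S\<^sub>0 M \<omega>" "exp_family S M \<omega>"
proof -
  obtain M' \<omega>' where M': "1 \<le> M'" "0 \<le> \<omega>'"
    and bound: "\<And>t y' y. 0 \<le> t \<Longrightarrow> \<bar>S t y' y\<bar> \<le> M' * exp (\<omega>' * t) * norm y * norm y'"
    by (rule S_exponential_bound) (rule that; assumption)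
  have "exp_family S M' \<omega>'"
    unfolding exp_family_def using S_twin S_measurable bound M' by auto
  then have "exp_family S (max M\<^sub>0 M') (max \<omega>\<^sub>0 \<omega>')"
    by (rule exp_family_mono) auto
  moreover have "exp_family S\<^sub>0 (max M\<^sub>0 M') (max \<omega>\<^sub>0 \<omega>')"
    by (rule exp_family_mono[OF exp_family_S0]) auto
  ultimately show ?thesis
    using M' by (intro that[of "max M\<^sub>0 M'" "max \<omega>\<^sub>0 \<omega>'"]) auto
qed

lemma S_minus_S0: "S t y' y - S\<^sub>0 t y' y = (\<Sum>j\<in>UNIV. conv (W y' j) (v y j) t)"
  by (simp add: S_def)

text \<open>The transform of \<open>S\<^sub>0\<close> is represented by assumption. For the difference, Fubini turns the
  transform over \<open>[0, n]\<close> into an integral against \<open>y'W\<close>, which is represented; then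
  \<open>n \<rightarrow> \<infinity>\<close>.\<close>

lemma right_rep_weighted_int_S:
  assumes S0: "exp_family S\<^sub>0 M \<omega>" and S: "exp_family S M \<omega>" and f: "weight a f" "\<omega> < a"
    and rep: "right_rep (\<lambda>y'. weighted_int S\<^sub>0 f y' y)"
  shows "right_rep (\<lambda>y'. weighted_int S f y' y)"
proof -
  define D where "D y' t = (\<Sum>j\<in>UNIV. conv (W y' j) (v y j) t)" for y' t
  define h where "h n j \<tau> u = indicator {..real n} u * f u * v y j (u - \<tau>)" for n j \<tau> and u :: real
  have [measurable]: "f \<in> borel_measurable borel"
    using f by (simp add: weight_def)
  have f_bound: "\<bar>f u\<bar> \<le> exp (\<bar>a\<bar> * T)" if "0 \<le> u" "u \<le> T" for u T
  proof -
    have "- (a * u) \<le> \<bar>a\<bar> * u"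
      using that(1) by (metis abs_ge_minus_self mult_minus_left mult_right_mono)
    also have "\<dots> \<le> \<bar>a\<bar> * T"
      using that by (intro mult_left_mono) auto
    finally have "exp (- (a * u)) \<le> exp (\<bar>a\<bar> * T)"
      by simp
    then show ?thesis
      using f(1) that(1) by (auto simp: weight_def intro: order_trans)
  qed
  have h: "bdd_borel2 (real n + 1) (h n j)" for n j
  proof -
    have [measurable]: "v y j \<in> borel_measurable borel"
      by (rule causalD[OF causal_v])
    obtain B where B: "0 \<le> B" "\<forall>s\<le>real n. \<bar>v y j s\<bar> \<le> B" by (rule causal_boundE[OF causal_v])
    show ?thesis
    proof (rule bdd_borel2I)
      show "case_prod (h n j) \<in> borel_measurable (borel \<Otimes>\<^sub>M borel)"
        unfolding h_def by measurable
      show "\<bar>h n j \<tau> u\<bar> \<le> exp (\<bar>a\<bar> * real n) * B" if "0 \<le> \<tau>" "0 \<le> u" for \<tau> u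
      proof (cases "u \<le> real n")
        case True
        then have "\<bar>f u\<bar> * \<bar>v y j (u - \<tau>)\<bar> \<le> exp (\<bar>a\<bar> * real n) * B"
          using that B by (intro mult_mono f_bound) auto
        then show ?thesis
          using True by (simp add: h_def abs_mult)
      qed (use B(1) in \<open>simp add: h_def\<close>)
      show "h n j \<tau> u = 0" if "0 \<le> \<tau>" "0 \<le> u" "real n + 1 < \<tau> \<or> real n + 1 < u" for \<tau> u
        using that by (cases "u \<le> real n") (auto simp: h_def v_neg)
    qed
  qed
  have approx: "right_rep (\<lambda>y'. \<integral>u. indicator {0..} u * (indicator {..real n} u * (f u * D y' u)) \<partial>lborel)" for n
  proof -
    have int: "integrable lborel (\<lambda>u. indicator {0..} u * nbv_int (W y' j) (\<lambda>\<tau>. h n j \<tau> u))" for j y'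
      by (intro integrable_lborel_bdd_borel[of "real n + 1"] bdd_borel_nbv_int[OF W_NBV] bdd_borel2_swap[OF h]) simp
    have "(\<integral>u. indicator {0..} u * (indicator {..real n} u * (f u * D y' u)) \<partial>lborel) =
        (\<Sum>j\<in>UNIV. nbv_int (W y' j) (\<lambda>\<tau>. \<integral>u. indicator {0..} u * h n j \<tau> u \<partial>lborel))" for y'
    proof -
      have eq: "indicator {0..} u * (indicator {..real n} u * (f u * D y' u)) =
          (\<Sum>j\<in>UNIV. indicator {0..} u * nbv_int (W y' j) (\<lambda>\<tau>. h n j \<tau> u))" for u
        by (simp add: D_def h_def conv_def nbv_int_cmult sum_distrib_left mult.assoc)
      have "(\<integral>u. indicator {0..} u * (indicator {..real n} u * (f u * D y' u)) \<partial>lborel) =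
          (\<Sum>j\<in>UNIV. \<integral>u. indicator {0..} u * nbv_int (W y' j) (\<lambda>\<tau>. h n j \<tau> u) \<partial>lborel)"
        unfolding eq by (rule Bochner_Integration.integral_sum[OF int])
      also have "\<dots> = (\<Sum>j\<in>UNIV. nbv_int (W y' j) (\<lambda>\<tau>. \<integral>u. indicator {0..} u * h n j \<tau> u \<partial>lborel))"
        by (intro sum.cong refl nbv_lborel_Fubini[OF W_NBV h, symmetric]) simp
      finally show ?thesis .
    qed
    moreover have "right_rep (\<lambda>y'. nbv_int (W y' j) (\<lambda>\<tau>. \<integral>u. indicator {0..} u * h n j \<tau> u \<partial>lborel))" for j
      by (rule right_rep_nbv_int_W[OF bdd_borel_parametric_lborel_integral[OF h]]) simp
    ultimately show ?thesis
      by (simp add: right_rep_sum)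
  qed
  have intS: "integrable lborel (\<lambda>t. indicator {0..} t * (f t * S t y' y))"
    and intS0: "integrable lborel (\<lambda>t. indicator {0..} t * (f t * S\<^sub>0 t y' y))" for y'
    using weighted_int_integrable[OF S f] weighted_int_integrable[OF S0 f] by auto
  have diff: "indicator {0..} t * (f t * D y' t) =
      indicator {0..} t * (f t * S t y' y) - indicator {0..} t * (f t * S\<^sub>0 t y' y)" for y' t
    by (simp add: D_def algebra_simps flip: S_minus_S0)
  have intD: "integrable lborel (\<lambda>t. indicator {0..} t * (f t * D y' t))" for y'
    unfolding diff using intS intS0 by auto
  have "(\<lambda>n. \<integral>u. indicator {0..} u * (indicator {..real n} u * (f u * D y' u)) \<partial>lborel)
      \<longlonglongrightarrow> (\<integral>u. indicator {0..} u * (f u * D y' u) \<partial>lborel)" for y'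
  proof (rule integral_dominated_convergence[OF _ _ integrable_norm[OF intD]])
    show "(\<lambda>u. indicator {0..} u * (f u * D y' u)) \<in> borel_measurable lborel"
      using intD by (rule borel_measurable_integrable)
    have "(\<lambda>u. indicator {..real n} u * (indicator {0..} u * (f u * D y' u))) \<in> borel_measurable lborel" for n
      using borel_measurable_integrable[OF intD[of y']] by measurable
    then show "(\<lambda>u. indicator {0..} u * (indicator {..real n} u * (f u * D y' u))) \<in> borel_measurable lborel" for n
      by (simp add: mult.left_commute)
    show "AE u in lborel. (\<lambda>n. indicator {0..} u * (indicator {..real n} u * (f u * D y' u)))
        \<longlonglongrightarrow> indicator {0..} u * (f u * D y' u)"
    proof (intro AE_I2 tendsto_eventually)
      fix u :: real
      obtain n0 :: nat where "u \<le> real n0"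
        using real_arch_simple by blast
      then have "u \<le> real n" if "n0 \<le> n" for n
        using that by (meson of_nat_mono order_trans)
      then show "\<forall>\<^sub>F n in sequentially. indicator {0..} u * (indicator {..real n} u * (f u * D y' u)) =
          indicator {0..} u * (f u * D y' u)"
        by (intro eventually_mono[OF eventually_ge_at_top[of n0]]) simp
    qed
    show "AE u in lborel. norm (indicator {0..} u * (indicator {..real n} u * (f u * D y' u))) \<le>
        norm (indicator {0..} u * (f u * D y' u))" for n
      by (intro AE_I2) (auto simp: indicator_def)
  qed
  then have "right_rep (\<lambda>y'. \<integral>u. indicator {0..} u * (f u * D y' u) \<partial>lborel)"
    by (rule right_rep_limit[OF approx])
  moreover have "(\<integral>u. indicator {0..} u * (f u * D y' u) \<partial>lborel) = weighted_int S f y' y - weighted_int S\<^sub>0 f y' y" for y'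
    unfolding diff weighted_int_def using intS intS0 by simp
  ultimately have "right_rep (\<lambda>y'. (weighted_int S f y' y - weighted_int S\<^sub>0 f y' y) + weighted_int S\<^sub>0 f y' y)"
    using rep by (intro right_rep_add) simp_all
  then show ?thesis by simp
qed

lemma S_semigroup:
  assumes M: "1 \<le> M" and \<omega>: "\<omega>\<^sub>0 \<le> \<omega>" and S0: "exp_family S\<^sub>0 M \<omega>" and S: "exp_family S M \<omega>"
  shows "twin_semigroup_bound p S M \<omega>"
  unfolding twin_semigroup_bound_def
proof (intro conjI allI impI)
  show "(\<lambda>t. S t y' y) \<in> borel_measurable (restrict_space borel {0..})" for y' y
    using S_measurable[of y' y] by (subst borel_measurable_restrict_space_iff) (auto simp: mult.commute)
  show "twin_operator p (twin_laplace S \<zeta>)" if "\<omega> < \<zeta>" for \<zeta>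
  proof -
    have "twin_operator p (twin_laplace S\<^sub>0 \<zeta>)"
      using semigroup that \<omega> by (simp add: twin_semigroup_bound_def)
    then show ?thesis
      unfolding twin_laplace_eq_weighted_int using that
      by (intro weighted_int_twin[OF S weight_exp] right_rep_weighted_int_S[OF S0 S weight_exp] right_rep_twin)
  qed
  show "complex_twin_operator p (complex_twin_laplace S \<zeta>)" if \<zeta>: "\<omega> < Re \<zeta>" for \<zeta>
  proof -
    have "complex_twin_operator p (complex_twin_laplace S\<^sub>0 \<zeta>)"
      using semigroup \<zeta> \<omega> by (simp add: twin_semigroup_bound_def)
    note rep = right_rep_weighted_int_complex[OF S0 \<zeta> this]
    have "complex_twin_laplace S \<zeta> = (\<lambda>u' u.
        complexify (weighted_int S (\<lambda>t. exp (- (Re \<zeta> * t)) * cos (Im \<zeta> * t))) u' u -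
        \<i> * complexify (weighted_int S (\<lambda>t. exp (- (Re \<zeta> * t)) * sin (Im \<zeta> * t))) u' u)"
      by (intro ext complex_twin_laplace_eq[OF S \<zeta>])
    then show ?thesis
      by (simp only:) (intro complex_twin_operatorI weighted_int_twin[OF S weight_cos \<zeta>] weighted_int_twin[OF S weight_sin \<zeta>]
          right_rep_weighted_int_S[OF S0 S weight_cos \<zeta>] right_rep_weighted_int_S[OF S0 S weight_sin \<zeta>] rep)
  qed
  show "\<bar>S t y' y\<bar> \<le> M * exp (\<omega> * t) * norm y * norm y'" if "0 \<le> t" for t y' y
    by (rule U_bound[OF S that])
  show "S 0 = p"
    by (intro ext S_0)
qed (use M S_twin S_twin_comp in auto)

section \<open>The Laplace transform of the perturbed semigroup\<close>

lemma S_q: "0 < t \<Longrightarrow> S t y' (q j) = w y' j t"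
  by (simp add: S_def w_fixed_point w0_pos)

text \<open>Both sides are \<open>y'W\<close> convolved with the antiderivative of \<open>V\<^sub>0 y\<close>. The right side is an ordinary
  convolution of functions, whose Laplace transform is a product.\<close>

lemma integrated_conv:
  "(\<integral>s. indicator {0..} s * (heaviside (t - s) * conv (W y' j) (v y j) s) \<partial>lborel) =
   (\<integral>u. indicator {0..} u * (v y j u * w y' j (t - u)) \<partial>lborel)"
proof -
  define T where "T = max t 1"
  have T: "0 < T" "t \<le> T" by (auto simp: T_def)
  have [measurable]: "v y j \<in> borel_measurable borel" "heaviside \<in> borel_measurable borel"
    using causalD(1)[OF causal_v] causalD(1)[OF causal_heaviside] by auto
  obtain B where B: "0 \<le> B" "\<forall>s\<le>t. \<bar>v y j s\<bar> \<le> B" by (rule causal_boundE[OF causal_v])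
  define h where "h \<tau> s = heaviside (t - s) * v y j (s - \<tau>)" for \<tau> s
  define k where "k \<tau> u = v y j u * heaviside (t - u - \<tau>)" for \<tau> u
  have h: "bdd_borel2 T h"
  proof (rule bdd_borel2I)
    show "case_prod h \<in> borel_measurable (borel \<Otimes>\<^sub>M borel)"
      unfolding h_def by measurable
    show "\<bar>h \<tau> s\<bar> \<le> B" if "0 \<le> \<tau>" "0 \<le> s" for \<tau> s
      using B that by (auto simp: h_def heaviside_def indicator_def)
    show "h \<tau> s = 0" if "0 \<le> \<tau>" "0 \<le> s" "T < \<tau> \<or> T < s" for \<tau> s
      using T that by (auto simp: h_def heaviside_def indicator_def v_neg)
  qed
  have k: "bdd_borel2 T k"
  proof (rule bdd_borel2I)
    show "case_prod k \<in> borel_measurable (borel \<Otimes>\<^sub>M borel)"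
      unfolding k_def by measurable
    show "\<bar>k \<tau> u\<bar> \<le> B" if "0 \<le> \<tau>" "0 \<le> u" for \<tau> u
      using B that by (auto simp: k_def heaviside_def indicator_def)
    show "k \<tau> u = 0" if "0 \<le> \<tau>" "0 \<le> u" "T < \<tau> \<or> T < u" for \<tau> u
      using T that by (auto simp: k_def heaviside_def indicator_def)
  qed
  have inner: "(\<integral>s. indicator {0..} s * h \<tau> s \<partial>lborel) = (\<integral>u. indicator {0..} u * k \<tau> u \<partial>lborel)" if "0 \<le> \<tau>" for \<tau>
  proof -
    have "(\<integral>s. indicator {0..} s * h \<tau> s \<partial>lborel) = (\<integral>u. indicator {0..} (\<tau> + u) * h \<tau> (\<tau> + u) \<partial>lborel)"
      using lborel_integral_real_affine[of 1 "\<lambda>s. indicator {0..} s * h \<tau> s" \<tau>] by simp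
    also have "\<dots> = (\<integral>u. indicator {0..} u * k \<tau> u \<partial>lborel)"
    proof (intro Bochner_Integration.integral_cong refl)
      show "indicator {0..} (\<tau> + u) * h \<tau> (\<tau> + u) = indicator {0..} u * k \<tau> u" for u
        using that by (cases "u < 0") (auto simp: h_def k_def v_neg algebra_simps)
    qed
    finally show ?thesis .
  qed
  have "(\<integral>s. indicator {0..} s * (heaviside (t - s) * conv (W y' j) (v y j) s) \<partial>lborel) =
      (\<integral>s. indicator {0..} s * nbv_int (W y' j) (\<lambda>\<tau>. h \<tau> s) \<partial>lborel)"
    by (simp add: h_def nbv_int_cmult conv_def)
  also have "\<dots> = nbv_int (W y' j) (\<lambda>\<tau>. \<integral>s. indicator {0..} s * h \<tau> s \<partial>lborel)"
    by (rule nbv_lborel_Fubini[OF W_NBV h T(1), symmetric])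
  also have "\<dots> = nbv_int (W y' j) (\<lambda>\<tau>. \<integral>u. indicator {0..} u * k \<tau> u \<partial>lborel)"
    by (rule nbv_int_cong[OF W_NBV bdd_borel_measurable[OF bdd_borel_parametric_lborel_integral[OF h T(1)]]
          bdd_borel_measurable[OF bdd_borel_parametric_lborel_integral[OF k T(1)]] inner])
  also have "\<dots> = (\<integral>u. indicator {0..} u * nbv_int (W y' j) (\<lambda>\<tau>. k \<tau> u) \<partial>lborel)"
    by (rule nbv_lborel_Fubini[OF W_NBV k T(1)])
  also have "\<dots> = (\<integral>u. indicator {0..} u * (v y j u * w y' j (t - u)) \<partial>lborel)"
    using conv_heaviside[OF W_NBV[of y' j]]
    by (simp add: k_def nbv_int_cmult ext_W conv_def fun_eq_iff)
  finally show ?thesis .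
qed

text \<open>Take Laplace transforms in \<open>integrated_conv\<close>: the left side gives the transform of \<open>S - S\<^sub>0\<close>
  divided by \<open>\<zeta>\<close>, the right side the product of the transforms of \<open>w = S(\<cdot>)q\<close> and \<open>V\<^sub>0 y\<close>.\<close>

lemma laplace_S:
  assumes S0: "exp_family S\<^sub>0 M \<omega>" and S: "exp_family S M \<omega>" and "0 \<le> \<omega>" and \<zeta>: "\<omega> < \<zeta>"
  defines "e \<equiv> \<lambda>t. exp (- (\<zeta> * t))"
  shows "weighted_int S e y' y = weighted_int S\<^sub>0 e y' y +
    (\<Sum>j\<in>UNIV. weighted_int S e y' (q j) * (\<zeta> * weighted_int S\<^sub>0 e (Q j) y - p (Q j) y))"
proof -
  have "0 < \<zeta>" using assms by simp
  have we: "weight \<zeta> e"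
    unfolding e_def by (rule weight_exp)
  have e_add: "e (t - u) * e u = e t" for t u
    by (simp add: e_def algebra_simps flip: exp_add)
  define D where "D t = (\<Sum>j\<in>UNIV. conv (W y' j) (v y j) t)" for t
  define f1 where "f1 t = indicator {0..} t * e t" for t
  define g1 where "g1 t = indicator {0..} t * (e t * D t)" for t
  define f2 where "f2 j t = e t * w y' j t" for j t
  define g2 where "g2 j t = e t * v y j t" for j t
  note iS = weighted_int_integrable[OF S we \<zeta>] and iS0 = weighted_int_integrable[OF S0 we \<zeta>]
  have f1: "integrable lborel f1" "(\<integral>t. f1 t \<partial>lborel) = 1 / \<zeta>"
    using exp_half_line[OF \<open>0 < \<zeta>\<close>] by (simp_all add: f1_def[abs_def] e_def)
  have g1: "integrable lborel g1" "(\<integral>t. g1 t \<partial>lborel) = weighted_int S e y' y - weighted_int S\<^sub>0 e y' y"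
  proof -
    have eq: "g1 = (\<lambda>t. indicator {0..} t * (e t * S t y' y) - indicator {0..} t * (e t * S\<^sub>0 t y' y))"
      by (rule ext) (simp add: g1_def D_def algebra_simps flip: S_minus_S0)
    show "integrable lborel g1" "(\<integral>t. g1 t \<partial>lborel) = weighted_int S e y' y - weighted_int S\<^sub>0 e y' y"
      unfolding eq weighted_int_def using iS[of y' y] iS0[of y' y] by simp_all
  qed
  have f2: "integrable lborel (f2 j)" "(\<integral>t. f2 j t \<partial>lborel) = weighted_int S e y' (q j)" for j
  proof -
    have meas: "f2 j \<in> borel_measurable lborel"
      unfolding f2_def[abs_def] e_def using causalD(1)[OF w_causal] by simp
    have "AE t in lborel. t \<noteq> (0::real)"
      by (rule AE_lborel_singleton)
    then have ae: "AE t in lborel. indicator {0..} t * (e t * S t y' (q j)) = f2 j t"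
    proof eventually_elim
      case (elim t)
      show ?case
        using elim S_q[of t y' j] causalD(2)[OF w_causal, of t y' j] by (cases "t < 0") (auto simp: f2_def)
    qed
    show "integrable lborel (f2 j)"
      by (rule integrable_cong_AE_imp[OF iS meas ae])
    show "(\<integral>t. f2 j t \<partial>lborel) = weighted_int S e y' (q j)"
      unfolding weighted_int_def
      by (rule integral_cong_AE[OF borel_measurable_integrable[OF iS] meas ae, symmetric])
  qed
  have g2: "integrable lborel (g2 j)" "(\<integral>t. g2 j t \<partial>lborel) = weighted_int S\<^sub>0 e (Q j) y - p (Q j) y / \<zeta>" for j
  proof -
    have eq: "g2 j = (\<lambda>t. indicator {0..} t * (e t * S\<^sub>0 t (Q j) y) - p (Q j) y * f1 t)"
      by (auto simp: g2_def v_def f1_def fun_eq_iff algebra_simps indicator_def)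
    show "integrable lborel (g2 j)" "(\<integral>t. g2 j t \<partial>lborel) = weighted_int S\<^sub>0 e (Q j) y - p (Q j) y / \<zeta>"
      unfolding eq using iS0[of "Q j" y] f1 by (simp_all add: weighted_int_def)
  qed
  have conv_eq: "(\<integral>u. f1 (t - u) * g1 u \<partial>lborel) = (\<Sum>j\<in>UNIV. \<integral>u. f2 j (t - u) * g2 j u \<partial>lborel)" for t
  proof -
    have int: "integrable lborel (\<lambda>s. indicator {0..} s * (heaviside (t - s) * conv (W y' j) (v y j) s))" for j
    proof (rule integrable_lborel_bdd_borel[of t])
      obtain B where B: "0 \<le> B" "\<forall>s\<le>t. \<bar>conv (W y' j) (v y j) s\<bar> \<le> B"
        by (rule causal_boundE[OF causal_conv[OF W_NBV causal_v]])
      have [measurable]: "conv (W y' j) (v y j) \<in> borel_measurable borel" "heaviside \<in> borel_measurable borel"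
        using causalD(1)[OF causal_conv[OF W_NBV causal_v]] causalD(1)[OF causal_heaviside] by auto
      show "bdd_borel t (\<lambda>s. heaviside (t - s) * conv (W y' j) (v y j) s)"
        using B by (intro bdd_borelI[where B = B]) (auto simp: heaviside_def indicator_def)
    qed
    have "(\<integral>u. f1 (t - u) * g1 u \<partial>lborel) =
        (\<integral>u. e t * (\<Sum>j\<in>UNIV. indicator {0..} u * (heaviside (t - u) * conv (W y' j) (v y j) u)) \<partial>lborel)"
    proof (intro Bochner_Integration.integral_cong refl)
      fix u
      have "f1 (t - u) * g1 u = (e (t - u) * e u) * (indicator {0..} u * (heaviside (t - u) * D u))"
        by (simp add: f1_def g1_def heaviside_def ac_simps)
      then show "f1 (t - u) * g1 u = e t * (\<Sum>j\<in>UNIV. indicator {0..} u * (heaviside (t - u) * conv (W y' j) (v y j) u))"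
        unfolding e_add by (simp add: D_def sum_distrib_left)
    qed
    also have "\<dots> = e t * (\<integral>u. (\<Sum>j\<in>UNIV. indicator {0..} u * (heaviside (t - u) * conv (W y' j) (v y j) u)) \<partial>lborel)"
      by (rule integral_mult_right_zero)
    also have "(\<integral>u. (\<Sum>j\<in>UNIV. indicator {0..} u * (heaviside (t - u) * conv (W y' j) (v y j) u)) \<partial>lborel) =
        (\<Sum>j\<in>UNIV. \<integral>u. indicator {0..} u * (heaviside (t - u) * conv (W y' j) (v y j) u) \<partial>lborel)"
      by (rule Bochner_Integration.integral_sum[OF int])
    also have "\<dots> = (\<Sum>j\<in>UNIV. \<integral>u. indicator {0..} u * (v y j u * w y' j (t - u)) \<partial>lborel)"
      by (intro sum.cong refl integrated_conv)
    also have "e t * \<dots> = (\<Sum>j\<in>UNIV. \<integral>u. e t * (indicator {0..} u * (v y j u * w y' j (t - u))) \<partial>lborel)"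
      by (simp add: sum_distrib_left)
    also have "\<dots> = (\<Sum>j\<in>UNIV. \<integral>u. f2 j (t - u) * g2 j u \<partial>lborel)"
    proof (intro sum.cong Bochner_Integration.integral_cong refl)
      fix j u
      have "f2 j (t - u) * g2 j u = (e (t - u) * e u) * (v y j u * w y' j (t - u))"
        by (simp add: f2_def g2_def ac_simps)
      then show "e t * (indicator {0..} u * (v y j u * w y' j (t - u))) = f2 j (t - u) * g2 j u"
        unfolding e_add by (cases "u < 0") (auto simp: v_neg)
    qed
    finally show ?thesis .
  qed
  have int2: "integrable lborel (\<lambda>t. \<integral>u. f2 j (t - u) * g2 j u \<partial>lborel)" for j
    using lborel_pair.integrable_snd[of "\<lambda>u t. f2 j (t - u) * g2 j u"] L1_convolution(1)[OF f2(1) g2(1)] by simp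
  have "(1 / \<zeta>) * (weighted_int S e y' y - weighted_int S\<^sub>0 e y' y) = (\<integral>t. (\<integral>u. f1 (t - u) * g1 u \<partial>lborel) \<partial>lborel)"
    using L1_convolution(2)[OF f1(1) g1(1)] f1(2) g1(2) by simp
  also have "\<dots> = (\<Sum>j\<in>UNIV. \<integral>t. (\<integral>u. f2 j (t - u) * g2 j u \<partial>lborel) \<partial>lborel)"
    unfolding conv_eq by (rule Bochner_Integration.integral_sum[OF int2])
  also have "\<dots> = (\<Sum>j\<in>UNIV. weighted_int S e y' (q j) * (weighted_int S\<^sub>0 e (Q j) y - p (Q j) y / \<zeta>))"
    by (intro sum.cong refl) (simp only: L1_convolution(2)[OF f2(1) g2(1)] f2(2) g2(2))
  finally have "weighted_int S e y' y - weighted_int S\<^sub>0 e y' y =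
      \<zeta> * (\<Sum>j\<in>UNIV. weighted_int S e y' (q j) * (weighted_int S\<^sub>0 e (Q j) y - p (Q j) y / \<zeta>))"
    using \<open>0 < \<zeta>\<close> by (simp add: field_simps)
  also have "\<dots> = (\<Sum>j\<in>UNIV. weighted_int S e y' (q j) * (\<zeta> * weighted_int S\<^sub>0 e (Q j) y - p (Q j) y))"
    unfolding sum_distrib_left using \<open>0 < \<zeta>\<close> by (intro sum.cong refl) (simp add: field_simps)
  finally show ?thesis by simp
qed

text \<open>The Laplace--Stieltjes transform of \<open>K j i\<close>.\<close>

definition \<kappa> :: "real \<Rightarrow> 'n \<Rightarrow> 'n \<Rightarrow> real" where
  "\<kappa> \<zeta> j i = \<zeta> * weighted_int S\<^sub>0 (\<lambda>t. exp (- (\<zeta> * t))) (Q j) (q i) - p (Q j) (q i)"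

text \<open>Substituting \<open>t = s / \<zeta>\<close> gives \<open>\<kappa> \<zeta> j i = \<integral> exp (- s) k(s / \<zeta>) ds\<close>, and \<open>k(0+) = 0\<close>.\<close>

lemma kappa_tendsto_0: "((\<lambda>\<zeta>. \<kappa> \<zeta> j i) \<longlongrightarrow> 0) at_top"
proof -
  define C where "C = M\<^sub>0 * norm (q i) * norm (Q j) + norm (Q j) * norm (q i)"
  have C: "0 \<le> C" using M0_ge_1 by (simp add: C_def)
  have v_exp: "\<bar>v (q i) j t\<bar> \<le> C * exp (\<bar>\<omega>\<^sub>0\<bar> * t)" if "0 \<le> t" for t
  proof -
    have "\<bar>S\<^sub>0 t (Q j) (q i)\<bar> \<le> M\<^sub>0 * exp (\<bar>\<omega>\<^sub>0\<bar> * t) * norm (q i) * norm (Q j)"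
      by (rule S0_bound_upto[OF that order_refl])
    moreover have "\<bar>p (Q j) (q i)\<bar> \<le> norm (Q j) * norm (q i) * exp (\<bar>\<omega>\<^sub>0\<bar> * t)"
    proof -
      have "norm (Q j) * norm (q i) * 1 \<le> norm (Q j) * norm (q i) * exp (\<bar>\<omega>\<^sub>0\<bar> * t)"
        using that by (intro mult_left_mono) auto
      then show ?thesis
        using pairing_bound[of "Q j" "q i"] by linarith
    qed
    ultimately show ?thesis
      using that by (simp add: v_nonneg C_def algebra_simps)
  qed
  have [measurable]: "v (q i) j \<in> borel_measurable borel"
    by (rule causalD[OF causal_v])
  have v0: "(v (q i) j \<longlongrightarrow> 0) (at_right 0)"
  proof -
    have "(distribution_ext (K j i) \<longlongrightarrow> distribution_ext (K j i) 0) (at_right 0)"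
      using NBV_ext_right_cont[OF K_NBV, of 0] by (simp add: continuous_within)
    then show ?thesis
      by (simp add: ext_K v_0)
  qed
  let ?s = "\<lambda>\<zeta> s. indicator {0..} s * (exp (- s) * v (q i) j (s / \<zeta>))"
  have "((\<lambda>\<zeta>. \<integral>s. ?s \<zeta> s \<partial>lborel) \<longlongrightarrow> integral\<^sup>L lborel (\<lambda>_::real. 0)) at_top"
  proof (rule integral_dominated_convergence_at_top[where s = ?s and f = "\<lambda>_. 0" and
        w = "\<lambda>s. C * (indicator {0..} s * exp (- ((1/2) * s)))"])
    show "integrable lborel (\<lambda>s. C * (indicator {0..} s * exp (- ((1/2) * s))))"
      by (intro integrable_mult_right exp_half_line) simp
    show "?s \<zeta> \<in> borel_measurable lborel" for \<zeta>
      by measurable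
    show "AE s in lborel. ((\<lambda>\<zeta>. ?s \<zeta> s) \<longlongrightarrow> 0) at_top"
    proof (intro AE_I2)
      fix s :: real
      show "((\<lambda>\<zeta>. ?s \<zeta> s) \<longlongrightarrow> 0) at_top"
      proof (cases "0 < s")
        case True
        have "((\<lambda>\<zeta>. s / \<zeta>) \<longlongrightarrow> 0) at_top"
          by (intro tendsto_divide_0[OF tendsto_const] filterlim_at_top_imp_at_infinity filterlim_ident)
        moreover have "\<forall>\<^sub>F \<zeta> in at_top. s / \<zeta> \<in> {0<..} \<and> s / \<zeta> \<noteq> 0"
          using eventually_gt_at_top[of 0] by eventually_elim (use True in auto)
        ultimately have "filterlim (\<lambda>\<zeta>. s / \<zeta>) (at_right 0) at_top"
          unfolding filterlim_at by simp
        from filterlim_compose[OF v0 this]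
        have "((\<lambda>\<zeta>. indicator {0..} s * (exp (- s) * v (q i) j (s / \<zeta>))) \<longlongrightarrow> indicator {0..} s * (exp (- s) * 0)) at_top"
          by (intro tendsto_intros)
        then show ?thesis by simp
      next
        case False
        then have "(\<lambda>\<zeta>. ?s \<zeta> s) = (\<lambda>_. 0)"
          by (cases "s = 0") (auto simp: v_0 fun_eq_iff)
        then show ?thesis
          by (simp only: tendsto_const)
      qed
    qed
    show "\<forall>\<^sub>F \<zeta> in at_top. AE s in lborel. norm (?s \<zeta> s) \<le> C * (indicator {0..} s * exp (- ((1/2) * s)))"
    proof (rule eventually_mono[OF eventually_ge_at_top[of "2 * \<bar>\<omega>\<^sub>0\<bar> + 1"]])
      fix \<zeta> :: real assume elim: "2 * \<bar>\<omega>\<^sub>0\<bar> + 1 \<le> \<zeta>"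
      have "norm (?s \<zeta> s) \<le> C * (indicator {0..} s * exp (- ((1/2) * s)))" for s
      proof (cases "0 \<le> s")
        case True
        have "0 < \<zeta>" using elim abs_ge_zero[of \<omega>\<^sub>0] by linarith
        have "(2 * \<bar>\<omega>\<^sub>0\<bar>) * s \<le> \<zeta> * s"
          using elim True by (intro mult_right_mono) auto
        then have "\<bar>\<omega>\<^sub>0\<bar> * (s / \<zeta>) \<le> s / 2"
          using \<open>0 < \<zeta>\<close> by (simp add: field_simps)
        then have "C * exp (\<bar>\<omega>\<^sub>0\<bar> * (s / \<zeta>)) \<le> C * exp (s / 2)"
          using C by (intro mult_left_mono) auto
        then have "\<bar>v (q i) j (s / \<zeta>)\<bar> \<le> C * exp (s / 2)"
          using v_exp[of "s / \<zeta>"] True \<open>0 < \<zeta>\<close> by simp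
        then have "exp (- s) * \<bar>v (q i) j (s / \<zeta>)\<bar> \<le> exp (- s) * (C * exp (s / 2))"
          by (intro mult_left_mono) auto
        also have "\<dots> = C * exp (- ((1/2) * s))"
          by (simp add: mult.left_commute flip: exp_add)
        finally show ?thesis
          using True by (simp add: abs_mult)
      qed simp
      then show "AE s in lborel. norm (?s \<zeta> s) \<le> C * (indicator {0..} s * exp (- ((1/2) * s)))"
        by (intro AE_I2)
    qed
  qed measurable
  then have lim: "((\<lambda>\<zeta>. \<integral>s. ?s \<zeta> s \<partial>lborel) \<longlongrightarrow> 0) at_top"
    by simp
  have "\<forall>\<^sub>F \<zeta> in at_top. (\<integral>s. ?s \<zeta> s \<partial>lborel) = \<kappa> \<zeta> j i"
    using eventually_gt_at_top[of "\<bar>\<omega>\<^sub>0\<bar>"]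
  proof eventually_elim
    case (elim \<zeta>)
    have pos: "0 < \<zeta>" using elim abs_ge_zero[of \<omega>\<^sub>0] by linarith
    have "\<omega>\<^sub>0 < \<zeta>" using elim by linarith
    let ?e = "\<lambda>t. exp (- (\<zeta> * t))"
    have "(\<integral>s. ?s \<zeta> s \<partial>lborel) = \<zeta> * (\<integral>t. ?s \<zeta> (\<zeta> * t) \<partial>lborel)"
      using lborel_integral_real_affine[of \<zeta> "?s \<zeta>" 0] pos by simp
    also have "(\<lambda>t. ?s \<zeta> (\<zeta> * t)) =
        (\<lambda>t. indicator {0..} t * (?e t * S\<^sub>0 t (Q j) (q i)) - p (Q j) (q i) * (indicator {0..} t * ?e t))"
      using pos by (auto simp: fun_eq_iff v_def indicator_def zero_le_mult_iff algebra_simps)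
    also have "\<zeta> * (\<integral>t. indicator {0..} t * (?e t * S\<^sub>0 t (Q j) (q i)) - p (Q j) (q i) * (indicator {0..} t * ?e t) \<partial>lborel) =
        \<zeta> * (weighted_int S\<^sub>0 ?e (Q j) (q i) - p (Q j) (q i) * (1 / \<zeta>))"
      using weighted_int_integrable[OF exp_family_S0 weight_exp \<open>\<omega>\<^sub>0 < \<zeta>\<close>, of "Q j" "q i"] exp_half_line[OF pos]
      by (simp add: weighted_int_def)
    also have "\<dots> = \<kappa> \<zeta> j i"
      using pos by (simp add: \<kappa>_def field_simps)
    finally show ?case .
  qed
  then show ?thesis
    by (rule Lim_transform_eventually[OF lim])
qed

text \<open>Once all entries of \<open>\<kappa>\<close> are below \<open>1 / (2 n)\<close>, the map \<open>1 - \<kappa>\<close> is injective in the sum norm.\<close>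

lemma one_minus_kappa_surj:
  obtains \<zeta>\<^sub>1 where "\<And>\<zeta> d. \<zeta>\<^sub>1 \<le> \<zeta> \<Longrightarrow> \<exists>c. \<forall>j. c j - (\<Sum>i\<in>UNIV. \<kappa> \<zeta> j i * c i) = d j"
proof -
  define \<epsilon> where "\<epsilon> = 1 / (2 * real CARD('n))"
  have "0 < \<epsilon>" by (simp add: \<epsilon>_def)
  have "\<forall>\<^sub>F \<zeta> in at_top. \<bar>\<kappa> \<zeta> j i\<bar> < \<epsilon>" for j i
    using tendstoD[OF kappa_tendsto_0[of j i] \<open>0 < \<epsilon>\<close>] by simp
  then have "\<forall>\<^sub>F \<zeta> in at_top. \<forall>j i. \<bar>\<kappa> \<zeta> j i\<bar> < \<epsilon>"
    by (intro eventually_all_finite)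
  then obtain \<zeta>\<^sub>1 where small: "\<And>\<zeta> j i. \<zeta>\<^sub>1 \<le> \<zeta> \<Longrightarrow> \<bar>\<kappa> \<zeta> j i\<bar> < \<epsilon>"
    unfolding eventually_at_top_linorder by blast
  show ?thesis
  proof (rule that)
    fix \<zeta> and d :: "'n \<Rightarrow> real" assume \<zeta>: "\<zeta>\<^sub>1 \<le> \<zeta>"
    define L :: "real ^ 'n \<Rightarrow> real ^ 'n" where "L c = (\<chi> j. c $ j - (\<Sum>i\<in>UNIV. \<kappa> \<zeta> j i * c $ i))" for c
    have lin: "linear L"
      by (intro linearI) (auto simp: L_def vec_eq_iff algebra_simps sum.distrib sum_distrib_left)
    have "c = 0" if "L c = 0" for c
    proof -
      define s where "s = (\<Sum>i\<in>UNIV. \<bar>c $ i\<bar>)"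
      have "\<bar>c $ j\<bar> \<le> \<epsilon> * s" for j
      proof -
        have "L c $ j = 0"
          by (simp only: that zero_index)
        then have eq: "c $ j = (\<Sum>i\<in>UNIV. \<kappa> \<zeta> j i * c $ i)"
          by (simp only: L_def vec_lambda_beta right_minus_eq)
        have "\<bar>c $ j\<bar> = \<bar>\<Sum>i\<in>UNIV. \<kappa> \<zeta> j i * c $ i\<bar>"
          by (rule arg_cong[OF eq])
        also have "\<dots> \<le> (\<Sum>i\<in>UNIV. \<bar>\<kappa> \<zeta> j i * c $ i\<bar>)"
          by (rule sum_abs)
        also have "\<dots> \<le> (\<Sum>i\<in>UNIV. \<epsilon> * \<bar>c $ i\<bar>)"
          unfolding abs_mult using small[OF \<zeta>] by (intro sum_mono mult_right_mono) (auto intro: less_imp_le)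
        finally show ?thesis
          by (simp add: s_def sum_distrib_left)
      qed
      then have "s \<le> (\<Sum>j\<in>(UNIV :: 'n set). \<epsilon> * s)"
        unfolding s_def by (intro sum_mono)
      then have "s \<le> s / 2"
        by (simp add: \<epsilon>_def)
      moreover have "0 \<le> s"
        unfolding s_def by (intro sum_nonneg) auto
      ultimately have "s = 0" by linarith
      then show ?thesis
        using sum_nonneg_eq_0_iff[of "UNIV :: 'n set" "\<lambda>i. \<bar>c $ i\<bar>"] by (auto simp: s_def vec_eq_iff)
    qed
    then have "inj L"
      using linear_injective_0[OF lin] by blast
    then have "surj L"
      using linear_injective_imp_surjective[OF lin] by simp
    then obtain c where "L c = (\<chi> j. d j)"
      by (metis surjD)
    then show "\<exists>c. \<forall>j. c j - (\<Sum>i\<in>UNIV. \<kappa> \<zeta> j i * c i) = d j"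
      by (intro exI[of _ "\<lambda>i. c $ i"]) (simp add: L_def vec_eq_iff)
  qed
qed

end

section \<open>The generator of the perturbed semigroup\<close>

lemma twin_semigroup_cong:
  assumes eq: "\<And>t. 0 \<le> t \<Longrightarrow> U t = V t"
  shows "twin_semigroup_bound p U M \<omega> = twin_semigroup_bound p V M \<omega>"
    and "twin_generator p U = twin_generator p V"
proof -
  have lap: "twin_laplace U = twin_laplace V"
    unfolding twin_laplace_def fun_eq_iff
    by (intro allI set_lebesgue_integral_cong) (auto simp: eq)
  have clap: "complex_twin_laplace U = complex_twin_laplace V"
    unfolding complex_twin_laplace_def fun_eq_iff
    by (intro allI set_lebesgue_integral_cong) (auto simp: eq)
  have meas: "(\<lambda>t. U t y' y) \<in> borel_measurable (restrict_space borel {0..}) \<longleftrightarrow>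
      (\<lambda>t. V t y' y) \<in> borel_measurable (restrict_space borel {0..})" for y' y
    by (intro measurable_cong) (auto simp: space_restrict_space eq)
  show bound: "twin_semigroup_bound p U M \<omega> = twin_semigroup_bound p V M \<omega>" for M \<omega>
    unfolding twin_semigroup_bound_def lap clap meas by (auto simp: eq)
  show "twin_generator p U = twin_generator p V"
    unfolding twin_generator_def lap bound ..
qed

context norming_pair
begin

lemma twin_right_laplace_eq_iff:
  assumes "twin_semigroup_bound p U M \<omega>" "\<omega> < \<zeta>"
  shows "y = twin_right p (twin_laplace U \<zeta>) x \<longleftrightarrow> (\<forall>y'. p y' y = weighted_int U (\<lambda>t. exp (- (\<zeta> * t))) y' x)"
proof -
  have tw: "twin_operator p (twin_laplace U \<zeta>)"
    using assms by (simp add: twin_semigroup_bound_def)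
  show ?thesis
  proof
    assume "y = twin_right p (twin_laplace U \<zeta>) x"
    then show "\<forall>y'. p y' y = weighted_int U (\<lambda>t. exp (- (\<zeta> * t))) y' x"
      using pairing_twin_right[OF tw] by (simp add: twin_laplace_eq_weighted_int)
  next
    assume "\<forall>y'. p y' y = weighted_int U (\<lambda>t. exp (- (\<zeta> * t))) y' x"
    then show "y = twin_right p (twin_laplace U \<zeta>) x"
      by (intro twin_right_eqI[symmetric]) (simp add: twin_laplace_eq_weighted_int)
  qed
qed

lemma twin_generator_iff:
  "(y, z) \<in> twin_generator p U \<longleftrightarrow>
    (\<exists>M \<omega>. twin_semigroup_bound p U M \<omega> \<and>
      (\<forall>\<zeta>>\<omega>. \<forall>y'. p y' y = weighted_int U (\<lambda>t. exp (- (\<zeta> * t))) y' (\<zeta> *\<^sub>R y - z)))"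
  unfolding twin_generator_def using twin_right_laplace_eq_iff by blast

text \<open>Membership in the generator needs the resolvent equation at every large parameter; by the resolvent
  identity one parameter suffices.\<close>

lemma generator_single_resolvent:
  assumes U: "twin_semigroup_bound p U M \<omega>" and \<lambda>: "\<omega> < l"
    and y: "\<And>y'. p y' y = weighted_int U (\<lambda>t. exp (- (l * t))) y' (l *\<^sub>R y - z)"
  shows "(y, z) \<in> twin_generator p U"
proof -
  note E = exp_family_semigroup[OF U]
  have "p y' y = weighted_int U (\<lambda>t. exp (- (m * t))) y' (m *\<^sub>R y - z)" if m: "\<omega> < m" for m y'
  proof (cases "m = l")
    case False
    let ?u = "l *\<^sub>R y - z"
    have "m *\<^sub>R y - z = 1 *\<^sub>R ?u + (m - l) *\<^sub>R y"
      by (simp add: algebra_simps)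
    then have "weighted_int U (\<lambda>t. exp (- (m * t))) y' (m *\<^sub>R y - z) =
        weighted_int U (\<lambda>t. exp (- (m * t))) y' ?u + (m - l) * weighted_int U (\<lambda>t. exp (- (m * t))) y' y"
      by (simp only: weighted_int_lin_right[OF E weight_exp m] mult_1)
    also have "(m - l) * weighted_int U (\<lambda>t. exp (- (m * t))) y' y =
        weighted_int U (\<lambda>t. exp (- (l * t))) y' ?u - weighted_int U (\<lambda>t. exp (- (m * t))) y' ?u"
      using resolvent_identity[OF U m \<lambda> False y, of y'] False by simp
    finally show ?thesis
      using y[of y'] by simp
  qed (use y in simp)
  then show ?thesis
    unfolding twin_generator_iff using U by blast
qed

end

context twin_perturbation
begin

text \<open>\<open>laplace_S\<close> at the \<open>q i\<close> reads \<open>S\<^sub>0\<^sup>^q = S\<^sup>^q (1 - \<kappa>)\<close> for the transforms.\<close>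

lemma laplace_S_q:
  assumes "exp_family S\<^sub>0 M \<omega>" "exp_family S M \<omega>" "0 \<le> \<omega>" "\<omega> < \<zeta>"
  defines "e \<equiv> \<lambda>t. exp (- (\<zeta> * t))"
  shows "(\<Sum>i\<in>UNIV. c i * weighted_int S\<^sub>0 e y' (q i)) =
    (\<Sum>j\<in>UNIV. weighted_int S e y' (q j) * (c j - (\<Sum>i\<in>UNIV. \<kappa> \<zeta> j i * c i)))"
proof -
  let ?B = "weighted_int S e y'"
  have "weighted_int S\<^sub>0 e y' (q i) = ?B (q i) - (\<Sum>j\<in>UNIV. ?B (q j) * \<kappa> \<zeta> j i)" for i
    using laplace_S[OF assms(1-4), of y' "q i"] by (simp add: \<kappa>_def e_def)
  then have "(\<Sum>i\<in>UNIV. c i * weighted_int S\<^sub>0 e y' (q i)) =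
      (\<Sum>i\<in>UNIV. c i * ?B (q i)) - (\<Sum>i\<in>UNIV. \<Sum>j\<in>UNIV. c i * (?B (q j) * \<kappa> \<zeta> j i))"
    by (simp add: right_diff_distrib sum_subtractf sum_distrib_left)
  also have "(\<Sum>i\<in>UNIV. \<Sum>j\<in>UNIV. c i * (?B (q j) * \<kappa> \<zeta> j i)) =
      (\<Sum>j\<in>UNIV. \<Sum>i\<in>UNIV. c i * (?B (q j) * \<kappa> \<zeta> j i))"
    by (rule sum.swap)
  also have "\<dots> = (\<Sum>j\<in>UNIV. ?B (q j) * (\<Sum>i\<in>UNIV. \<kappa> \<zeta> j i * c i))"
    by (simp add: sum_distrib_left ac_simps)
  finally show ?thesis
    by (simp add: right_diff_distrib sum_subtractf mult.commute)
qed

text \<open>Let \<open>c = Q z\<^sub>0\<close> and \<open>u = \<zeta> y - z\<^sub>0 - q c\<close>. Then \<open>\<zeta> Q S\<^sub>0\<^sup>^u - Q u = (1 - \<kappa>) c\<close>, so the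
  correction in \<open>laplace_S\<close> equals \<open>S\<^sub>0\<^sup>^q c\<close> and restores \<open>y\<close>.\<close>

lemma generator_subset:
  assumes "(y, z\<^sub>0) \<in> twin_generator p S\<^sub>0"
  shows "(y, z\<^sub>0 + (\<Sum>j\<in>UNIV. p (Q j) z\<^sub>0 *\<^sub>R q j)) \<in> twin_generator p S"
proof -
  obtain M\<^sub>1 \<omega>\<^sub>1 where "twin_semigroup_bound p S\<^sub>0 M\<^sub>1 \<omega>\<^sub>1"
    and y: "\<And>\<zeta> y'. \<omega>\<^sub>1 < \<zeta> \<Longrightarrow> p y' y = weighted_int S\<^sub>0 (\<lambda>t. exp (- (\<zeta> * t))) y' (\<zeta> *\<^sub>R y - z\<^sub>0)"
    using assms unfolding twin_generator_iff by blast
  obtain M \<omega> where M: "1 \<le> M" "0 \<le> \<omega>" "\<omega>\<^sub>0 \<le> \<omega>" and S0: "exp_family S\<^sub>0 M \<omega>" and S: "exp_family S M \<omega>"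
    by (rule common_growth) (rule that; assumption)
  define \<zeta> where "\<zeta> = max \<omega> \<omega>\<^sub>1 + 1"
  have \<zeta>: "\<omega> < \<zeta>" "\<omega>\<^sub>1 < \<zeta>" by (auto simp: \<zeta>_def)
  let ?e = "\<lambda>t. exp (- (\<zeta> * t))"
  let ?A = "weighted_int S\<^sub>0 ?e" and ?B = "weighted_int S ?e" and ?c = "\<lambda>i. p (Q i) z\<^sub>0"
  interpret A: bounded_bilinear ?A
  proof (rule twin_operator_bilinear)
    show "twin_operator p ?A"
      using semigroup M(3) \<zeta>(1) by (simp add: twin_semigroup_bound_def flip: twin_laplace_eq_weighted_int)
  qed
  have lap: "?B y' x = ?A y' x + (\<Sum>j\<in>UNIV. ?B y' (q j) * (\<zeta> * ?A (Q j) x - p (Q j) x))" for y' x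
    by (rule laplace_S[OF S0 S M(2) \<zeta>(1)])
  let ?u = "\<zeta> *\<^sub>R y - (z\<^sub>0 + (\<Sum>j\<in>UNIV. ?c j *\<^sub>R q j))"
  have u: "?u = (\<zeta> *\<^sub>R y - z\<^sub>0) - (\<Sum>j\<in>UNIV. ?c j *\<^sub>R q j)"
    by simp
  have Au: "?A y' ?u = p y' y - (\<Sum>i\<in>UNIV. ?c i * ?A y' (q i))" for y'
    unfolding u by (simp only: A.diff_right[of _ "\<zeta> *\<^sub>R y - z\<^sub>0"] A.sum_right A.scaleR_right y[OF \<zeta>(2), symmetric] real_scaleR_def)
  have pu: "p (Q j) ?u = \<zeta> * p (Q j) y - ?c j - (\<Sum>i\<in>UNIV. ?c i * p (Q j) (q i))" for j
    by (simp add: p.diff_right p.add_right p.sum_right p.scaleR_right)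
  have d: "\<zeta> * ?A (Q j) ?u - p (Q j) ?u = ?c j - (\<Sum>i\<in>UNIV. \<kappa> \<zeta> j i * ?c i)" for j
    unfolding Au pu by (simp add: \<kappa>_def algebra_simps sum_subtractf sum_distrib_left)
  have "?B y' ?u = p y' y" for y'
  proof -
    have "?B y' ?u = ?A y' ?u + (\<Sum>j\<in>UNIV. ?B y' (q j) * (?c j - (\<Sum>i\<in>UNIV. \<kappa> \<zeta> j i * ?c i)))"
      using lap[of y' ?u] by (simp only: d)
    then show ?thesis
      using laplace_S_q[OF S0 S M(2) \<zeta>(1), of ?c y'] Au[of y'] by linarith
  qed
  then show ?thesis
    by (intro generator_single_resolvent[OF S_semigroup[OF M(1,3) S0 S] \<zeta>(1)]) simp
qed

text \<open>Solve \<open>(1 - \<kappa>) c = \<zeta> Q S\<^sub>0\<^sup>^u - Q u\<close> for \<open>u = \<zeta> y - z\<close> and put \<open>z\<^sub>0 = z - q c\<close>. Then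
  \<open>S\<^sub>0\<^sup>^(\<zeta> y - z\<^sub>0) = S\<^sup>^u = y\<close>, and pairing with \<open>Q\<close> gives \<open>Q z\<^sub>0 = c\<close>.\<close>

lemma generator_superset:
  assumes "(y, z) \<in> twin_generator p S"
  obtains z\<^sub>0 where "(y, z\<^sub>0) \<in> twin_generator p S\<^sub>0" "z = z\<^sub>0 + (\<Sum>j\<in>UNIV. p (Q j) z\<^sub>0 *\<^sub>R q j)"
proof -
  obtain M\<^sub>1 \<omega>\<^sub>1 where "twin_semigroup_bound p S M\<^sub>1 \<omega>\<^sub>1"
    and y: "\<And>\<zeta> y'. \<omega>\<^sub>1 < \<zeta> \<Longrightarrow> p y' y = weighted_int S (\<lambda>t. exp (- (\<zeta> * t))) y' (\<zeta> *\<^sub>R y - z)"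
    using assms unfolding twin_generator_iff by blast
  obtain M \<omega> where M: "1 \<le> M" "0 \<le> \<omega>" "\<omega>\<^sub>0 \<le> \<omega>" and S0: "exp_family S\<^sub>0 M \<omega>" and S: "exp_family S M \<omega>"
    by (rule common_growth) (rule that; assumption)
  obtain \<zeta>\<^sub>1 where surj: "\<And>\<zeta> d. \<zeta>\<^sub>1 \<le> \<zeta> \<Longrightarrow> \<exists>c. \<forall>j. c j - (\<Sum>i\<in>UNIV. \<kappa> \<zeta> j i * c i) = d j"
    by (rule one_minus_kappa_surj) (rule that; assumption)
  define \<zeta> where "\<zeta> = max (max \<omega> \<omega>\<^sub>1) \<zeta>\<^sub>1 + 1"
  have \<zeta>: "\<omega> < \<zeta>" "\<omega>\<^sub>1 < \<zeta>" "\<zeta>\<^sub>1 \<le> \<zeta>" by (auto simp: \<zeta>_def)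
  have \<zeta>0: "\<omega>\<^sub>0 < \<zeta>" using \<zeta>(1) M(3) by simp
  let ?e = "\<lambda>t. exp (- (\<zeta> * t))"
  let ?A = "weighted_int S\<^sub>0 ?e" and ?B = "weighted_int S ?e"
  interpret A: bounded_bilinear ?A
  proof (rule twin_operator_bilinear)
    show "twin_operator p ?A"
      using semigroup \<zeta>0 by (simp add: twin_semigroup_bound_def flip: twin_laplace_eq_weighted_int)
  qed
  have lap: "?B y' x = ?A y' x + (\<Sum>j\<in>UNIV. ?B y' (q j) * (\<zeta> * ?A (Q j) x - p (Q j) x))" for y' x
    by (rule laplace_S[OF S0 S M(2) \<zeta>(1)])
  define u where "u = \<zeta> *\<^sub>R y - z"
  define d where "d j = \<zeta> * ?A (Q j) u - p (Q j) u" for j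
  obtain c where c: "\<And>j. c j - (\<Sum>i\<in>UNIV. \<kappa> \<zeta> j i * c i) = d j"
    using surj[OF \<zeta>(3), of d] by blast
  define z\<^sub>0 where "z\<^sub>0 = z - (\<Sum>j\<in>UNIV. c j *\<^sub>R q j)"
  have u0: "\<zeta> *\<^sub>R y - z\<^sub>0 = u + (\<Sum>j\<in>UNIV. c j *\<^sub>R q j)"
    by (simp add: z\<^sub>0_def u_def)
  have y0: "p y' y = ?A y' (\<zeta> *\<^sub>R y - z\<^sub>0)" for y'
  proof -
    note laplace_S_q[OF S0 S M(2) \<zeta>(1), of c y']
    then have "?A y' u + (\<Sum>i\<in>UNIV. c i * ?A y' (q i)) = ?B y' u"
      unfolding lap[of y' u] c d_def by simp
    then show ?thesis
      unfolding u0 using y[OF \<zeta>(2), of y'] by (simp add: A.add_right A.sum_right A.scaleR_right u_def)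
  qed
  have "p (Q j) z\<^sub>0 = c j" for j
  proof -
    have A: "?A (Q j) (u + (\<Sum>j\<in>UNIV. c j *\<^sub>R q j)) = ?A (Q j) u + (\<Sum>i\<in>UNIV. c i * ?A (Q j) (q i))"
      by (simp add: A.add_right A.sum_right A.scaleR_right)
    have P: "p (Q j) (u + (\<Sum>j\<in>UNIV. c j *\<^sub>R q j)) = p (Q j) u + (\<Sum>i\<in>UNIV. c i * p (Q j) (q i))"
      by (simp add: p.add_right p.sum_right p.scaleR_right)
    have "p (Q j) z\<^sub>0 = \<zeta> * p (Q j) y - p (Q j) (\<zeta> *\<^sub>R y - z\<^sub>0)"
      by (simp add: p.diff_right p.scaleR_right)
    also have "\<dots> = d j + (\<Sum>i\<in>UNIV. \<kappa> \<zeta> j i * c i)"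
      unfolding y0[of "Q j"] u0 A P d_def \<kappa>_def
      by (simp add: algebra_simps sum_subtractf sum_distrib_left)
    also have "\<dots> = c j"
      using c[of j] by simp
    finally show ?thesis .
  qed
  then have "z = z\<^sub>0 + (\<Sum>j\<in>UNIV. p (Q j) z\<^sub>0 *\<^sub>R q j)"
    by (simp add: z\<^sub>0_def)
  moreover have "(y, z\<^sub>0) \<in> twin_generator p S\<^sub>0"
    by (rule generator_single_resolvent[OF semigroup \<zeta>0 y0])
  ultimately show ?thesis
    using that by blast
qed

lemma generator_S: "twin_generator p S `` {y} =
    {z + (\<Sum>j\<in>UNIV. p (Q j) z *\<^sub>R q j) | z. z \<in> twin_generator p S\<^sub>0 `` {y}}"
proof (intro equalityI subsetI)
  fix x assume "x \<in> twin_generator p S `` {y}"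
  then have "(y, x) \<in> twin_generator p S" by simp
  then show "x \<in> {z + (\<Sum>j\<in>UNIV. p (Q j) z *\<^sub>R q j) | z. z \<in> twin_generator p S\<^sub>0 `` {y}}"
    by (rule generator_superset) auto
next
  fix x assume "x \<in> {z + (\<Sum>j\<in>UNIV. p (Q j) z *\<^sub>R q j) | z. z \<in> twin_generator p S\<^sub>0 `` {y}}"
  then show "x \<in> twin_generator p S `` {y}"
    using generator_subset by auto
qed

end

theorem theorem10p2:
  fixes p :: "'b::banach \<Rightarrow> 'a::banach \<Rightarrow> real"
    and S\<^sub>0 :: "real \<Rightarrow> 'b \<Rightarrow> 'a \<Rightarrow> real"
    and q :: "'n::finite \<Rightarrow> 'a"
    and Q :: "'n \<Rightarrow> 'b"
    and R :: "real \<Rightarrow> real^'n^'n"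
  assumes "norming_dual_pair p"
    and "sequentially_complete (pairing_topology p)"
    and "\<And>\<phi>. linear \<phi> \<Longrightarrow> seq_continuous_functional (pairing_topology p) \<phi> \<Longrightarrow>
           continuous_map (pairing_topology p) euclideanreal \<phi>"
    and "twin_semigroup p S\<^sub>0"
    and "\<And>i j. NBV_loc (\<lambda>t. pert_kernel p S\<^sub>0 q Q t $ i $ j)"
    and "\<And>i j. continuous (at 0 within {0..}) (\<lambda>t. pert_kernel p S\<^sub>0 q Q t $ i $ j)"
    and "is_resolvent (pert_kernel p S\<^sub>0 q Q) R"
    and "\<And>y'. NBV_loc (pert_W\<^sub>0 S\<^sub>0 q y')"
  shows "(\<forall>y'. NBV_loc (pert_W S\<^sub>0 q R y')) \<and>
         twin_semigroup p (pert_semigroup p S\<^sub>0 q Q R) \<and>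
         Domain (twin_generator p (pert_semigroup p S\<^sub>0 q Q R)) = Domain (twin_generator p S\<^sub>0) \<and>
         (\<forall>y. twin_generator p (pert_semigroup p S\<^sub>0 q Q R) `` {y} =
              {z + (\<Sum>j\<in>UNIV. p (Q j) z *\<^sub>R q j) | z. z \<in> twin_generator p S\<^sub>0 `` {y}})"
proof -
  obtain M\<^sub>0 \<omega>\<^sub>0 where sg: "twin_semigroup_bound p S\<^sub>0 M\<^sub>0 \<omega>\<^sub>0"
    using assms(4) by (auto simp: twin_semigroup_def)
  interpret twin_perturbation p S\<^sub>0 q Q R M\<^sub>0 \<omega>\<^sub>0
    by unfold_locales (fact assms sg)+
  have eq: "twin_generator p (pert_semigroup p S\<^sub>0 q Q R) = twin_generator p S"
    by (rule twin_semigroup_cong(2)) (rule pert_semigroup_eq)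
  have "NBV_loc (pert_W S\<^sub>0 q R y')" for y'
    using W_NBV[of y'] by (intro NBV_loc_vecI) (simp add: W_def[abs_def])
  moreover have "twin_semigroup p (pert_semigroup p S\<^sub>0 q Q R)"
  proof -
    obtain M \<omega> where "1 \<le> M" "0 \<le> \<omega>" "\<omega>\<^sub>0 \<le> \<omega>" "exp_family S\<^sub>0 M \<omega>" "exp_family S M \<omega>"
      by (rule common_growth) (rule that; assumption)
    then have "twin_semigroup_bound p S M \<omega>"
      by (intro S_semigroup)
    then have "twin_semigroup_bound p (pert_semigroup p S\<^sub>0 q Q R) M \<omega>"
      by (subst twin_semigroup_cong(1)[OF pert_semigroup_eq])
    then show ?thesis
      unfolding twin_semigroup_def by blast
  qed
  moreover have gen: "twin_generator p (pert_semigroup p S\<^sub>0 q Q R) `` {y} =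
      {z + (\<Sum>j\<in>UNIV. p (Q j) z *\<^sub>R q j) | z. z \<in> twin_generator p S\<^sub>0 `` {y}}" for y
    unfolding eq by (rule generator_S)
  moreover have "Domain (twin_generator p (pert_semigroup p S\<^sub>0 q Q R)) = Domain (twin_generator p S\<^sub>0)"
  proof -
    have "y \<in> Domain (twin_generator p (pert_semigroup p S\<^sub>0 q Q R)) \<longleftrightarrow> y \<in> Domain (twin_generator p S\<^sub>0)" for y
      using gen[of y] by blast
    then show ?thesis by blast
  qed
  ultimately show ?thesis
    by blast
qed

end
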